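(* Let $k$ be a field of characteristic not $2$ or $3$. Let $\pi:\mathfrak{g}\rightarrow\mathfrak{so}_{\epsilon}(V,(\ ,\ ))$ be a finite-dimensional $\epsilon$-orthogonal representation, with $\dim V\ge 2$, of colour Lie type of a finite-dimensional $\epsilon$-quadratic colour Lie algebra $(\mathfrak{g},B_{\mathfrak{g}})$. Let $\tilde{\mathfrak{g}}=\mathfrak{g}\oplus V$ be the associated colour Lie algebra and let $\tilde{D}$ be the cubic Dirac operator. Then in $U_{\epsilon}(\tilde{\mathfrak{g}})\otimes C_{\epsilon}(V,(\ ,\ ))$ we have $$\tilde{D}^2=\Omega(\tilde{\mathfrak{g}})\otimes 1-\Delta(\Omega(\mathfrak{g}))+\frac{1}{24}\Big(Tr_{\epsilon}(ad_{\tilde{\mathfrak{g}}}(\Omega(\tilde{\mathfrak{g}})))-Tr_{\epsilon}(ad_{\mathfrak{g}}(\Omega(\mathfrak{g})))\Big)\, 1\otimes 1,$$ where $\Omega(\tilde{\mathfrak{g}})$ (resp. $\Omega(\mathfrak{g})$) is the Casimir element of $\tilde{\mathfrak{g}}$ (resp. $\mathfrak{g}$).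
   Context: Graded conventions. $\Gamma$ is an abelian group (additive) and $\epsilon:\Gamma\times\Gamma\to k^{\times}$ is a commutation factor: $\epsilon(a,b)\epsilon(b,a)=1$, $\epsilon(a+b,c)=\epsilon(a,c)\epsilon(b,c)$, $\epsilon(a,b+c)=\epsilon(a,b)\epsilon(a,c)$. For homogeneous $v,w$ write $\epsilon(v,w)=\epsilon(|v|,|w|)$, $\epsilon(v)=\epsilon(|v|,|v|)$. Formulas involving degrees are for homogeneous elements and extended by linearity; bases are homogeneous; bilinear forms are of degree $0$ ($B(V_a,V_b)=0$ unless $a+b=0$). A bilinear map $B$ is $\epsilon$-symmetric if $B(v,w)=\epsilon(v,w)B(w,v)$, $\epsilon$-antisymmetric if $B(v,w)=-\epsilon(v,w)B(w,v)$. For a basis $\{e_i\}$ of a finite-dimensional space with a non-degenerate $\epsilon$-symmetric form, the dual basis $\{e^i\}$ is defined by $(e_i,e^j)=\delta_{ij}$. $Tr_\epsilon(f)=Tr(\mathcal{E}\circ f)$ where $\mathcal{E}(v)=\epsilon(v)v$. Colour Lie algebra: a $\Gamma$-graded space with bilinear bracket satisfying $\{\mathfrak{g}_a,\mathfrak{g}_b\}\subseteq\mathfrak{g}_{a+b}$, $\{x,y\}=-\epsilon(x,y)\{y,x\}$, $\epsilon(z,x)\{x,\{y,z\}\}+\epsilon(x,y)\{y,\{z,x\}\}+\epsilon(y,z)\{z,\{x,y\}\}=0$. It is $\epsilon$-quadratic if equipped with a non-degenerate $\epsilon$-symmetric form $B$ with $B(\{x,y\},z)=-\epsilon(x,y)B(y,\{x,z\})$.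 $\mathfrak{so}_\epsilon(V,(\ ,\ ))$ is the colour Lie algebra spanned by homogeneous $f\in\mathrm{End}(V)$ with $(f(v),w)+\epsilon(f,v)(v,f(w))=0$, with bracket $fg-\epsilon(f,g)gf$. An $\epsilon$-orthogonal representation is a $\Gamma$-graded space $V$ with a non-degenerate $\epsilon$-symmetric form and a degree $0$ morphism of colour Lie algebras $\pi:\mathfrak{g}\to\mathfrak{so}_\epsilon(V,(\ ,\ ))$. $ad(x)=\{x,\cdot\}$, extended to the enveloping algebra. $U_\epsilon(\mathfrak{g})=T(\mathfrak{g})/\langle x\otimes y-\epsilon(x,y)y\otimes x-\{x,y\}\rangle$; Casimir element $\Omega(\mathfrak{g})=\sum_i x^ix_i$ for a basis $\{x_i\}$ of $\mathfrak{g}$ with dual basis $\{x^i\}$ for the quadratic form. $C_\epsilon(V,(\ ,\ ))=T(V)/\langle x\otimes y+\epsilon(x,y)y\otimes x-2(x,y)1\rangle$, which is $\mathbb{Z}_2\times\Gamma$-graded; $\Lambda_\epsilon(V)=T(V)/\langle x\otimes y+\epsilon(x,y)y\otimes x\rangle$. Moment map: $\mu:\Lambda^2_\epsilon(V)\to\mathfrak{g}$ is given by $B_{\mathfrak{g}}(x,\mu(v,w))=(\pi(x)(v),w)$. Colour Lie type: $\pi$ is of colour Lie type if there is a degree $0$ $\epsilon$-antisymmetric bilinear map $\phi:V\times V\to V$ with $\pi(x)(\phi(v,w))=\phi(\pi(x)(v),w)+\epsilon(x,v)\phi(v,\pi(x)(w))$ and $(\phi(u,v),w)=-\epsilon(u,v)(v,\phi(u,w))$,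 such that $\tilde{\mathfrak{g}}=\mathfrak{g}\oplus V$, with the $\epsilon$-antisymmetric bracket extending that of $\mathfrak{g}$, $\{x,v\}=\pi(x)(v)$ and $\{v,w\}=\mu(v,w)+\phi(v,w)$ ($x\in\mathfrak{g}$, $v,w\in V$), and with $B_{\tilde{\mathfrak{g}}}=B_{\mathfrak{g}}\perp(\ ,\ )$, is an $\epsilon$-quadratic colour Lie algebra. Such a $\phi$ is fixed, and $(\tilde{\mathfrak{g}},B_{\tilde{\mathfrak{g}}})$ is the associated colour Lie algebra. The corresponding cubic term is $$\psi=\frac{1}{12}\sum_{i,j,l}(e^i,\phi(e^j,e^l))\,e_le_je_i\in C_\epsilon(V,(\ ,\ ))$$ for a basis $\{e_i\}$ of $V$ with dual basis $\{e^i\}$ (independent of the basis). Map $\pi_*$: $\pi_*:\mathfrak{g}\to C_\epsilon(V,(\ ,\ ))$, $\pi_*(x)=\frac14\sum_i\pi(x)(e^i)e_i$; it is a morphism of colour Lie algebras for the bracket $x\cdot y-\tilde\epsilon(x,y)y\cdot x$, where $\tilde\epsilon((a_1,\gamma_1),(a_2,\gamma_2))=(-1)^{a_1a_2}\epsilon(\gamma_1,\gamma_2)$ on $\mathbb{Z}_2\times\Gamma$. Cubic Dirac operator: on $U_\epsilon(\tilde{\mathfrak{g}})\otimes C_\epsilon(V,(\ ,\ ))$ (with $U_\epsilon(\tilde{\mathfrak{g}})$ of $\mathbb{Z}_2$-degree $0$) use the product $(a\otimes b)(c\otimes d)=\tilde\epsilon(b,c)\,ac\otimes bd$. Set $D=\sum_ie^i\otimes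 e_i$ and $\tilde D=D+1\otimes\psi$. The map $\Delta:\mathfrak{g}\to U_\epsilon(\tilde{\mathfrak{g}})\otimes C_\epsilon(V,(\ ,\ ))$, $\Delta(x)=x\otimes1+1\otimes\pi_*(x)$, is a colour Lie algebra morphism and is extended to an algebra morphism on $U_\epsilon(\mathfrak{g})$. *)

theory Defs
  imports Complex_Main "HOL-Library.Poly_Mapping" "HOL-Library.Product_Plus" "HOL-Library.Z2"
begin

text \<open>
  Vector spaces over a field \<open>'k\<close> are types with an explicit scalar multiplication \<open>s\<close>
  satisfying \<^locale>\<open>vector_space\<close>; a grading by an abelian group \<open>'a\<close> is the family \<open>G\<close> of
  homogeneous subspaces.
\<close>

subsection \<open>Graded spaces and forms\<close>

definition commutation_factor :: "('a::ab_group_add \<Rightarrow> 'a \<Rightarrow> 'k::field) \<Rightarrow> bool" where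
  "commutation_factor \<epsilon> \<longleftrightarrow>
     (\<forall>a b. \<epsilon> a b * \<epsilon> b a = 1) \<and>
     (\<forall>a b c. \<epsilon> (a + b) c = \<epsilon> a c * \<epsilon> b c) \<and>
     (\<forall>a b c. \<epsilon> a (b + c) = \<epsilon> a b * \<epsilon> a c)"

definition homogeneous_decomp :: "('a \<Rightarrow> 'v::ab_group_add set) \<Rightarrow> 'v \<Rightarrow> ('a \<Rightarrow> 'v) \<Rightarrow> bool" where
  "homogeneous_decomp G v f \<longleftrightarrow>
     (\<forall>a. f a \<in> G a) \<and> finite {a. f a \<noteq> 0} \<and> v = (\<Sum>a | f a \<noteq> 0. f a)"

definition graded_space ::
  "('k::field \<Rightarrow> 'v::ab_group_add \<Rightarrow> 'v) \<Rightarrow> ('a \<Rightarrow> 'v set) \<Rightarrow> bool" where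
  "graded_space s G \<longleftrightarrow>
     vector_space s \<and> (\<forall>a. module.subspace s (G a)) \<and> (\<forall>v. \<exists>!f. homogeneous_decomp G v f)"

definition hcomp :: "('a \<Rightarrow> 'v::ab_group_add set) \<Rightarrow> 'v \<Rightarrow> 'a \<Rightarrow> 'v" where
  "hcomp G v = (THE f. homogeneous_decomp G v f)"

definition bilinear_map ::
  "('k::field \<Rightarrow> 'u::ab_group_add \<Rightarrow> 'u) \<Rightarrow> ('k \<Rightarrow> 'v::ab_group_add \<Rightarrow> 'v) \<Rightarrow>
   ('k \<Rightarrow> 'w::ab_group_add \<Rightarrow> 'w) \<Rightarrow> ('u \<Rightarrow> 'v \<Rightarrow> 'w) \<Rightarrow> bool" where
  "bilinear_map s1 s2 s3 f \<longleftrightarrow>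
     (\<forall>u. Vector_Spaces.linear s2 s3 (\<lambda>v. f u v)) \<and>
     (\<forall>v. Vector_Spaces.linear s1 s3 (\<lambda>u. f u v))"

definition eps_symmetric_form ::
  "('k::field \<Rightarrow> 'v::ab_group_add \<Rightarrow> 'v) \<Rightarrow> ('a::ab_group_add \<Rightarrow> 'v set) \<Rightarrow> ('a \<Rightarrow> 'a \<Rightarrow> 'k) \<Rightarrow>
   ('v \<Rightarrow> 'v \<Rightarrow> 'k) \<Rightarrow> bool" where
  "eps_symmetric_form s G \<epsilon> B \<longleftrightarrow>
     bilinear_map s s (*) B \<and>
     (\<forall>a b. \<forall>v\<in>G a. \<forall>w\<in>G b. a + b \<noteq> 0 \<longrightarrow> B v w = 0) \<and>
     (\<forall>a b. \<forall>v\<in>G a. \<forall>w\<in>G b. B v w = \<epsilon> a b * B w v)"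

definition nondegenerate :: "('v::zero \<Rightarrow> 'v \<Rightarrow> 'k::zero) \<Rightarrow> bool" where
  "nondegenerate B \<longleftrightarrow>
     (\<forall>v. (\<forall>w. B v w = 0) \<longrightarrow> v = 0) \<and> (\<forall>w. (\<forall>v. B v w = 0) \<longrightarrow> w = 0)"

definition homogeneous_basis ::
  "('k::field \<Rightarrow> 'v::ab_group_add \<Rightarrow> 'v) \<Rightarrow> ('a \<Rightarrow> 'v set) \<Rightarrow> 'v set \<Rightarrow> bool" where
  "homogeneous_basis s G E \<longleftrightarrow>
     finite_dimensional_vector_space s E \<and> (\<forall>e\<in>E. \<exists>a. e \<in> G a)"

text \<open>\<open>dual_basis B E e\<close> is the member of the dual basis of \<open>E\<close> with the index of \<open>e \<in> E\<close>.\<close>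

definition dual_basis :: "('v \<Rightarrow> 'v \<Rightarrow> 'k::zero_neq_one) \<Rightarrow> 'v set \<Rightarrow> 'v \<Rightarrow> 'v" where
  "dual_basis B E e = (THE d. \<forall>f\<in>E. B f d = (if f = e then 1 else 0))"

definition lin_trace ::
  "('k::field \<Rightarrow> 'v::ab_group_add \<Rightarrow> 'v) \<Rightarrow> ('v \<Rightarrow> 'v) \<Rightarrow> 'k" where
  "lin_trace s f =
     (let E = (SOME E. finite_dimensional_vector_space s E)
      in \<Sum>e\<in>E. module.representation s E (f e) e)"

definition eps_op ::
  "('k::field \<Rightarrow> 'v::ab_group_add \<Rightarrow> 'v) \<Rightarrow> ('a \<Rightarrow> 'v set) \<Rightarrow> ('a \<Rightarrow> 'a \<Rightarrow> 'k) \<Rightarrow> 'v \<Rightarrow> 'v" where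
  "eps_op s G \<epsilon> v = (\<Sum>a | hcomp G v a \<noteq> 0. s (\<epsilon> a a) (hcomp G v a))"

definition eps_trace ::
  "('k::field \<Rightarrow> 'v::ab_group_add \<Rightarrow> 'v) \<Rightarrow> ('a \<Rightarrow> 'v set) \<Rightarrow> ('a \<Rightarrow> 'a \<Rightarrow> 'k) \<Rightarrow>
   ('v \<Rightarrow> 'v) \<Rightarrow> 'k" where
  "eps_trace s G \<epsilon> f = lin_trace s (eps_op s G \<epsilon> \<circ> f)"

subsection \<open>Colour Lie algebras and their representations\<close>

definition colour_lie_algebra ::
  "('k::field \<Rightarrow> 'g::ab_group_add \<Rightarrow> 'g) \<Rightarrow> ('a::ab_group_add \<Rightarrow> 'g set) \<Rightarrow> ('a \<Rightarrow> 'a \<Rightarrow> 'k) \<Rightarrow>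
   ('g \<Rightarrow> 'g \<Rightarrow> 'g) \<Rightarrow> bool" where
  "colour_lie_algebra s G \<epsilon> br \<longleftrightarrow>
     graded_space s G \<and> bilinear_map s s s br \<and>
     (\<forall>a b. \<forall>x\<in>G a. \<forall>y\<in>G b. br x y \<in> G (a + b)) \<and>
     (\<forall>a b. \<forall>x\<in>G a. \<forall>y\<in>G b. br x y = - s (\<epsilon> a b) (br y x)) \<and>
     (\<forall>a b c. \<forall>x\<in>G a. \<forall>y\<in>G b. \<forall>z\<in>G c.
        s (\<epsilon> c a) (br x (br y z)) + s (\<epsilon> a b) (br y (br z x)) + s (\<epsilon> b c) (br z (br x y)) = 0)"

definition eps_quadratic ::
  "('k::field \<Rightarrow> 'g::ab_group_add \<Rightarrow> 'g) \<Rightarrow> ('a::ab_group_add \<Rightarrow> 'g set) \<Rightarrow> ('a \<Rightarrow> 'a \<Rightarrow> 'k) \<Rightarrow>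
   ('g \<Rightarrow> 'g \<Rightarrow> 'g) \<Rightarrow> ('g \<Rightarrow> 'g \<Rightarrow> 'k) \<Rightarrow> bool" where
  "eps_quadratic s G \<epsilon> br B \<longleftrightarrow>
     colour_lie_algebra s G \<epsilon> br \<and> eps_symmetric_form s G \<epsilon> B \<and> nondegenerate B \<and>
     (\<forall>a b. \<forall>x\<in>G a. \<forall>y\<in>G b. \<forall>z. B (br x y) z = - \<epsilon> a b * B y (br x z))"

text \<open>The component of degree \<open>a\<close> of \<open>so\<^sub>\<epsilon>(V, B)\<close>.\<close>

definition so_eps ::
  "('k::field \<Rightarrow> 'v::ab_group_add \<Rightarrow> 'v) \<Rightarrow> ('a::ab_group_add \<Rightarrow> 'v set) \<Rightarrow> ('a \<Rightarrow> 'a \<Rightarrow> 'k) \<Rightarrow>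
   ('v \<Rightarrow> 'v \<Rightarrow> 'k) \<Rightarrow> 'a \<Rightarrow> ('v \<Rightarrow> 'v) set" where
  "so_eps s G \<epsilon> B a =
     {f. Vector_Spaces.linear s s f \<and> (\<forall>b. f ` G b \<subseteq> G (a + b)) \<and>
         (\<forall>b. \<forall>v\<in>G b. \<forall>w. B (f v) w + \<epsilon> a b * B v (f w) = 0)}"

definition orthogonal_rep ::
  "('k::field \<Rightarrow> 'g::ab_group_add \<Rightarrow> 'g) \<Rightarrow> ('a::ab_group_add \<Rightarrow> 'g set) \<Rightarrow> ('a \<Rightarrow> 'a \<Rightarrow> 'k) \<Rightarrow>
   ('g \<Rightarrow> 'g \<Rightarrow> 'g) \<Rightarrow>
   ('k \<Rightarrow> 'v::ab_group_add \<Rightarrow> 'v) \<Rightarrow> ('a \<Rightarrow> 'v set) \<Rightarrow> ('v \<Rightarrow> 'v \<Rightarrow> 'k) \<Rightarrow>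
   ('g \<Rightarrow> 'v \<Rightarrow> 'v) \<Rightarrow> bool" where
  "orthogonal_rep sg Gg \<epsilon> brg sv Gv Bv \<pi> \<longleftrightarrow>
     graded_space sv Gv \<and> eps_symmetric_form sv Gv \<epsilon> Bv \<and> nondegenerate Bv \<and>
     (\<forall>v. Vector_Spaces.linear sg sv (\<lambda>x. \<pi> x v)) \<and>
     (\<forall>a. \<forall>x\<in>Gg a. \<pi> x \<in> so_eps sv Gv \<epsilon> Bv a) \<and>
     (\<forall>a b. \<forall>x\<in>Gg a. \<forall>y\<in>Gg b. \<forall>v.
        \<pi> (brg x y) v = \<pi> x (\<pi> y v) - sv (\<epsilon> a b) (\<pi> y (\<pi> x v)))"

text \<open>The moment map, as an \<open>\<epsilon>\<close>-antisymmetric bilinear map on \<open>V \<times> V\<close>.\<close>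

definition moment_map ::
  "('g \<Rightarrow> 'g \<Rightarrow> 'k) \<Rightarrow> ('v \<Rightarrow> 'v \<Rightarrow> 'k) \<Rightarrow> ('g \<Rightarrow> 'v \<Rightarrow> 'v) \<Rightarrow> 'v \<Rightarrow> 'v \<Rightarrow> 'g" where
  "moment_map Bg Bv \<pi> v w = (THE m. \<forall>x. Bg x m = Bv (\<pi> x v) w)"

definition ext_scale ::
  "('k \<Rightarrow> 'g \<Rightarrow> 'g) \<Rightarrow> ('k \<Rightarrow> 'v \<Rightarrow> 'v) \<Rightarrow> 'k \<Rightarrow> 'g \<times> 'v \<Rightarrow> 'g \<times> 'v" where
  "ext_scale sg sv c = map_prod (sg c) (sv c)"

definition ext_part :: "('a \<Rightarrow> 'g set) \<Rightarrow> ('a \<Rightarrow> 'v set) \<Rightarrow> 'a \<Rightarrow> ('g \<times> 'v) set" where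
  "ext_part Gg Gv a = Gg a \<times> Gv a"

definition ext_form ::
  "('g \<Rightarrow> 'g \<Rightarrow> 'k::plus) \<Rightarrow> ('v \<Rightarrow> 'v \<Rightarrow> 'k) \<Rightarrow> 'g \<times> 'v \<Rightarrow> 'g \<times> 'v \<Rightarrow> 'k" where
  "ext_form Bg Bv p q = Bg (fst p) (fst q) + Bv (snd p) (snd q)"

text \<open>
  The bracket on \<open>\<g> \<oplus> V\<close>. The double sum is the bilinear extension of \<open>\<epsilon>(v, y) \<pi>(y)(v)\<close>, so that
  \<open>{v, y} = - \<epsilon>(v, y) {y, v}\<close> for homogeneous \<open>v \<in> V\<close> and \<open>y \<in> \<g>\<close>.
\<close>

definition ext_bracket ::
  "('a \<Rightarrow> 'g::ab_group_add set) \<Rightarrow> ('a \<Rightarrow> 'a \<Rightarrow> 'k) \<Rightarrow> ('g \<Rightarrow> 'g \<Rightarrow> 'g) \<Rightarrow> ('g \<Rightarrow> 'g \<Rightarrow> 'k) \<Rightarrow>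
   ('k \<Rightarrow> 'v::ab_group_add \<Rightarrow> 'v) \<Rightarrow> ('a \<Rightarrow> 'v set) \<Rightarrow> ('v \<Rightarrow> 'v \<Rightarrow> 'k) \<Rightarrow>
   ('g \<Rightarrow> 'v \<Rightarrow> 'v) \<Rightarrow> ('v \<Rightarrow> 'v \<Rightarrow> 'v) \<Rightarrow> 'g \<times> 'v \<Rightarrow> 'g \<times> 'v \<Rightarrow> 'g \<times> 'v" where
  "ext_bracket Gg \<epsilon> brg Bg sv Gv Bv \<pi> \<phi> = (\<lambda>(x, v) (y, w).
     (brg x y + moment_map Bg Bv \<pi> v w,
      \<pi> x w
      - (\<Sum>a | hcomp Gv v a \<noteq> 0. \<Sum>b | hcomp Gg y b \<noteq> 0.
           sv (\<epsilon> a b) (\<pi> (hcomp Gg y b) (hcomp Gv v a)))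
      + \<phi> v w))"

definition colour_lie_type ::
  "('k::field \<Rightarrow> 'g::ab_group_add \<Rightarrow> 'g) \<Rightarrow> ('a::ab_group_add \<Rightarrow> 'g set) \<Rightarrow> ('a \<Rightarrow> 'a \<Rightarrow> 'k) \<Rightarrow>
   ('g \<Rightarrow> 'g \<Rightarrow> 'g) \<Rightarrow> ('g \<Rightarrow> 'g \<Rightarrow> 'k) \<Rightarrow>
   ('k \<Rightarrow> 'v::ab_group_add \<Rightarrow> 'v) \<Rightarrow> ('a \<Rightarrow> 'v set) \<Rightarrow> ('v \<Rightarrow> 'v \<Rightarrow> 'k) \<Rightarrow>
   ('g \<Rightarrow> 'v \<Rightarrow> 'v) \<Rightarrow> ('v \<Rightarrow> 'v \<Rightarrow> 'v) \<Rightarrow> bool" where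
  "colour_lie_type sg Gg \<epsilon> brg Bg sv Gv Bv \<pi> \<phi> \<longleftrightarrow>
     bilinear_map sv sv sv \<phi> \<and>
     (\<forall>a b. \<forall>v\<in>Gv a. \<forall>w\<in>Gv b. \<phi> v w \<in> Gv (a + b)) \<and>
     (\<forall>a b. \<forall>v\<in>Gv a. \<forall>w\<in>Gv b. \<phi> v w = - sv (\<epsilon> a b) (\<phi> w v)) \<and>
     (\<forall>a b. \<forall>x\<in>Gg a. \<forall>v\<in>Gv b. \<forall>w. \<pi> x (\<phi> v w) = \<phi> (\<pi> x v) w + sv (\<epsilon> a b) (\<phi> v (\<pi> x w))) \<and>
     (\<forall>a b. \<forall>u\<in>Gv a. \<forall>v\<in>Gv b. \<forall>w. Bv (\<phi> u v) w = - \<epsilon> a b * Bv v (\<phi> u w)) \<and>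
     eps_quadratic (ext_scale sg sv) (ext_part Gg Gv) \<epsilon>
       (ext_bracket Gg \<epsilon> brg Bg sv Gv Bv \<pi> \<phi>) (ext_form Bg Bv)"

subsection \<open>Algebras given by generators and relations\<close>

datatype 'x free_monoid = Word (letters: "'x list")

instantiation free_monoid :: (type) monoid_add
begin

definition zero_free_monoid :: "'a free_monoid" where
  "0 = Word []"

definition plus_free_monoid :: "'a free_monoid \<Rightarrow> 'a free_monoid \<Rightarrow> 'a free_monoid" where
  "u + v = Word (letters u @ letters v)"

instance
  by standard (simp_all add: zero_free_monoid_def plus_free_monoid_def)

end

text \<open>The free associative unital algebra on the set of all elements of \<open>'x\<close>.\<close>

type_synonym ('x, 'k) free_algebra = "'x free_monoid \<Rightarrow>\<^sub>0 'k"

definition gen :: "'x \<Rightarrow> ('x, 'k::zero_neq_one) free_algebra" where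
  "gen x = Poly_Mapping.single (Word [x]) 1"

definition const :: "'k::zero \<Rightarrow> ('x, 'k) free_algebra" where
  "const c = Poly_Mapping.single 0 c"

inductive_set ideal_gen :: "'r::ring_1 set \<Rightarrow> 'r set" for R where
  zero: "0 \<in> ideal_gen R"
| base: "r \<in> R \<Longrightarrow> r \<in> ideal_gen R"
| add: "p \<in> ideal_gen R \<Longrightarrow> q \<in> ideal_gen R \<Longrightarrow> p + q \<in> ideal_gen R"
| mult_left: "p \<in> ideal_gen R \<Longrightarrow> q * p \<in> ideal_gen R"
| mult_right: "p \<in> ideal_gen R \<Longrightarrow> p * q \<in> ideal_gen R"

definition algebra_over :: "('k::field \<Rightarrow> 'u::ring_1 \<Rightarrow> 'u) \<Rightarrow> bool" where
  "algebra_over s \<longleftrightarrow>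
     vector_space s \<and> (\<forall>c u v. s c (u * v) = s c u * v) \<and> (\<forall>c u v. s c (u * v) = u * s c v)"

definition algebra_hom ::
  "('k::field \<Rightarrow> 'u::ring_1 \<Rightarrow> 'u) \<Rightarrow> ('k \<Rightarrow> 'w::ring_1 \<Rightarrow> 'w) \<Rightarrow> ('u \<Rightarrow> 'w) \<Rightarrow> bool" where
  "algebra_hom s1 s2 F \<longleftrightarrow>
     Vector_Spaces.linear s1 s2 F \<and> F 1 = 1 \<and> (\<forall>u v. F (u * v) = F u * F v)"

definition free_eval ::
  "('k::zero \<Rightarrow> 'u::ring_1 \<Rightarrow> 'u) \<Rightarrow> ('x \<Rightarrow> 'u) \<Rightarrow> ('x, 'k) free_algebra \<Rightarrow> 'u" where
  "free_eval s \<iota> p =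
     (\<Sum>w\<in>Poly_Mapping.keys p. s (Poly_Mapping.lookup p w) (prod_list (map \<iota> (letters w))))"

text \<open>
  \<open>presented_algebra s \<iota> R\<close>: the algebra \<open>'u\<close> is the quotient of the free algebra on \<open>'x\<close> by the
  two-sided ideal generated by \<open>R\<close>, and \<open>\<iota> x\<close> is the class of the generator \<open>x\<close>.
\<close>

definition presented_algebra ::
  "('k::field \<Rightarrow> 'u::ring_1 \<Rightarrow> 'u) \<Rightarrow> ('x \<Rightarrow> 'u) \<Rightarrow> ('x, 'k) free_algebra set \<Rightarrow> bool" where
  "presented_algebra s \<iota> R \<longleftrightarrow>
     algebra_over s \<and> range (free_eval s \<iota>) = UNIV \<and> {p. free_eval s \<iota> p = 0} = ideal_gen R"

text \<open>
  The free algebra on the underlying set of a vector space modulo the following relations is its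
  tensor algebra, hence adding further relations to them gives a quotient of the tensor algebra.
\<close>

definition tensor_rels ::
  "('k::field \<Rightarrow> 'x::ab_group_add \<Rightarrow> 'x) \<Rightarrow> ('x, 'k) free_algebra set" where
  "tensor_rels s =
     {gen (x + y) - gen x - gen y |x y. True} \<union> {gen (s c x) - const c * gen x |c x. True}"

definition enveloping_algebra ::
  "('k::field \<Rightarrow> 'g::ab_group_add \<Rightarrow> 'g) \<Rightarrow> ('a \<Rightarrow> 'g set) \<Rightarrow> ('a \<Rightarrow> 'a \<Rightarrow> 'k) \<Rightarrow>
   ('g \<Rightarrow> 'g \<Rightarrow> 'g) \<Rightarrow> ('k \<Rightarrow> 'u::ring_1 \<Rightarrow> 'u) \<Rightarrow> ('g \<Rightarrow> 'u) \<Rightarrow> bool" where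
  "enveloping_algebra s G \<epsilon> br sU \<iota> \<longleftrightarrow>
     presented_algebra sU \<iota> (tensor_rels s \<union>
       {gen x * gen y - const (\<epsilon> a b) * gen y * gen x - gen (br x y) |a b x y. x \<in> G a \<and> y \<in> G b})"

definition clifford_algebra ::
  "('k::field \<Rightarrow> 'v::ab_group_add \<Rightarrow> 'v) \<Rightarrow> ('a \<Rightarrow> 'v set) \<Rightarrow> ('a \<Rightarrow> 'a \<Rightarrow> 'k) \<Rightarrow>
   ('v \<Rightarrow> 'v \<Rightarrow> 'k) \<Rightarrow> ('k \<Rightarrow> 'c::ring_1 \<Rightarrow> 'c) \<Rightarrow> ('v \<Rightarrow> 'c) \<Rightarrow> bool" where
  "clifford_algebra s G \<epsilon> B sC \<iota> \<longleftrightarrow>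
     presented_algebra sC \<iota> (tensor_rels s \<union>
       {gen x * gen y + const (\<epsilon> a b) * gen y * gen x - const (2 * B x y) |a b x y.
          x \<in> G a \<and> y \<in> G b})"

text \<open>The grading of an algebra induced by a grading \<open>P\<close> of its generators.\<close>

definition algebra_part ::
  "('k::field \<Rightarrow> 'u::ring_1 \<Rightarrow> 'u) \<Rightarrow> ('x \<Rightarrow> 'u) \<Rightarrow> ('b::ab_group_add \<Rightarrow> 'x set) \<Rightarrow> 'b \<Rightarrow> 'u set" where
  "algebra_part s \<iota> P i =
     module.span s {prod_list (map \<iota> xs) |xs is.
       list_all2 (\<lambda>x j. x \<in> P j) xs is \<and> sum_list is = i}"

text \<open>The \<open>\<int>\<^sub>2 \<times> \<Gamma>\<close>-grading of a \<open>\<Gamma>\<close>-graded space placed in \<open>\<int>\<^sub>2\<close>-degree \<open>z\<close>.\<close>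

definition z2_part :: "bit \<Rightarrow> ('a \<Rightarrow> 'x::zero set) \<Rightarrow> bit \<times> 'a \<Rightarrow> 'x set" where
  "z2_part z G = (\<lambda>(y, a). if y = z then G a else {0})"

definition eps_tilde :: "('a \<Rightarrow> 'a \<Rightarrow> 'k::field) \<Rightarrow> bit \<times> 'a \<Rightarrow> bit \<times> 'a \<Rightarrow> 'k" where
  "eps_tilde \<epsilon> = (\<lambda>(z1, a1) (z2, a2). (if z1 * z2 = 1 then -1 else 1) * \<epsilon> a1 a2)"

subsection \<open>Tensor products\<close>

text \<open>
  \<open>tensor_product s1 s2 s3 t\<close>: the space \<open>'w\<close> with \<open>t u v\<close> as \<open>u \<otimes> v\<close> is the tensor product, that is,
  the quotient of the vector space with basis \<open>'u \<times> 'v\<close> by the bilinearity relations.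
\<close>

definition free_scale :: "'k::field \<Rightarrow> ('x \<Rightarrow>\<^sub>0 'k) \<Rightarrow> ('x \<Rightarrow>\<^sub>0 'k)" where
  "free_scale c = Poly_Mapping.map ((*) c)"

definition bilinearity_rels ::
  "('k::field \<Rightarrow> 'u::ab_group_add \<Rightarrow> 'u) \<Rightarrow> ('k \<Rightarrow> 'v::ab_group_add \<Rightarrow> 'v) \<Rightarrow>
   ('u \<times> 'v \<Rightarrow>\<^sub>0 'k) set" where
  "bilinearity_rels s1 s2 =
     (let b = (\<lambda>u v. Poly_Mapping.single (u, v) (1::'k)) in
       {b (u + u') v - b u v - b u' v |u u' v. True} \<union>
       {b u (v + v') - b u v - b u v' |u v v'. True} \<union>
       {b (s1 c u) v - free_scale c (b u v) |c u v. True} \<union>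
       {b u (s2 c v) - free_scale c (b u v) |c u v. True})"

definition tensor_eval ::
  "('k::zero \<Rightarrow> 'w::comm_monoid_add \<Rightarrow> 'w) \<Rightarrow> ('u \<Rightarrow> 'v \<Rightarrow> 'w) \<Rightarrow> ('u \<times> 'v \<Rightarrow>\<^sub>0 'k) \<Rightarrow> 'w" where
  "tensor_eval s3 t p = (\<Sum>(u, v)\<in>Poly_Mapping.keys p. s3 (Poly_Mapping.lookup p (u, v)) (t u v))"

definition tensor_product ::
  "('k::field \<Rightarrow> 'u::ab_group_add \<Rightarrow> 'u) \<Rightarrow> ('k \<Rightarrow> 'v::ab_group_add \<Rightarrow> 'v) \<Rightarrow>
   ('k \<Rightarrow> 'w::ab_group_add \<Rightarrow> 'w) \<Rightarrow> ('u \<Rightarrow> 'v \<Rightarrow> 'w) \<Rightarrow> bool" where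
  "tensor_product s1 s2 s3 t \<longleftrightarrow>
     vector_space s3 \<and> range (tensor_eval s3 t) = UNIV \<and>
     {p. tensor_eval s3 t p = 0} = module.span free_scale (bilinearity_rels s1 s2)"

text \<open>
  The tensor product of the algebras \<open>'u\<close> and \<open>'c\<close>, graded by \<open>PU\<close> and \<open>PC\<close>, with the product twisted
  by \<open>\<eta>\<close>: \<open>(a \<otimes> b) (c \<otimes> d) = \<eta>(b, c) ac \<otimes> bd\<close>.
\<close>

definition twisted_tensor_algebra ::
  "('k::field \<Rightarrow> 'u::ring_1 \<Rightarrow> 'u) \<Rightarrow> ('b \<Rightarrow> 'u set) \<Rightarrow> ('k \<Rightarrow> 'c::ring_1 \<Rightarrow> 'c) \<Rightarrow> ('b \<Rightarrow> 'c set) \<Rightarrow>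
   ('b \<Rightarrow> 'b \<Rightarrow> 'k) \<Rightarrow> ('k \<Rightarrow> 'w::ring_1 \<Rightarrow> 'w) \<Rightarrow> ('u \<Rightarrow> 'c \<Rightarrow> 'w) \<Rightarrow> bool" where
  "twisted_tensor_algebra sU PU sC PC \<eta> sW t \<longleftrightarrow>
     algebra_over sW \<and> tensor_product sU sC sW t \<and> t 1 1 = 1 \<and>
     (\<forall>i j a d. \<forall>b\<in>PC i. \<forall>c\<in>PU j. t a b * t c d = sW (\<eta> i j) (t (a * c) (b * d)))"

subsection \<open>Extensions to the enveloping algebra\<close>

definition env_extension ::
  "('k::field \<Rightarrow> 'u::ring_1 \<Rightarrow> 'u) \<Rightarrow> ('g \<Rightarrow> 'u) \<Rightarrow> ('k \<Rightarrow> 'w::ring_1 \<Rightarrow> 'w) \<Rightarrow> ('g \<Rightarrow> 'w) \<Rightarrow>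
   'u \<Rightarrow> 'w" where
  "env_extension sU \<iota> sW f = (THE F. algebra_hom sU sW F \<and> (\<forall>x. F (\<iota> x) = f x))"

text \<open>The extension of the adjoint representation to an algebra morphism \<open>U\<^sub>\<epsilon>(\<g>) \<rightarrow> End(\<g>)\<close>.\<close>

definition ad_extension ::
  "('k::field \<Rightarrow> 'g::ab_group_add \<Rightarrow> 'g) \<Rightarrow> ('g \<Rightarrow> 'g \<Rightarrow> 'g) \<Rightarrow> ('k \<Rightarrow> 'u::ring_1 \<Rightarrow> 'u) \<Rightarrow>
   ('g \<Rightarrow> 'u) \<Rightarrow> 'u \<Rightarrow> 'g \<Rightarrow> 'g" where
  "ad_extension s br sU \<iota> =
     (THE A. (\<forall>x. A (\<iota> x) = br x) \<and> A 1 = id \<and> (\<forall>u v. A (u * v) = A u \<circ> A v) \<and>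
        (\<forall>z. Vector_Spaces.linear sU s (\<lambda>u. A u z)) \<and> (\<forall>u. Vector_Spaces.linear s s (A u)))"

subsection \<open>Casimir element and cubic Dirac operator\<close>

definition casimir :: "('g \<Rightarrow> 'u::ring_1) \<Rightarrow> ('g \<Rightarrow> 'g \<Rightarrow> 'k::zero_neq_one) \<Rightarrow> 'g set \<Rightarrow> 'u" where
  "casimir \<iota> B X = (\<Sum>x\<in>X. \<iota> (dual_basis B X x) * \<iota> x)"

definition cubic_term ::
  "('k::field \<Rightarrow> 'c::ring_1 \<Rightarrow> 'c) \<Rightarrow> ('v \<Rightarrow> 'c) \<Rightarrow> ('v \<Rightarrow> 'v \<Rightarrow> 'k) \<Rightarrow> ('v \<Rightarrow> 'v \<Rightarrow> 'v) \<Rightarrow> 'v set \<Rightarrow> 'c" where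
  "cubic_term sC \<iota> B \<phi> E =
     sC (1 / 12) (\<Sum>ei\<in>E. \<Sum>ej\<in>E. \<Sum>el\<in>E.
       sC (B (dual_basis B E ei) (\<phi> (dual_basis B E ej) (dual_basis B E el))) (\<iota> el * \<iota> ej * \<iota> ei))"

definition pi_star ::
  "('k::field \<Rightarrow> 'c::ring_1 \<Rightarrow> 'c) \<Rightarrow> ('v \<Rightarrow> 'c) \<Rightarrow> ('v \<Rightarrow> 'v \<Rightarrow> 'k) \<Rightarrow> ('g \<Rightarrow> 'v \<Rightarrow> 'v) \<Rightarrow> 'v set \<Rightarrow>
   'g \<Rightarrow> 'c" where
  "pi_star sC \<iota> B \<pi> E x = sC (1 / 4) (\<Sum>e\<in>E. \<iota> (\<pi> x (dual_basis B E e)) * \<iota> e)"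

definition cubic_dirac ::
  "('u::ring_1 \<Rightarrow> 'c::ring_1 \<Rightarrow> 'w::ring_1) \<Rightarrow> ('g::zero \<times> 'v \<Rightarrow> 'u) \<Rightarrow>
   ('k::field \<Rightarrow> 'c \<Rightarrow> 'c) \<Rightarrow> ('v \<Rightarrow> 'c) \<Rightarrow> ('v \<Rightarrow> 'v \<Rightarrow> 'k) \<Rightarrow> ('v \<Rightarrow> 'v \<Rightarrow> 'v) \<Rightarrow> 'v set \<Rightarrow> 'w" where
  "cubic_dirac t \<iota>U sC \<iota>C B \<phi> E =
     (\<Sum>e\<in>E. t (\<iota>U (0, dual_basis B E e)) (\<iota>C e)) + t 1 (cubic_term sC \<iota>C B \<phi> E)"

definition delta_map ::
  "('u::ring_1 \<Rightarrow> 'c::ring_1 \<Rightarrow> 'w::ring_1) \<Rightarrow> ('g \<times> 'v::zero \<Rightarrow> 'u) \<Rightarrow>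
   ('k::field \<Rightarrow> 'c \<Rightarrow> 'c) \<Rightarrow> ('v \<Rightarrow> 'c) \<Rightarrow> ('v \<Rightarrow> 'v \<Rightarrow> 'k) \<Rightarrow> ('g \<Rightarrow> 'v \<Rightarrow> 'v) \<Rightarrow> 'v set \<Rightarrow> 'g \<Rightarrow> 'w" where
  "delta_map t \<iota>U sC \<iota>C B \<pi> E x = t (\<iota>U (x, 0)) 1 + t 1 (pi_star sC \<iota>C B \<pi> E x)"

end

theory Submission
  imports Defs
begin

text \<open>
  Let \<open>f\<^sub>* = 1/4 \<Sum> f(e\<^sup>i) e\<^sub>i\<close> be the lift of \<open>f \<in> so\<^sub>\<epsilon>(V)\<close> to the Clifford algebra, so that
  \<open>[f\<^sub>*, v] = f(v)\<close>. Reordering \<open>D\<^sup>2\<close> with the relations of both factors leaves the Casimir element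
  of \<open>V\<close> and \<open>- 1/2 \<Sum> {e\<^sup>i, e\<^sup>j} \<otimes> e\<^sub>j e\<^sub>i\<close>. The \<open>\<mu>\<close>-part of the latter is the mixed part of
  \<open>- \<Delta>(\<Omega>(\<g>))\<close>, and the \<open>\<phi>\<close>-part cancels against \<open>D \<psi> + \<psi> D\<close>, because
  \<open>v \<psi> + \<psi> v = 2 \<phi>(v, -)\<^sub>*\<close>. It remains to see that \<open>\<psi>\<^sup>2 + \<pi>\<^sub>*(\<Omega>(\<g>))\<close> is the scalar
  \<open>\<tau>/8 + \<kappa>/24\<close>, where \<open>\<tau>\<close> and \<open>\<kappa>\<close> are the \<open>\<epsilon>\<close>-traces on \<open>V\<close> of \<open>\<pi>(\<Omega>(\<g>))\<close> and of
  \<open>\<Sum> \<phi>(e\<^sup>i, \<phi>(e\<^sub>i, -))\<close>.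

  Since \<open>3 \<psi> = \<Sum> \<phi>(e\<^sup>i, -)\<^sub>* e\<^sub>i\<close>, moving \<open>\<psi>\<close> through this sum expresses \<open>\<psi>\<^sup>2\<close> by
  \<open>Q = \<Sum> \<phi>(e\<^sup>i, -)\<^sub>* \<phi>(e\<^sub>i, -)\<^sub>*\<close> and \<open>Z = \<Sum> [\<phi>(e\<^sup>i, -)\<^sub>*, \<psi>] e\<^sub>i\<close>. The latter is computed
  twice: the Jacobi identity turns the commutators into expressions in \<open>\<pi>\<close>, which gives
  \<open>\<pi>\<^sub>*(\<Omega>(\<g>))\<close> and \<open>\<tau>\<close>, while rotating the indices of \<open>\<phi>(e\<^sup>a, \<phi>(e\<^sup>b, e\<^sup>c))\<close> gives \<open>Q\<close> and \<open>\<kappa>\<close>.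
  Invariance of the form shows that the difference of the two traces in the statement is
  \<open>3 \<tau> + \<kappa>\<close>.
\<close>

section \<open>Linear and bilinear maps\<close>

abbreviation linear_map ::
  "('k::field \<Rightarrow> 'v::ab_group_add \<Rightarrow> 'v) \<Rightarrow> ('k \<Rightarrow> 'w::ab_group_add \<Rightarrow> 'w) \<Rightarrow> ('v \<Rightarrow> 'w) \<Rightarrow> bool" where
  "linear_map \<equiv> Vector_Spaces.linear"

lemmas linear_map_add = module_hom.add[OF module_hom_iff_linear[THEN iffD2]]
  and linear_map_scale = module_hom.scale[OF module_hom_iff_linear[THEN iffD2]]
  and linear_map_zero = module_hom.zero[OF module_hom_iff_linear[THEN iffD2]]
  and linear_map_neg = module_hom.neg[OF module_hom_iff_linear[THEN iffD2]]
  and linear_map_diff = module_hom.diff[OF module_hom_iff_linear[THEN iffD2]]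
  and linear_map_sum = module_hom.sum[OF module_hom_iff_linear[THEN iffD2]]

lemmas linear_map_simps = linear_map_add linear_map_scale linear_map_zero linear_map_neg
  linear_map_diff linear_map_sum

lemma linear_map_vector_space:
  "linear_map s t f \<Longrightarrow> vector_space s"
  "linear_map s t f \<Longrightarrow> vector_space t"
  by (simp_all add: Vector_Spaces.linear_iff)

lemma linear_map_vector_space_pair: "linear_map s t f \<Longrightarrow> vector_space_pair s t"
  by (simp add: Vector_Spaces.linear_iff vector_space_pair_def)

lemma linear_map_compose: "linear_map s2 s3 g \<Longrightarrow> linear_map s1 s2 f \<Longrightarrow> linear_map s1 s3 (\<lambda>x. g (f x))"
  by (simp add: Vector_Spaces.linear_iff)

named_theorems linear_intros

lemmas linear_map_ident [linear_intros] = vector_space.linear_ident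

lemma linear_map_compose_add [linear_intros]:
  "linear_map s t f \<Longrightarrow> linear_map s t g \<Longrightarrow> linear_map s t (\<lambda>x. f x + g x)"
  by (rule vector_space_pair.linear_compose_add[OF linear_map_vector_space_pair])

lemma linear_map_compose_neg [linear_intros]: "linear_map s t f \<Longrightarrow> linear_map s t (\<lambda>x. - f x)"
  by (rule vector_space_pair.linear_compose_neg[OF linear_map_vector_space_pair])

lemma linear_map_compose_scale_right [linear_intros]:
  "linear_map s t f \<Longrightarrow> linear_map s t (\<lambda>x. t c (f x))"
  by (rule vector_space_pair.linear_compose_scale_right[OF linear_map_vector_space_pair])

lemma linear_map_compose_scale [linear_intros]:
  "vector_space t \<Longrightarrow> linear_map s (*) f \<Longrightarrow> linear_map s t (\<lambda>x. t (f x) v)"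
  by (simp add: Vector_Spaces.linear_iff vector_space_def)

lemma linear_map_compose_sum [linear_intros]:
  "vector_space s \<Longrightarrow> vector_space t \<Longrightarrow> (\<And>i. i \<in> I \<Longrightarrow> linear_map s t (f i)) \<Longrightarrow>
    linear_map s t (\<lambda>x. \<Sum>i\<in>I. f i x)"
  by (rule vector_space_pair.linear_compose_sum) (simp_all add: vector_space_pair_def)

lemma algebra_over_vector_space: "algebra_over t \<Longrightarrow> vector_space t"
  by (simp add: algebra_over_def)

lemma algebra_over_scale_mult:
  assumes "algebra_over s"
  shows "s c u * v = s c (u * v)" and "u * s c v = s c (u * v)"
  using assms unfolding algebra_over_def by metis+

lemma linear_map_compose_mult_right [linear_intros]:
  "algebra_over t \<Longrightarrow> linear_map s t f \<Longrightarrow> linear_map s t (\<lambda>x. f x * c)"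
  by (simp add: Vector_Spaces.linear_iff algebra_over_def distrib_right)

lemma linear_map_compose_mult_left [linear_intros]:
  "algebra_over t \<Longrightarrow> linear_map s t f \<Longrightarrow> linear_map s t (\<lambda>x. c * f x)"
  by (simp add: Vector_Spaces.linear_iff algebra_over_scale_mult distrib_left)


lemma bilinear_map_linear:
  assumes "bilinear_map s1 s2 s3 F"
  shows "linear_map s2 s3 (F u)" and "linear_map s1 s3 (\<lambda>u. F u v)"
  using assms by (auto simp: bilinear_map_def)

lemma bilinear_mapI:
  "(\<And>u. linear_map s2 s3 (\<lambda>v. F u v)) \<Longrightarrow> (\<And>v. linear_map s1 s3 (\<lambda>u. F u v)) \<Longrightarrow>
    bilinear_map s1 s2 s3 F"
  by (auto simp: bilinear_map_def)

lemma twisted_commute_mult_left: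
  assumes "algebra_over s" and "x * u = s p (u * x) + u'" and "x * v = s q (v * x) + v'"
  shows "x * (u * v) = s (p * q) (u * v * x) + (u' * v + s p (u * v'))"
proof -
  interpret vector_space s using assms(1) by (rule algebra_over_vector_space)
  have "x * (u * v) = (s p (u * x) + u') * v"
    by (simp add: assms(2) flip: mult.assoc)
  also have "\<dots> = s p (u * (x * v)) + u' * v"
    by (simp add: algebra_over_scale_mult[OF assms(1)] distrib_right mult.assoc)
  finally show ?thesis
    by (simp add: assms(3) algebra_over_scale_mult[OF assms(1)] distrib_left scale_right_distrib
        mult.assoc)
qed

lemma twisted_commute_mult_right:
  assumes "algebra_over s" and "u * x = s p (x * u) + u'" and "v * x = s q (x * v) + v'"
  shows "u * v * x = s (p * q) (x * (u * v)) + (s q (u' * v) + u * v')"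
proof -
  interpret vector_space s using assms(1) by (rule algebra_over_vector_space)
  have "u * v * x = s q ((u * x) * v) + u * v'"
    by (simp add: assms(3) algebra_over_scale_mult[OF assms(1)] distrib_left mult.assoc)
  then show ?thesis
    by (simp add: assms(2) algebra_over_scale_mult[OF assms(1)] distrib_right scale_right_distrib
        mult.assoc mult.commute[of p])
qed

lemma sum_rotate:
  "(\<Sum>i\<in>I. \<Sum>j\<in>J. \<Sum>k\<in>K. h i j k) = (\<Sum>k\<in>K. \<Sum>i\<in>I. \<Sum>j\<in>J. h i j k)"
  by (simp add: sum.swap[of _ K])

section \<open>Presented algebras and tensor products\<close>

definition free_extension ::
  "('k::zero \<Rightarrow> 'z::comm_monoid_add \<Rightarrow> 'z) \<Rightarrow> ('x \<Rightarrow> 'z) \<Rightarrow> ('x \<Rightarrow>\<^sub>0 'k) \<Rightarrow> 'z" where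
  "free_extension s h p = (\<Sum>x\<in>Poly_Mapping.keys p. s (Poly_Mapping.lookup p x) (h x))"

lemma free_extension_simps:
  assumes "vector_space s"
  shows "free_extension s h (p + q) = free_extension s h p + free_extension s h q"
    and "free_extension s h (p - q) = free_extension s h p - free_extension s h q"
    and "free_extension s h (Poly_Mapping.single x c) = s c (h x)"
    and "free_extension s h 0 = 0"
proof -
  interpret vector_space s by fact
  show add: "free_extension s h (p + q) = free_extension s h p + free_extension s h q" for p q
    unfolding free_extension_def
    by (rule setsum_keys_plus_distrib[where f = "\<lambda>x c. s c (h x)"])
      (simp_all add: scale_left_distrib)
  show "free_extension s h (p - q) = free_extension s h p - free_extension s h q"
    using add[of "p - q" q] by (simp add: algebra_simps)
  show "free_extension s h (Poly_Mapping.single x c) = s c (h x)"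
    by (cases "c = 0") (simp_all add: free_extension_def)
qed (simp add: free_extension_def)

lemma poly_mapping_single_induct [case_names zero single add]:
  fixes p :: "'x \<Rightarrow>\<^sub>0 'b::comm_monoid_add"
  assumes "P 0" and "\<And>x c. P (Poly_Mapping.single x c)" and "\<And>p q. P p \<Longrightarrow> P q \<Longrightarrow> P (p + q)"
  shows "P p"
proof -
  have eq: "p = (\<Sum>x\<in>Poly_Mapping.keys p. Poly_Mapping.single x (Poly_Mapping.lookup p x))"
    by (rule poly_mapping_eqI) (auto simp: lookup_sum lookup_single when_def in_keys_iff sum.delta)
  have "P (\<Sum>x\<in>A. Poly_Mapping.single x (Poly_Mapping.lookup p x))" for A
    by (induction A rule: infinite_finite_induct) (simp_all add: assms)
  then show ?thesis
    by (subst eq)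
qed

definition word_action ::
  "('k::zero \<Rightarrow> 'z::comm_monoid_add \<Rightarrow> 'z) \<Rightarrow> ('x \<Rightarrow> 'z \<Rightarrow> 'z) \<Rightarrow> ('x, 'k) free_algebra \<Rightarrow> 'z \<Rightarrow> 'z" where
  "word_action s \<rho> p z = free_extension s (\<lambda>w. foldr \<rho> (letters w) z) p"

context
  fixes s :: "'k::field \<Rightarrow> 'z::ab_group_add \<Rightarrow> 'z" and \<rho> :: "'x \<Rightarrow> 'z \<Rightarrow> 'z"
  assumes vector_space_s: "vector_space s" and linear_rho: "\<And>x. linear_map s s (\<rho> x)"
begin

lemma foldr_linear: "linear_map s s (\<lambda>z. foldr \<rho> xs z)"
  by (induction xs)
    (simp_all add: linear_map_ident[OF vector_space_s] linear_map_compose[OF linear_rho])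

lemma word_action_linear: "linear_map s s (word_action s \<rho> p)"
  unfolding word_action_def free_extension_def by (intro linear_intros vector_space_s foldr_linear)

lemma word_action_simps:
  "word_action s \<rho> (p + q) z = word_action s \<rho> p z + word_action s \<rho> q z"
  "word_action s \<rho> (p - q) z = word_action s \<rho> p z - word_action s \<rho> q z"
  "word_action s \<rho> (gen x) z = \<rho> x z"
  "word_action s \<rho> (const k) z = s k z"
  "word_action s \<rho> 0 z = 0"
  "word_action s \<rho> 1 z = z"
  "word_action s \<rho> (Poly_Mapping.single w k) z = s k (foldr \<rho> (letters w) z)"
proof -
  interpret vector_space s by (rule vector_space_s)
  note simps = word_action_def free_extension_simps[OF vector_space_s] zero_free_monoid_def
  show "word_action s \<rho> (p + q) z = word_action s \<rho> p z + word_action s \<rho> q z"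
    "word_action s \<rho> (p - q) z = word_action s \<rho> p z - word_action s \<rho> q z"
    "word_action s \<rho> (gen x) z = \<rho> x z"
    "word_action s \<rho> (const k) z = s k z"
    "word_action s \<rho> 0 z = 0"
    "word_action s \<rho> (Poly_Mapping.single w k) z = s k (foldr \<rho> (letters w) z)"
    by (simp_all add: simps gen_def const_def)
  show "word_action s \<rho> 1 z = z"
    unfolding single_one[symmetric] simps by simp
qed

lemma word_action_mult: "word_action s \<rho> (p * q) z = word_action s \<rho> p (word_action s \<rho> q z)"
proof (induction p rule: poly_mapping_single_induct)
  case (single w k)
  show ?case
  proof (induction q rule: poly_mapping_single_induct)
    case (single w' k')
    show ?case
      using vector_space_s by (simp add: mult_single word_action_simps plus_free_monoid_def
          linear_map_scale[OF foldr_linear] vector_space_def)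
  qed (simp_all add: distrib_left word_action_simps linear_map_simps[OF word_action_linear])
qed (simp_all add: distrib_right word_action_simps)

lemma word_action_ideal:
  assumes "p \<in> ideal_gen R" and rels: "\<And>r z. r \<in> R \<Longrightarrow> word_action s \<rho> r z = 0"
  shows "word_action s \<rho> p z = 0"
  using assms(1)
  by (induction arbitrary: z)
    (simp_all add: rels word_action_simps word_action_mult linear_map_zero[OF word_action_linear])

end

lemma free_eval_eq_word_action: "free_eval s \<iota> p = word_action s (\<lambda>x z. \<iota> x * z) p 1"
proof -
  have "prod_list (map \<iota> xs) = foldr (\<lambda>x z. \<iota> x * z) xs 1" for xs
    by (induction xs) simp_all
  then show ?thesis
    by (simp add: free_eval_def word_action_def free_extension_def)
qed

lemma word_action_left_mult:
  assumes "algebra_over s"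
  shows "word_action s (\<lambda>x z. \<iota> x * z) p z = free_eval s \<iota> p * z"
proof -
  have "foldr (\<lambda>x z. \<iota> x * z) xs z = foldr (\<lambda>x z. \<iota> x * z) xs 1 * z" for xs
    by (induction xs) (simp_all add: mult.assoc)
  then have "s k (foldr (\<lambda>x z. \<iota> x * z) xs z) = s k (foldr (\<lambda>x z. \<iota> x * z) xs 1) * z" for k xs
    by (simp only: algebra_over_scale_mult(1)[OF assms])
  then show ?thesis
    by (simp add: free_eval_eq_word_action word_action_def free_extension_def sum_distrib_right)
qed

lemma left_mult_linear: "algebra_over s \<Longrightarrow> linear_map s s (\<lambda>z. u * z)"
  by (intro linear_intros algebra_over_vector_space)

lemma free_eval_simps:
  assumes alg: "algebra_over s"
  shows "free_eval s \<iota> (p + q) = free_eval s \<iota> p + free_eval s \<iota> q"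
    and "free_eval s \<iota> (p - q) = free_eval s \<iota> p - free_eval s \<iota> q"
    and "free_eval s \<iota> (gen x) = \<iota> x"
    and "free_eval s \<iota> (const k) = s k 1"
    and "free_eval s \<iota> 0 = 0"
    and "free_eval s \<iota> 1 = 1"
    and "free_eval s \<iota> (p * q) = free_eval s \<iota> p * free_eval s \<iota> q"
proof -
  note vs = algebra_over_vector_space[OF alg] and left_mult = left_mult_linear[OF alg]
  show "free_eval s \<iota> (p + q) = free_eval s \<iota> p + free_eval s \<iota> q"
    "free_eval s \<iota> (p - q) = free_eval s \<iota> p - free_eval s \<iota> q"
    "free_eval s \<iota> (gen x) = \<iota> x" "free_eval s \<iota> (const k) = s k 1"
    "free_eval s \<iota> 0 = 0" "free_eval s \<iota> 1 = 1"
    by (simp_all add: free_eval_eq_word_action word_action_simps[OF vs left_mult])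
  have "free_eval s \<iota> (p * q) = word_action s (\<lambda>x z. \<iota> x * z) p (word_action s (\<lambda>x z. \<iota> x * z) q 1)"
    by (simp only: free_eval_eq_word_action word_action_mult[OF vs left_mult])
  then show "free_eval s \<iota> (p * q) = free_eval s \<iota> p * free_eval s \<iota> q"
    by (simp only: word_action_left_mult[OF alg] mult_1_right)
qed

lemma scale_one_mult: "algebra_over s \<Longrightarrow> s k 1 * u = s k u"
  by (simp add: algebra_over_scale_mult)

lemma presented_algebra_induct [consumes 1, case_names scalar generator add mult]:
  assumes pres: "presented_algebra s \<iota> R"
    and scalar: "\<And>k. P (s k 1)" and generator: "\<And>x. P (\<iota> x)"
    and add: "\<And>u v. P u \<Longrightarrow> P v \<Longrightarrow> P (u + v)" and mult: "\<And>u v. P u \<Longrightarrow> P v \<Longrightarrow> P (u * v)"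
  shows "P u"
proof -
  have alg: "algebra_over s" and "range (free_eval s \<iota>) = UNIV"
    using pres by (simp_all add: presented_algebra_def)
  interpret vector_space s using alg by (rule algebra_over_vector_space)
  have word: "P (prod_list (map \<iota> xs))" for xs
    using scalar[of 1] by (induction xs) (simp_all add: generator mult)
  obtain p where "u = free_eval s \<iota> p"
    using \<open>range (free_eval s \<iota>) = UNIV\<close> by blast
  moreover have "P (free_eval s \<iota> p)"
  proof (induction p rule: poly_mapping_single_induct)
    case zero
    then show ?case
      using scalar[of 0] by (simp add: free_eval_simps[OF alg])
  next
    case (single w k)
    then show ?case
      using mult[OF scalar word, of k "letters w"] scalar[of 0]
      by (cases "k = 0") (simp_all add: free_eval_def scale_one_mult[OF alg])
  next
    case (add p q)
    then show ?case
      by (simp add: free_eval_simps[OF alg] assms(4))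
  qed
  ultimately show ?thesis by simp
qed

definition algebra_action ::
  "('k::field \<Rightarrow> 'u::ring_1 \<Rightarrow> 'u) \<Rightarrow> ('k \<Rightarrow> 'z::ab_group_add \<Rightarrow> 'z) \<Rightarrow> ('u \<Rightarrow> 'z \<Rightarrow> 'z) \<Rightarrow> bool" where
  "algebra_action sU s A \<longleftrightarrow> A 1 = id \<and> (\<forall>u v. A (u * v) = A u \<circ> A v) \<and>
     (\<forall>z. linear_map sU s (\<lambda>u. A u z)) \<and> (\<forall>u. linear_map s s (A u))"

lemma algebra_action_simps:
  assumes "algebra_action sU s A"
  shows "A 1 z = z" and "A (u * v) z = A u (A v z)" and "A (u + v) z = A u z + A v z"
    and "A (sU k u) z = s k (A u z)" and "A (sum g I) z = (\<Sum>i\<in>I. A (g i) z)"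
proof -
  have linear: "linear_map sU s (\<lambda>u. A u z)"
    using assms by (simp add: algebra_action_def)
  show "A (u + v) z = A u z + A v z" and "A (sU k u) z = s k (A u z)"
    and "A (sum g I) z = (\<Sum>i\<in>I. A (g i) z)"
    by (rule linear_map_add[OF linear] linear_map_scale[OF linear] linear_map_sum[OF linear])+
qed (use assms in \<open>simp_all add: algebra_action_def\<close>)

lemma presented_algebra_action_unique:
  assumes pres: "presented_algebra sU \<iota> R" and A: "algebra_action sU s A"
    and A': "algebra_action sU s A'"
    and eq: "\<And>x. A (\<iota> x) = A' (\<iota> x)"
  shows "A = A'"
proof -
  have "\<forall>z. A u z = A' u z" for u
    using pres by (induction u rule: presented_algebra_induct)
      (simp_all add: eq algebra_action_simps[OF A] algebra_action_simps[OF A'])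
  then show ?thesis
    by (intro ext) blast
qed

lemma presented_algebra_ex_action:
  fixes s :: "'k::field \<Rightarrow> 'z::ab_group_add \<Rightarrow> 'z" and sU :: "'k \<Rightarrow> 'u::ring_1 \<Rightarrow> 'u"
  assumes pres: "presented_algebra sU \<iota> R"
    and vs: "vector_space s" and \<rho>: "\<And>x. linear_map s s (\<rho> x)"
    and rels: "\<And>r z. r \<in> R \<Longrightarrow> word_action s \<rho> r z = 0"
  shows "\<exists>A. algebra_action sU s A \<and> (\<forall>x. A (\<iota> x) = \<rho> x)"
proof -
  let ?ev = "free_eval sU \<iota>"
  have alg: "algebra_over sU" and surj: "range ?ev = UNIV" and ker: "{p. ?ev p = 0} = ideal_gen R"
    using pres by (simp_all add: presented_algebra_def)
  note act = word_action_simps[OF vs \<rho>] word_action_mult[OF vs \<rho>]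
  note ev = free_eval_simps[OF alg]
  define A where "A u = word_action s \<rho> (inv ?ev u)" for u
  have A_ev: "A (?ev p) z = word_action s \<rho> p z" for p z
  proof -
    have "inv ?ev (?ev p) - p \<in> ideal_gen R"
      using surj_f_inv_f[OF surj, of "?ev p"] by (simp add: ev flip: ker)
    then have "word_action s \<rho> (inv ?ev (?ev p) - p) z = 0"
      using rels by (rule word_action_ideal[OF vs \<rho>])
    then show ?thesis
      by (simp add: A_def act)
  qed
  have ex: "\<exists>p. u = ?ev p" for u
    using surj by (metis surjD)
  show ?thesis
  proof (intro exI conjI allI)
    show "A (\<iota> x) = \<rho> x" for x
      using A_ev[of "gen x"] by (simp add: ev act fun_eq_iff)
    have "A 1 z = z" for z
      using A_ev[of 1] by (simp add: ev act)
    moreover have "A (u * v) z = A u (A v z)" "A (u + v) z = A u z + A v z"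
        "A (sU k u) z = s k (A u z)" for u v k z
      using ex[of u] ex[of v] A_ev[of "_ * _" z] A_ev[of "_ + _" z] A_ev[of "const k * _" z]
      by (auto simp: ev act A_ev scale_one_mult[OF alg])
    moreover have "linear_map s s (A u)" for u
      unfolding A_def by (rule word_action_linear[OF vs \<rho>])
    ultimately show "algebra_action sU s A"
      by (auto simp: algebra_action_def fun_eq_iff Vector_Spaces.linear_iff vs
          algebra_over_vector_space[OF alg])
  qed
qed

lemma algebra_hom_simps:
  assumes "algebra_hom s t F"
  shows "F 1 = 1" and "F (u * v) = F u * F v" and "F (u + v) = F u + F v"
    and "F (s k u) = t k (F u)"
    and "F (sum g I) = (\<Sum>i\<in>I. F (g i))"
proof -
  have linear: "linear_map s t F"
    using assms by (simp add: algebra_hom_def)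
  show "F (u + v) = F u + F v" and "F (s k u) = t k (F u)" and "F (sum g I) = (\<Sum>i\<in>I. F (g i))"
    by (rule linear_map_add[OF linear] linear_map_scale[OF linear] linear_map_sum[OF linear])+
qed (use assms in \<open>simp_all add: algebra_hom_def\<close>)

lemma presented_algebra_hom_unique:
  assumes pres: "presented_algebra sU \<iota> R" and F: "algebra_hom sU sW F"
    and F': "algebra_hom sU sW F'"
    and eq: "\<And>x. F (\<iota> x) = F' (\<iota> x)"
  shows "F = F'"
proof
  show "F u = F' u" for u
    using pres by (induction u rule: presented_algebra_induct)
      (simp_all add: eq algebra_hom_simps[OF F] algebra_hom_simps[OF F'])
qed

lemma presented_algebra_ex_hom:
  fixes sU :: "'k::field \<Rightarrow> 'u::ring_1 \<Rightarrow> 'u" and sW :: "'k \<Rightarrow> 'w::ring_1 \<Rightarrow> 'w"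
  assumes pres: "presented_algebra sU \<iota> R" and alg: "algebra_over sW"
    and rels: "\<And>r. r \<in> R \<Longrightarrow> free_eval sW f r = 0"
  shows "\<exists>F. algebra_hom sU sW F \<and> (\<forall>x. F (\<iota> x) = f x)"
proof -
  have "word_action sW (\<lambda>x z. f x * z) r z = 0" if "r \<in> R" for r z
    using that by (simp add: word_action_left_mult[OF alg] rels)
  then have "\<exists>A. algebra_action sU sW A \<and> (\<forall>x. A (\<iota> x) = (\<lambda>z. f x * z))"
    by (rule presented_algebra_ex_action[OF pres algebra_over_vector_space[OF alg]
        left_mult_linear[OF alg]])
  then obtain A where A: "algebra_action sU sW A" and A_gen: "A (\<iota> x) = (\<lambda>z. f x * z)" for x
    by blast
  note A_simps = algebra_action_simps[OF A]
  have left_mult: "A u z = A u 1 * z" for u z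
    using pres
  proof (induction u arbitrary: z rule: presented_algebra_induct)
    case (mult u v)
    have "A (u * v) z = A u (A v z)"
      by (rule A_simps(2))
    also have "\<dots> = A u 1 * A v z"
      by (rule mult(1))
    also have "A v z = A v 1 * z"
      by (rule mult(2))
    also have "A u 1 * (A v 1 * z) = A (u * v) 1 * z"
      by (simp only: A_simps(2) mult(1)[of "A v 1"] mult.assoc)
    finally show ?case .
  next
    case (add u v)
    then show ?case
      by (metis A_simps(3) distrib_right)
  qed (simp_all add: A_simps A_gen scale_one_mult[OF alg])
  have "A (u * v) 1 = A u 1 * A v 1" for u v
    using left_mult[of u "A v 1"] by (simp only: A_simps(2))
  then have "algebra_hom sU sW (\<lambda>u. A u 1)"
    using A by (simp add: algebra_hom_def algebra_action_def)
  then show ?thesis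
    by (intro exI[of _ "\<lambda>u. A u 1"]) (simp add: A_gen)
qed

lemma env_extension_hom:
  assumes "presented_algebra sU \<iota> R" and "algebra_over sW" and "\<And>r. r \<in> R \<Longrightarrow> free_eval sW f r = 0"
  shows "algebra_hom sU sW (env_extension sU \<iota> sW f)" and "env_extension sU \<iota> sW f (\<iota> x) = f x"
proof -
  obtain F where F: "algebra_hom sU sW F" "\<And>x. F (\<iota> x) = f x"
    using presented_algebra_ex_hom[OF assms] by blast
  then have "env_extension sU \<iota> sW f = F"
    unfolding env_extension_def
    by (intro the_equality presented_algebra_hom_unique[OF assms(1)]) simp_all
  with F show "algebra_hom sU sW (env_extension sU \<iota> sW f)"
    and "env_extension sU \<iota> sW f (\<iota> x) = f x"
    by simp_all
qed

lemma lookup_free_scale: "Poly_Mapping.lookup (free_scale k p) x = k * Poly_Mapping.lookup p x"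
  unfolding free_scale_def by transfer (simp add: when_def)

lemma free_scale_single: "free_scale k (Poly_Mapping.single x b) = Poly_Mapping.single x (k * b)"
  by (rule poly_mapping_eqI) (simp add: lookup_free_scale lookup_single when_def)

lemma module_free_scale: "module (free_scale :: 'k::field \<Rightarrow> ('x \<Rightarrow>\<^sub>0 'k) \<Rightarrow> _)"
  by standard (auto intro!: poly_mapping_eqI simp: lookup_free_scale lookup_add algebra_simps)

lemma tensor_product_bilinear:
  fixes s1 :: "'k::field \<Rightarrow> 'u::ab_group_add \<Rightarrow> 'u" and s2 :: "'k \<Rightarrow> 'v::ab_group_add \<Rightarrow> 'v"
    and s3 :: "'k \<Rightarrow> 'w::ab_group_add \<Rightarrow> 'w"
  assumes vs1: "vector_space s1" and vs2: "vector_space s2" and tp: "tensor_product s1 s2 s3 t"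
  shows "bilinear_map s1 s2 s3 t"
proof -
  have vs3: "vector_space s3"
    and ker: "{p. tensor_eval s3 t p = 0} = module.span free_scale (bilinearity_rels s1 s2)"
    using tp by (simp_all add: tensor_product_def)
  interpret s3: vector_space s3 by (rule vs3)
  interpret free: module "free_scale :: 'k \<Rightarrow> _ \<Rightarrow> 'u \<times> 'v \<Rightarrow>\<^sub>0 'k"
    by (rule module_free_scale)
  have eval: "tensor_eval s3 t = free_extension s3 (\<lambda>(u, v). t u v)"
    by (simp add: tensor_eval_def[abs_def] free_extension_def[abs_def] case_prod_beta)
  have rel: "free_extension s3 (\<lambda>(u, v). t u v) p = 0" if "p \<in> bilinearity_rels s1 s2" for p
    using free.span_base[OF that] unfolding ker[symmetric] eval by simp
  have "t (u + u') v - t u v - t u' v = 0" "t u (v + v') - t u v - t u v' = 0"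
    "t (s1 k u) v - s3 k (t u v) = 0" "t u (s2 k v) - s3 k (t u v) = 0" for u u' v v' k
    using rel[of "Poly_Mapping.single (u + u', v) 1 - Poly_Mapping.single (u, v) 1
        - Poly_Mapping.single (u', v) 1"]
      rel[of "Poly_Mapping.single (u, v + v') 1 - Poly_Mapping.single (u, v) 1
          - Poly_Mapping.single (u, v') 1"]
      rel[of "Poly_Mapping.single (s1 k u, v) 1 - free_scale k (Poly_Mapping.single (u, v) 1)"]
      rel[of "Poly_Mapping.single (u, s2 k v) 1 - free_scale k (Poly_Mapping.single (u, v) 1)"]
    unfolding bilinearity_rels_def Let_def
    by (simp_all add: free_extension_simps[OF vs3] free_scale_single) blast+
  then show ?thesis
    by (simp add: bilinear_map_def Vector_Spaces.linear_iff vs1 vs2 vs3 algebra_simps)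
qed

section \<open>Commutation factors\<close>

locale commutation =
  fixes \<epsilon> :: "'a::ab_group_add \<Rightarrow> 'a \<Rightarrow> 'k::field"
  assumes commutation: "commutation_factor \<epsilon>"
begin

lemma eps_swap [simp]: "\<epsilon> a b * \<epsilon> b a = 1"
  and eps_add_left: "\<epsilon> (a + b) c = \<epsilon> a c * \<epsilon> b c"
  and eps_add_right: "\<epsilon> c (a + b) = \<epsilon> c a * \<epsilon> c b"
  using commutation by (simp_all add: commutation_factor_def)

lemma eps_nonzero: "\<epsilon> a b \<noteq> 0"
  using eps_swap[of a b] by fastforce

lemma eps_zero [simp]: "\<epsilon> 0 c = 1" "\<epsilon> c 0 = 1"
  using eps_add_left[of 0 0 c] eps_add_right[of c 0 0] eps_nonzero[of 0 c] eps_nonzero[of c 0]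
  by auto

lemma eps_minus_left: "\<epsilon> (- a) b = \<epsilon> b a"
proof -
  have "\<epsilon> (- a) b * \<epsilon> a b = \<epsilon> b a * \<epsilon> a b"
    by (simp flip: eps_add_left)
  then show ?thesis
    by (simp only: mult_right_cancel[OF eps_nonzero])
qed

lemma eps_minus_right: "\<epsilon> b (- a) = \<epsilon> a b"
  using eps_minus_left[of "- a" b] by simp

lemma eps_diff_left: "\<epsilon> (a - b) c = \<epsilon> a c * \<epsilon> c b"
  and eps_diff_right: "\<epsilon> c (a - b) = \<epsilon> c a * \<epsilon> b c"
  using eps_add_left[of a "- b" c] eps_add_right[of c a "- b"]
  by (simp_all add: eps_minus_left eps_minus_right)

lemmas eps_simps = eps_diff_left eps_diff_right eps_add_left eps_add_right eps_minus_left
    eps_minus_right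

end

section \<open>Dual bases\<close>

locale nondegenerate_form =
  fixes s :: "'k::field \<Rightarrow> 'v::ab_group_add \<Rightarrow> 'v" and B :: "'v \<Rightarrow> 'v \<Rightarrow> 'k" and E :: "'v set"
  assumes bilinear_form: "bilinear_map s s (*) B"
    and nondegenerate: "nondegenerate B"
    and basis: "finite_dimensional_vector_space s E"
begin

sublocale vs: finite_dimensional_vector_space s E
  by (rule basis)

abbreviation dual :: "'v \<Rightarrow> 'v" where
  "dual \<equiv> dual_basis B E"

lemmas vector_space [linear_intros] = vs.vector_space_axioms

lemmas form_simps = linear_map_simps[OF bilinear_map_linear(1)[OF bilinear_form]]
  linear_map_simps[OF bilinear_map_linear(2)[OF bilinear_form]]

lemma form_linear [linear_intros]:
  "linear_map t s f \<Longrightarrow> linear_map t (*) (\<lambda>x. B u (f x))"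
  "linear_map t s f \<Longrightarrow> linear_map t (*) (\<lambda>x. B (f x) v)"
  by (rule linear_map_compose[OF bilinear_map_linear(1)[OF bilinear_form]],
      assumption, rule linear_map_compose[OF bilinear_map_linear(2)[OF bilinear_form]])

lemma linear_map_eqI:
  assumes "linear_map s t f" and "linear_map s t g" and "\<And>e. e \<in> E \<Longrightarrow> f e = g e"
  shows "f v = g v"
proof -
  interpret vector_space_pair s t
    using assms(1) by (rule linear_map_vector_space_pair)
  show ?thesis
    by (rule linear_eq_on[OF assms(1,2) _ assms(3)]) (simp_all add: vs.span_Basis)
qed

lemma form_eqI:
  assumes "\<And>u. B u v = B u w"
  shows "v = w"
proof -
  have "\<forall>u. B u (v - w) = 0"
    using assms by (simp add: form_simps)
  then show "v = w"
    using nondegenerate unfolding nondegenerate_def by (metis right_minus_eq)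
qed

lemma form_eqI_basis:
  assumes "\<And>e. e \<in> E \<Longrightarrow> B e v = B e w"
  shows "v = w"
  by (rule form_eqI, rule linear_map_eqI[of "(*)" "\<lambda>u. B u v" "\<lambda>u. B u w"])
    (intro linear_intros assms)+

lemma coefficients_eqI:
  assumes "(\<Sum>e\<in>E. s (c e) e) = (\<Sum>e\<in>E. s (c' e) e)" and "e \<in> E"
  shows "c e = c' e"
proof -
  have "(\<Sum>e\<in>E. s (c e - c' e) e) = 0"
    using assms(1) by (simp add: vs.scale_left_diff_distrib sum_subtractf)
  then have "c e - c' e = 0"
    by (rule vs.independentD[OF vs.independent_Basis vs.finite_Basis subset_refl _ assms(2)])
  then show ?thesis by simp
qed

lemma ex_form_values: "\<exists>u. \<forall>e\<in>E. B e u = c e"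
proof -
  define \<Phi> where "\<Phi> u = (\<Sum>e\<in>E. s (B e u) e)" for u
  have "linear_map s s \<Phi>"
    unfolding \<Phi>_def by (intro linear_intros)
  moreover have "inj \<Phi>"
    unfolding \<Phi>_def by (intro injI form_eqI_basis) (rule coefficients_eqI)
  ultimately have "surj \<Phi>"
    by (rule vs.linear_inj_imp_surj)
  then obtain u where "\<Phi> u = (\<Sum>e\<in>E. s (c e) e)"
    by (metis surjD)
  then have "B e u = c e" if "e \<in> E" for e
    using that unfolding \<Phi>_def by (rule coefficients_eqI)
  then show ?thesis by blast
qed

lemma dual_eqI:
  assumes "\<And>f. f \<in> E \<Longrightarrow> B f v = (if f = e then 1 else 0)"
  shows "dual e = v"
  unfolding dual_basis_def by (rule the_equality) (use assms in \<open>auto intro: form_eqI_basis\<close>)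

lemma form_dual: "f \<in> E \<Longrightarrow> B f (dual e) = (if f = e then 1 else 0)"
  using ex_form_values[of "\<lambda>f. if f = e then 1 else 0"] dual_eqI[of _ e] by metis

lemma basis_expansion: "(\<Sum>e\<in>E. s (B v (dual e)) e) = v"
proof (rule linear_map_eqI[of s "\<lambda>v. \<Sum>e\<in>E. s (B v (dual e)) e" "\<lambda>v. v"])
  fix f assume "f \<in> E"
  then show "(\<Sum>e\<in>E. s (B f (dual e)) e) = f"
    by (simp add: form_dual if_distrib[of "\<lambda>c. s c _"] vs.finite_Basis cong: if_cong)
qed (intro linear_intros)+

lemma dual_basis_expansion: "(\<Sum>e\<in>E. s (B e v) (dual e)) = v"
  by (rule form_eqI_basis)
    (simp add: form_simps form_dual if_distrib[of "\<lambda>c. _ * c"] vs.finite_Basis cong: if_cong)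

lemma linear_expansion:
  assumes F: "linear_map s t F"
  shows "(\<Sum>e\<in>E. t (B v (dual e)) (F e)) = F v"
  by (simp only: basis_expansion flip: linear_map_scale[OF F] linear_map_sum[OF F])

lemma linear_dual_expansion:
  assumes F: "linear_map s t F"
  shows "(\<Sum>e\<in>E. t (B e v) (F (dual e))) = F v"
  by (simp only: dual_basis_expansion flip: linear_map_scale[OF F] linear_map_sum[OF F])

lemma sum_dual_basis_eq:
  assumes F: "bilinear_map s s t F" and b: "\<And>v. (\<Sum>i\<in>I. s (B v (b' i)) (b i)) = v"
  shows "(\<Sum>e\<in>E. F (dual e) e) = (\<Sum>i\<in>I. F (b' i) (b i))"
proof -
  note F_simps = linear_map_simps[OF bilinear_map_linear(1)[OF F]]
  have "(\<Sum>e\<in>E. F (dual e) e) = (\<Sum>e\<in>E. \<Sum>i\<in>I. t (B e (b' i)) (F (dual e) (b i)))"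
    by (subst (3) b[symmetric]) (simp add: F_simps)
  also have "\<dots> = (\<Sum>i\<in>I. \<Sum>e\<in>E. t (B e (b' i)) (F (dual e) (b i)))"
    by (rule sum.swap)
  also have "\<dots> = (\<Sum>i\<in>I. F (b' i) (b i))"
    by (intro sum.cong refl linear_dual_expansion bilinear_map_linear[OF F])
  finally show ?thesis .
qed

lemma sum_dual_adjoint:
  assumes F: "bilinear_map s s t F" and f: "linear_map s s f" and g: "linear_map s s g"
    and adjoint: "\<And>e e'. e \<in> E \<Longrightarrow> e' \<in> E \<Longrightarrow> c e * B (f e) (dual e') = B e (g (dual e'))"
  shows "(\<Sum>e\<in>E. t (c e) (F (dual e) (f e))) = (\<Sum>e\<in>E. F (g (dual e)) e)"
proof -
  note F_linear = bilinear_map_linear[OF F]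
  interpret t: vector_space t using F_linear(1) by (rule linear_map_vector_space)
  have "(\<Sum>e\<in>E. t (c e) (F (dual e) (f e)))
      = (\<Sum>e\<in>E. t (c e) (\<Sum>e'\<in>E. t (B (f e) (dual e')) (F (dual e) e')))"
    by (simp only: linear_expansion[OF F_linear(1)])
  also have "\<dots> = (\<Sum>e\<in>E. \<Sum>e'\<in>E. t (B e (g (dual e'))) (F (dual e) e'))"
    using adjoint by (intro sum.cong) (simp_all add: t.scale_sum_right)
  also have "\<dots> = (\<Sum>e'\<in>E. \<Sum>e\<in>E. t (B e (g (dual e'))) (F (dual e) e'))"
    by (rule sum.swap)
  also have "\<dots> = (\<Sum>e\<in>E. F (g (dual e)) e)"
    by (simp only: linear_dual_expansion[OF F_linear(2)])
  finally show ?thesis .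
qed

lemma representation_eq_form: "e \<in> E \<Longrightarrow> vs.representation E v e = B v (dual e)"
proof (rule linear_map_eqI[of "(*)" "\<lambda>v. vs.representation E v e" "\<lambda>v. B v (dual e)"])
  show "linear_map s (*) (\<lambda>v. vs.representation E v e)"
    by (rule vs.linear_representation[OF vs.independent_Basis vs.span_Basis])
qed (auto intro!: linear_intros simp: vs.representation_basis[OF vs.independent_Basis] form_dual)

lemma lin_trace_eq_form:
  assumes f: "linear_map s s f"
  shows "lin_trace s f = (\<Sum>e\<in>E. B (f e) (dual e))"
proof -
  define E\<^sub>0 where "E\<^sub>0 = (SOME E. finite_dimensional_vector_space s E)"
  have "finite_dimensional_vector_space s E\<^sub>0"
    unfolding E\<^sub>0_def by (rule someI, rule basis)
  then interpret chosen: nondegenerate_form s B E\<^sub>0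
    using bilinear_form nondegenerate by (simp add: nondegenerate_form_def)
  have "lin_trace s f = (\<Sum>e\<in>E\<^sub>0. B (f e) (chosen.dual e))"
    by (simp add: lin_trace_def chosen.representation_eq_form flip: E\<^sub>0_def)
  also have "\<dots> = (\<Sum>e\<in>E. B (f e) (dual e))"
    by (rule chosen.sum_dual_basis_eq[of "(*)" "\<lambda>p q. B (f q) p"])
      (intro bilinear_mapI linear_intros f basis_expansion)+
  finally show ?thesis .
qed

end

section \<open>Homogeneous dual bases and colour traces\<close>

text \<open>Meaningful for homogeneous \<open>v \<noteq> 0\<close> only: \<open>0\<close> lies in every component.\<close>

definition degree :: "('a \<Rightarrow> 'v set) \<Rightarrow> 'v \<Rightarrow> 'a" where
  "degree G v = (SOME a. v \<in> G a)"

lemma ex1_homogeneous_decomp: "graded_space s G \<Longrightarrow> \<exists>!h. homogeneous_decomp G v h"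
  by (simp add: graded_space_def)

lemma hcomp_eqI: "graded_space s G \<Longrightarrow> homogeneous_decomp G v h \<Longrightarrow> hcomp G v = h"
  unfolding hcomp_def using ex1_homogeneous_decomp by (metis the1_equality)

lemma homogeneous_decomp_hcomp: "graded_space s G \<Longrightarrow> homogeneous_decomp G v (hcomp G v)"
  by (metis ex1_homogeneous_decomp hcomp_eqI)

lemma linear_map_eqI_graded:
  assumes "graded_space s G" and f: "linear_map s t f" and g: "linear_map s t g"
    and eq: "\<And>a v. v \<in> G a \<Longrightarrow> f v = g v"
  shows "f v = g v"
proof -
  have hcomp: "f (hcomp G v a) = g (hcomp G v a)"
    and v: "(\<Sum>a | hcomp G v a \<noteq> 0. hcomp G v a) = v" for a
    using homogeneous_decomp_hcomp[OF assms(1), of v] eq by (auto simp: homogeneous_decomp_def)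
  have "f (\<Sum>a | hcomp G v a \<noteq> 0. hcomp G v a) = g (\<Sum>a | hcomp G v a \<noteq> 0. hcomp G v a)"
    by (simp only: linear_map_sum[OF f] linear_map_sum[OF g] hcomp)
  then show ?thesis
    by (simp only: v)
qed

text \<open>\<open>\<rho>(\<Omega>)\<close> when \<open>\<rho>\<close> is a representation; no such hypothesis is made, since \<open>\<phi>\<close> is not one.\<close>

definition casimir_operator ::
  "('x \<Rightarrow> 'x \<Rightarrow> 'k::zero_neq_one) \<Rightarrow> 'x set \<Rightarrow> ('x \<Rightarrow> 'v \<Rightarrow> 'v::comm_monoid_add) \<Rightarrow> 'v \<Rightarrow> 'v" where
  "casimir_operator B X \<rho> v = (\<Sum>x\<in>X. \<rho> (dual_basis B X x) (\<rho> x v))"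

lemma casimir_operator_linear [linear_intros]:
  assumes "linear_map t s f" and "\<And>x. linear_map s s (\<rho> x)"
  shows "linear_map t s (\<lambda>u. casimir_operator B X \<rho> (f u))"
  unfolding casimir_operator_def
  by (intro linear_intros linear_map_vector_space[OF assms(1)] linear_map_compose[OF assms(2)]
      assms(1))

locale colour_form = commutation \<epsilon>
  for \<epsilon> :: "'a::ab_group_add \<Rightarrow> 'a \<Rightarrow> 'k::field" +
  fixes s :: "'k \<Rightarrow> 'v::ab_group_add \<Rightarrow> 'v" and G :: "'a \<Rightarrow> 'v set" and B :: "'v \<Rightarrow> 'v \<Rightarrow> 'k"
    and E :: "'v set"
  assumes graded: "graded_space s G"
    and eps_symmetric: "eps_symmetric_form s G \<epsilon> B"
    and form_nondegenerate: "nondegenerate B"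
    and homogeneous: "homogeneous_basis s G E"
begin

sublocale nondegenerate_form s B E
  using eps_symmetric form_nondegenerate homogeneous
  by (simp add: nondegenerate_form_def eps_symmetric_form_def homogeneous_basis_def)

abbreviation deg :: "'v \<Rightarrow> 'a" where
  "deg \<equiv> degree G"

lemma basis_deg: "e \<in> E \<Longrightarrow> e \<in> G (deg e)"
  using homogeneous unfolding homogeneous_basis_def degree_def by (metis someI_ex)

lemma subspace_homogeneous: "vs.subspace (G a)"
  using graded by (simp add: graded_space_def)

lemma zero_homogeneous [simp]: "0 \<in> G a"
  by (rule vs.subspace_0[OF subspace_homogeneous])

lemma form_orthogonal: "v \<in> G a \<Longrightarrow> w \<in> G b \<Longrightarrow> a + b \<noteq> 0 \<Longrightarrow> B v w = 0"
  using eps_symmetric by (simp add: eps_symmetric_form_def)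

lemma form_swap: "v \<in> G a \<Longrightarrow> w \<in> G b \<Longrightarrow> B v w = \<epsilon> a b * B w v"
  using eps_symmetric unfolding eps_symmetric_form_def by blast

lemma form_degree_cong:
  assumes "v \<in> G a" and "w \<in> G b" and "a = - b \<Longrightarrow> p = q"
  shows "p * B v w = q * B v w"
  using form_orthogonal[OF assms(1,2)] assms(3) by (auto simp: eq_neg_iff_add_eq_0)

lemma form_swap_diagonal:
  assumes "v \<in> G a" "w \<in> G b"
  shows "B v w = \<epsilon> a a * B w v" and "B v w = \<epsilon> b b * B w v"
proof -
  have "b = - a \<Longrightarrow> \<epsilon> a b = \<epsilon> a a" "b = - a \<Longrightarrow> \<epsilon> a b = \<epsilon> b b"
    by (simp_all add: eps_simps)
  then have "\<epsilon> a b * B w v = \<epsilon> a a * B w v" "\<epsilon> a b * B w v = \<epsilon> b b * B w v"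
    by (intro form_degree_cong[OF assms(2,1)]; blast)+
  then show "B v w = \<epsilon> a a * B w v" and "B v w = \<epsilon> b b * B w v"
    by (simp_all only: form_swap[OF assms])
qed

lemma dual_deg:
  assumes e: "e \<in> E"
  shows "dual e \<in> G (- deg e)"
proof -
  let ?h = "hcomp G (dual e)"
  have h: "?h a \<in> G a" "finite {a. ?h a \<noteq> 0}" "dual e = (\<Sum>a | ?h a \<noteq> 0. ?h a)" for a
    using homogeneous_decomp_hcomp[OF graded, of "dual e"] by (auto simp: homogeneous_decomp_def)
  have "dual e = ?h (- deg e)"
  proof (rule dual_eqI)
    fix f assume f: "f \<in> E"
    have orth: "B f (?h a) = 0" if "a \<noteq> - deg f" for a
      using form_orthogonal[OF basis_deg[OF f] h(1)] that by (metis add.commute eq_neg_iff_add_eq_0)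
    have "B f (dual e) = (\<Sum>a | ?h a \<noteq> 0. B f (?h a))"
      by (subst h(3)) (simp add: form_simps)
    also have "\<dots> = (\<Sum>a | ?h a \<noteq> 0. if a = - deg f then B f (?h a) else 0)"
      using orth by (intro sum.cong) auto
    also have "\<dots> = B f (?h (- deg f))"
      using h(2) by (simp add: form_simps)
    finally show "B f (?h (- deg e)) = (if f = e then 1 else 0)"
      using form_dual[OF f, of e] orth[of "- deg e"] by (cases "f = e"; cases "deg f = deg e") auto
  qed
  then show ?thesis
    using h(1)[of "- deg e"] by simp
qed

lemma linear_dual_expansion_swap:
  assumes F: "linear_map s t F" and v: "v \<in> G a"
  shows "(\<Sum>e\<in>E. t (B v e) (F (dual e))) = t (\<epsilon> a a) (F v)"
proof -
  interpret t: vector_space t using F by (rule linear_map_vector_space)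
  have "(\<Sum>e\<in>E. t (B v e) (F (dual e))) = (\<Sum>e\<in>E. t (\<epsilon> a a) (t (B e v) (F (dual e))))"
    using form_swap_diagonal(1)[OF v basis_deg] by (intro sum.cong) auto
  then show ?thesis
    by (simp only: t.scale_sum_right[symmetric] linear_dual_expansion[OF F])
qed

lemma sum_dual_flip_weighted:
  assumes F: "bilinear_map s s t F"
  shows "(\<Sum>e\<in>E. t (c (deg e) * \<epsilon> (deg e) (deg e)) (F e (dual e)))
    = (\<Sum>e\<in>E. t (c (- deg e)) (F (dual e) e))"
proof -
  note F_linear = bilinear_map_linear[OF F]
  interpret t: vector_space t using F_linear(1) by (rule linear_map_vector_space)
  have "(\<Sum>e\<in>E. t (c (deg e) * \<epsilon> (deg e) (deg e)) (F e (dual e)))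
      = (\<Sum>e\<in>E. t (c (deg e)) (\<Sum>f\<in>E. t (B e f) (F (dual f) (dual e))))"
    using linear_dual_expansion_swap[OF F_linear(2) basis_deg] by simp
  also have "\<dots> = (\<Sum>e\<in>E. \<Sum>f\<in>E. t (c (- deg f)) (t (B e f) (F (dual f) (dual e))))"
  proof -
    have "c (deg e) * B e f = c (- deg f) * B e f" if "e \<in> E" "f \<in> E" for e f
      by (intro form_degree_cong[OF basis_deg[OF that(1)] basis_deg[OF that(2)]]) simp
    then show ?thesis
      by (simp only: t.scale_sum_right t.scale_scale cong: sum.cong)
  qed
  also have "\<dots> = (\<Sum>f\<in>E. \<Sum>e\<in>E. t (c (- deg f)) (t (B e f) (F (dual f) (dual e))))"
    by (rule sum.swap)
  also have "\<dots> = (\<Sum>f\<in>E. t (c (- deg f)) (F (dual f) f))"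
    by (simp only: t.scale_sum_right[symmetric] linear_dual_expansion[OF F_linear(1)])
  finally show ?thesis .
qed

lemma sum_dual_flip:
  assumes F: "bilinear_map s s t F"
  shows "(\<Sum>e\<in>E. t (\<epsilon> (deg e) (deg e)) (F e (dual e))) = (\<Sum>e\<in>E. F (dual e) e)"
  using sum_dual_flip_weighted[OF F, of "\<lambda>_. 1"]
      linear_map_vector_space(2)[OF bilinear_map_linear(1)[OF F]]
  by (simp add: vector_space_def)

lemma so_eps_linear: "f \<in> so_eps s G \<epsilon> B a \<Longrightarrow> linear_map s s f"
  and so_eps_deg: "f \<in> so_eps s G \<epsilon> B a \<Longrightarrow> v \<in> G b \<Longrightarrow> f v \<in> G (a + b)"
  and so_eps_skew: "f \<in> so_eps s G \<epsilon> B a \<Longrightarrow> v \<in> G b \<Longrightarrow> B (f v) w = - \<epsilon> a b * B v (f w)"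
  unfolding so_eps_def by (auto simp: add_eq_0_iff2)

lemma sum_dual_so_eps:
  assumes F: "bilinear_map s s t F" and f: "f \<in> so_eps s G \<epsilon> B a"
  shows "(\<Sum>e\<in>E. t (\<epsilon> a (- deg e)) (F (dual e) (f e))) = - (\<Sum>e\<in>E. F (f (dual e)) e)"
proof -
  have "(\<Sum>e\<in>E. t (\<epsilon> a (- deg e)) (F (dual e) (f e))) = (\<Sum>e\<in>E. F (- f (dual e)) e)"
  proof (rule sum_dual_adjoint[OF F so_eps_linear[OF f]
      linear_map_compose_neg[OF so_eps_linear[OF f]]])
    fix e e' assume "e \<in> E"
    then show "\<epsilon> a (- deg e) * B (f e) (dual e') = B e (- f (dual e'))"
      using so_eps_skew[OF f basis_deg] by (simp add: form_simps eps_simps)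
  qed
  then show ?thesis
    by (simp add: linear_map_neg[OF bilinear_map_linear(2)[OF F]] sum_negf)
qed

lemma eps_op_expansion: "eps_op s G \<epsilon> v = (\<Sum>e\<in>E. s (\<epsilon> (deg e) (deg e) * B v (dual e)) e)"
proof -
  define h where "h a = (\<Sum>e | e \<in> E \<and> deg e = a. s (B v (dual e)) e)" for a
  have "h a = 0" if "a \<notin> deg ` E" for a
    unfolding h_def using that by (intro sum.neutral) auto
  then have support: "{a. h a \<noteq> 0} \<subseteq> deg ` E"
    by blast
  have sum: "(\<Sum>a | h a \<noteq> 0. s (c a) (h a)) = (\<Sum>e\<in>E. s (c (deg e) * B v (dual e)) e)" for c
  proof -
    have "(\<Sum>a | h a \<noteq> 0. s (c a) (h a)) = (\<Sum>a\<in>deg ` E. s (c a) (h a))"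
      using support vs.finite_Basis by (intro sum.mono_neutral_left) auto
    also have "\<dots> = (\<Sum>a\<in>deg ` E. \<Sum>e | e \<in> E \<and> deg e = a. s (c (deg e) * B v (dual e)) e)"
      by (intro sum.cong refl) (simp add: h_def vs.scale_sum_right)
    also have "\<dots> = (\<Sum>e\<in>E. s (c (deg e) * B v (dual e)) e)"
      using sum.image_gen[OF vs.finite_Basis, of _ deg] by (rule sym)
    finally show ?thesis .
  qed
  have "homogeneous_decomp G v h"
    unfolding homogeneous_decomp_def
  proof (intro conjI allI)
    show "h a \<in> G a" for a
      unfolding h_def using basis_deg
      by (intro vs.subspace_sum vs.subspace_scale subspace_homogeneous) auto
    show "finite {a. h a \<noteq> 0}"
      by (rule finite_subset[OF support]) (simp add: vs.finite_Basis)
    show "v = (\<Sum>a | h a \<noteq> 0. h a)"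
      using sum[of "\<lambda>_. 1"] by (simp add: basis_expansion)
  qed
  then have "hcomp G v = h"
    by (rule hcomp_eqI[OF graded])
  then show ?thesis
    by (simp add: eps_op_def sum[of "\<lambda>a. \<epsilon> a a"])
qed

lemma eps_trace_eq_form:
  assumes f: "linear_map s s f"
  shows "eps_trace s G \<epsilon> f = (\<Sum>e\<in>E. B (f (dual e)) e)"
proof -
  have "linear_map s s (eps_op s G \<epsilon> \<circ> f)"
    unfolding comp_def eps_op_expansion by (intro linear_intros f)
  moreover have "B (eps_op s G \<epsilon> (f e)) (dual e) = \<epsilon> (deg e) (deg e) * B (f e) (dual e)" if "e \<in> E"
      for e
    using that by (simp add: eps_op_expansion form_simps form_dual if_distrib[of "\<lambda>c. _ * c"]
        vs.finite_Basis cong: sum.cong if_cong)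
  ultimately have "eps_trace s G \<epsilon> f = (\<Sum>e\<in>E. \<epsilon> (deg e) (deg e) * B (f e) (dual e))"
    by (simp add: eps_trace_def lin_trace_eq_form)
  also have "\<dots> = (\<Sum>e\<in>E. B (f (dual e)) e)"
    by (rule sum_dual_flip) (intro bilinear_mapI linear_intros f)
  finally show ?thesis .
qed

lemma eps_trace_add:
  "linear_map s s f \<Longrightarrow> linear_map s s g \<Longrightarrow>
    eps_trace s G \<epsilon> (\<lambda>v. f v + g v) = eps_trace s G \<epsilon> f + eps_trace s G \<epsilon> g"
  by (simp add: eps_trace_eq_form linear_map_compose_add form_simps sum.distrib)

lemma casimir_operator_deg:
  assumes X: "colour_form \<epsilon> s' G' B' X"
    and \<rho>: "\<And>a x. x \<in> G' a \<Longrightarrow> \<rho> x \<in> so_eps s G \<epsilon> B a" and v: "v \<in> G a"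
  shows "casimir_operator B' X \<rho> v \<in> G a"
proof -
  interpret X: colour_form \<epsilon> s' G' B' X by fact
  have "\<rho> (X.dual x) (\<rho> x v) \<in> G a" if "x \<in> X" for x
    using so_eps_deg[OF \<rho>[OF X.dual_deg[OF that]] so_eps_deg[OF \<rho>[OF X.basis_deg[OF that]] v]]
    by simp
  then show ?thesis
    unfolding casimir_operator_def by (intro vs.subspace_sum subspace_homogeneous)
qed

lemma casimir_operator_selfadjoint:
  assumes X: "colour_form \<epsilon> s' G' B' X"
    and linear: "\<And>v. linear_map s' s (\<lambda>x. \<rho> x v)" "\<And>x. linear_map s s (\<rho> x)"
    and \<rho>: "\<And>a x. x \<in> G' a \<Longrightarrow> \<rho> x \<in> so_eps s G \<epsilon> B a" and v: "v \<in> G a"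
  shows "B (casimir_operator B' X \<rho> v) w = B v (casimir_operator B' X \<rho> w)"
proof -
  interpret X: colour_form \<epsilon> s' G' B' X by fact
  have skew: "B (\<rho> (X.dual x) (\<rho> x v)) w
      = \<epsilon> (X.deg x) (X.deg x) * B v (\<rho> x (\<rho> (X.dual x) w))" if x: "x \<in> X" for x
  proof -
    note \<rho>x = \<rho>[OF X.basis_deg[OF x]]
    have "B (\<rho> (X.dual x) (\<rho> x v)) w
        = \<epsilon> (- X.deg x) (X.deg x + a) * (\<epsilon> (X.deg x) a * B v (\<rho> x (\<rho> (X.dual x) w)))"
      by (simp add: so_eps_skew[OF \<rho>[OF X.dual_deg[OF x]] so_eps_deg[OF \<rho>x v]] so_eps_skew[OF \<rho>x v])
    then show ?thesis
      using eps_swap[of "X.deg x" a] unfolding eps_simps by algebra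
  qed
  have "B (casimir_operator B' X \<rho> v) w
      = (\<Sum>x\<in>X. \<epsilon> (X.deg x) (X.deg x) * B v (\<rho> x (\<rho> (X.dual x) w)))"
    by (simp add: casimir_operator_def form_simps skew)
  also have "\<dots> = (\<Sum>x\<in>X. B v (\<rho> (X.dual x) (\<rho> x w)))"
    by (rule X.sum_dual_flip)
      (intro bilinear_mapI linear_intros linear(1) linear_map_compose[OF linear(2) linear(1)])
  finally show ?thesis
    by (simp add: casimir_operator_def form_simps)
qed

end

section \<open>Quadratic elements of a colour Clifford algebra\<close>

locale colour_clifford = colour_form \<epsilon> s G B E
  for \<epsilon> :: "'a::ab_group_add \<Rightarrow> 'a \<Rightarrow> 'k::field"
    and s :: "'k \<Rightarrow> 'v::ab_group_add \<Rightarrow> 'v" and G B E +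
  fixes sA :: "'k \<Rightarrow> 'w::ring_1 \<Rightarrow> 'w" and c :: "'v \<Rightarrow> 'w"
  assumes algebra [linear_intros]: "algebra_over sA"
    and generator_linear: "linear_map s sA c"
    and clifford: "u \<in> G a \<Longrightarrow> v \<in> G b \<Longrightarrow> c u * c v = sA (2 * B u v) 1 - sA (\<epsilon> a b) (c v * c u)"
    and two_nonzero: "(2::'k) \<noteq> 0"
begin

sublocale alg: vector_space sA
  by (rule algebra_over_vector_space[OF algebra])

declare alg.vector_space_axioms [linear_intros]
    linear_map_compose[OF generator_linear, linear_intros]

lemmas scale_mult = algebra_over_scale_mult[OF algebra]

lemmas alg_simps = scale_mult alg.scale_right_distrib alg.scale_right_diff_distrib
  distrib_left distrib_right right_diff_distrib left_diff_distrib mult.assoc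

lemmas generator_simps = linear_map_simps[OF generator_linear]

lemma generator_commute:
  "u \<in> G a \<Longrightarrow> v \<in> G b \<Longrightarrow> c u * c v = sA (- \<epsilon> a b) (c v * c u) + sA (2 * B u v) 1"
  using clifford[of u a v b] by simp

lemma four_nonzero: "(4::'k) \<noteq> 0"
  using two_nonzero mult_eq_0_iff[of "2::'k" 2] by simp

text \<open>\<open>lift f\<close> is \<open>4 f\<^sub>*\<close>; clearing the denominators keeps the scalars below integral.\<close>

definition lift :: "('v \<Rightarrow> 'v) \<Rightarrow> 'w" where
  "lift f = (\<Sum>e\<in>E. c (f (dual e)) * c e)"

lemma lift_linear [linear_intros]:
  "vector_space t \<Longrightarrow> (\<And>v. linear_map t s (\<lambda>u. h u v)) \<Longrightarrow> linear_map t sA (\<lambda>u. lift (h u))"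
  unfolding lift_def by (intro linear_intros)

lemma lift_diff: "lift (\<lambda>v. f v - g v) = lift f - lift g"
  and lift_scale: "lift (\<lambda>v. s k (f v)) = sA k (lift f)"
  and lift_sum: "lift (\<lambda>v. \<Sum>i\<in>I. h i v) = (\<Sum>i\<in>I. lift (h i))"
  by (simp_all add: lift_def generator_simps scale_mult left_diff_distrib sum_subtractf
      alg.scale_sum_right sum_distrib_right sum.swap[of _ I])

lemma lift_commute_generator:
  assumes f: "f \<in> so_eps s G \<epsilon> B a" and w: "w \<in> G b"
  shows "lift f * c w = sA (\<epsilon> a b) (c w * lift f) + sA 4 (c (f w))"
proof -
  have summand: "c (f (dual e)) * c e * c w = sA (\<epsilon> a b) (c w * (c (f (dual e)) * c e))
      + (sA 2 (sA (B (f w) (dual e)) (c e)) + sA 2 (sA (B e w) (c (f (dual e)))))"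
    if e: "e \<in> E" for e
  proof -
    have fe: "f (dual e) \<in> G (a - deg e)"
      using so_eps_deg[OF f dual_deg[OF e]] by simp
    have "B (f (dual e)) w = - \<epsilon> a (- deg e) * (\<epsilon> (- deg e) (a + b) * B (f w) (dual e))"
      by (simp only: so_eps_skew[OF f dual_deg[OF e]]
          form_swap[OF dual_deg[OF e] so_eps_deg[OF f w]])
    then have form: "- \<epsilon> (deg e) b * (2 * B (f (dual e)) w) = 2 * B (f w) (dual e)"
      using eps_swap[of a "deg e"] eps_swap[of b "deg e"] unfolding eps_simps by algebra
    have eps: "- \<epsilon> (a - deg e) b * - \<epsilon> (deg e) b = \<epsilon> a b"
      by (simp add: eps_simps mult.assoc)
    show ?thesis
      using twisted_commute_mult_right[OF algebra generator_commute[OF fe w]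
          generator_commute[OF basis_deg[OF e] w]]
      by (simp only: eps form scale_mult alg.scale_scale mult_1_left mult_1_right)
  qed
  have "lift f * c w = sA (\<epsilon> a b) (c w * lift f)
      + (sA 2 (\<Sum>e\<in>E. sA (B (f w) (dual e)) (c e)) + sA 2 (\<Sum>e\<in>E. sA (B e w) (c (f (dual e)))))"
    by (simp only: lift_def sum_distrib_left sum_distrib_right alg.scale_sum_right
        summand sum.distrib cong: sum.cong)
  also have "\<dots> = sA (\<epsilon> a b) (c w * lift f) + (sA 2 (c (f w)) + sA 2 (c (f w)))"
    by (simp only: linear_expansion[OF generator_linear]
        linear_dual_expansion[OF linear_map_compose[OF generator_linear so_eps_linear[OF f]]])
  finally show ?thesis
    by (simp flip: alg.scale_left_distrib)
qed

lemma lift_commute_lift: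
  assumes f: "f \<in> so_eps s G \<epsilon> B a" and g: "g \<in> so_eps s G \<epsilon> B b"
  shows "lift f * lift g = sA (\<epsilon> a b) (lift g * lift f)
      + sA 4 (lift (\<lambda>v. f (g v) - s (\<epsilon> a b) (g (f v))))"
proof -
  have summand: "lift f * (c (g (dual e)) * c e) = sA (\<epsilon> a b) (c (g (dual e)) * c e * lift f)
      + (sA 4 (c (f (g (dual e))) * c e)
        + sA (4 * \<epsilon> a b) (sA (\<epsilon> a (- deg e)) (c (g (dual e)) * c (f e))))"
    if e: "e \<in> E" for e
  proof -
    have "g (dual e) \<in> G (b - deg e)"
      using so_eps_deg[OF g dual_deg[OF e]] by simp
    from twisted_commute_mult_left[OF algebra lift_commute_generator[OF f this]
        lift_commute_generator[OF f basis_deg[OF e]]]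
    show ?thesis
      by (simp add: eps_simps mult_ac scale_mult)
  qed
  have "lift f * lift g = sA (\<epsilon> a b) (lift g * lift f)
      + (sA 4 (lift (\<lambda>v. f (g v)))
        + sA (4 * \<epsilon> a b) (\<Sum>e\<in>E. sA (\<epsilon> a (- deg e)) (c (g (dual e)) * c (f e))))"
    by (simp only: lift_def[of g] lift_def[of "\<lambda>v. f (g v)"] sum_distrib_left sum_distrib_right
        alg.scale_sum_right summand sum.distrib cong: sum.cong)
  also have "(\<Sum>e\<in>E. sA (\<epsilon> a (- deg e)) (c (g (dual e)) * c (f e))) = - lift (\<lambda>v. g (f v))"
    unfolding lift_def by (rule sum_dual_so_eps[OF _ f, of sA "\<lambda>p q. c (g p) * c q"])
      (intro bilinear_mapI linear_intros so_eps_linear[OF g])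
  finally show ?thesis
    by (simp add: lift_diff lift_scale alg.scale_right_diff_distrib)
qed

lemma lift_selfadjoint:
  assumes f: "linear_map s s f" and f_deg: "\<And>a v. v \<in> G a \<Longrightarrow> f v \<in> G a"
    and selfadjoint: "\<And>a v w. v \<in> G a \<Longrightarrow> B (f v) w = B v (f w)"
  shows "lift f = sA (eps_trace s G \<epsilon> f) 1"
proof -
  have "(\<Sum>e\<in>E. sA (\<epsilon> (deg e) (deg e)) (c e * c (f (dual e)))) = (\<Sum>e\<in>E. c (dual e) * c (f e))"
    by (rule sum_dual_flip) (intro bilinear_mapI linear_intros f)
  also have "\<dots> = lift f"
    using sum_dual_adjoint[of sA "\<lambda>p q. c p * c q" f f "\<lambda>_. 1"] f selfadjoint[OF basis_deg]
    by (simp add: lift_def bilinear_mapI linear_intros)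
  finally have "lift f = sA (2 * eps_trace s G \<epsilon> f) 1 - lift f"
    using clifford[OF f_deg[OF dual_deg] basis_deg]
    by (simp add: lift_def[of f] eps_simps sum_subtractf eps_trace_eq_form[OF f] sum_distrib_left
        flip: alg.scale_sum_left)
  then have "sA 2 (lift f) = sA 2 (sA (eps_trace s G \<epsilon> f) 1)"
    by (metis diff_add_cancel one_add_one alg.scale_left_distrib alg.scale_one alg.scale_scale)
  then show ?thesis
    using two_nonzero alg.scale_left_imp_eq by blast
qed

lemma sum_swapped_generators:
  assumes F: "bilinear_map s s sA F"
  shows "(\<Sum>e\<in>E. \<Sum>f\<in>E. sA (\<epsilon> (- deg e) (- deg f)) (F (dual f) (dual e) * (c f * c e)))
    = sA 2 (\<Sum>e\<in>E. F (dual e) e) - (\<Sum>e\<in>E. \<Sum>f\<in>E. F (dual e) (dual f) * (c f * c e))"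
proof -
  have summand: "sA (\<epsilon> (- deg e) (- deg f)) (F (dual f) (dual e) * (c f * c e))
      = sA 2 (sA (B e f) (F (dual f) (dual e))) - F (dual f) (dual e) * (c e * c f)"
    if "e \<in> E" "f \<in> E" for e f
  proof -
    note ef = basis_deg[OF that(1)] basis_deg[OF that(2)]
    have "sA (\<epsilon> (- deg e) (- deg f)) (c f * c e) = sA (2 * B e f) 1 - c e * c f"
      unfolding clifford[OF ef] by (simp add: eps_simps)
    then have "F (dual f) (dual e) * sA (\<epsilon> (- deg e) (- deg f)) (c f * c e)
        = F (dual f) (dual e) * (sA (2 * B e f) 1 - c e * c f)"
      by simp
    then show ?thesis
      by (simp add: scale_mult right_diff_distrib)
  qed
  have "(\<Sum>e\<in>E. \<Sum>f\<in>E. sA (\<epsilon> (- deg e) (- deg f)) (F (dual f) (dual e) * (c f * c e)))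
      = sA 2 (\<Sum>e\<in>E. \<Sum>f\<in>E. sA (B e f) (F (dual f) (dual e)))
        - (\<Sum>e\<in>E. \<Sum>f\<in>E. F (dual f) (dual e) * (c e * c f))"
    by (simp only: summand sum_subtractf alg.scale_sum_right cong: sum.cong)
  also have "(\<Sum>e\<in>E. \<Sum>f\<in>E. sA (B e f) (F (dual f) (dual e)))
      = (\<Sum>f\<in>E. \<Sum>e\<in>E. sA (B e f) (F (dual f) (dual e)))"
    by (rule sum.swap)
  also have "\<dots> = (\<Sum>f\<in>E. F (dual f) f)"
    by (intro sum.cong refl linear_dual_expansion bilinear_map_linear(1)[OF F])
  also have "(\<Sum>e\<in>E. \<Sum>f\<in>E. F (dual f) (dual e) * (c e * c f))
      = (\<Sum>e\<in>E. \<Sum>f\<in>E. F (dual e) (dual f) * (c f * c e))"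
    by (rule sum.swap)
  finally show ?thesis .
qed

lemma sum_moment_generators:
  assumes X: "colour_form \<epsilon> s' G' B' X"
    and \<rho>: "\<And>a x. x \<in> G' a \<Longrightarrow> \<rho> x \<in> so_eps s G \<epsilon> B a"
    and m: "\<And>x e f. x \<in> X \<Longrightarrow> e \<in> E \<Longrightarrow> f \<in> E \<Longrightarrow>
      B' x (m (dual e) (dual f)) = B (\<rho> x (dual e)) (dual f)"
    and h: "linear_map s' sA h"
  shows "(\<Sum>e\<in>E. \<Sum>f\<in>E. sA (k (- deg e - deg f)) (h (m (dual e) (dual f)) * (c f * c e)))
    = (\<Sum>x\<in>X. sA (k (- degree G' x)) (h (dual_basis B' X x) * lift (\<rho> x)))"
proof -
  interpret X: colour_form \<epsilon> s' G' B' X by fact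
  have expand: "sA (k (- deg e - deg f)) (h (m (dual e) (dual f)) * (c f * c e))
      = (\<Sum>x\<in>X. sA (k (- X.deg x)) (sA (B (\<rho> x (dual e)) (dual f)) (h (X.dual x) * (c f * c e))))"
    if e: "e \<in> E" and f: "f \<in> E" for e f
  proof -
    have weight: "k (- deg e - deg f) * B (\<rho> x (dual e)) (dual f)
        = k (- X.deg x) * B (\<rho> x (dual e)) (dual f)"
      if x: "x \<in> X" for x
      by (rule form_degree_cong[OF so_eps_deg[OF \<rho>[OF X.basis_deg[OF x]] dual_deg[OF e]]
          dual_deg[OF f]])
        (simp add: algebra_simps)
    have "h (m (dual e) (dual f)) * (c f * c e)
        = (\<Sum>x\<in>X. sA (B' x (m (dual e) (dual f))) (h (X.dual x) * (c f * c e)))"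
      by (rule X.linear_dual_expansion[symmetric]) (intro linear_intros h)
    then show ?thesis
      by (simp only: alg.scale_sum_right alg.scale_scale m[OF _ e f] weight cong: sum.cong)
  qed
  have "(\<Sum>e\<in>E. \<Sum>f\<in>E. sA (k (- deg e - deg f)) (h (m (dual e) (dual f)) * (c f * c e)))
      = (\<Sum>e\<in>E. \<Sum>f\<in>E. \<Sum>x\<in>X.
        sA (k (- X.deg x)) (sA (B (\<rho> x (dual e)) (dual f)) (h (X.dual x) * (c f * c e))))"
    by (simp only: expand cong: sum.cong)
  also have "\<dots> = (\<Sum>x\<in>X. \<Sum>e\<in>E. \<Sum>f\<in>E.
        sA (k (- X.deg x)) (sA (B (\<rho> x (dual e)) (dual f)) (h (X.dual x) * (c f * c e))))"
    by (rule sum_rotate)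
  also have "\<dots> = (\<Sum>x\<in>X. sA (k (- X.deg x)) (\<Sum>e\<in>E. h (X.dual x) * (c (\<rho> x (dual e)) * c e)))"
    unfolding alg.scale_sum_right[symmetric]
    by (intro sum.cong refl arg_cong[of _ _ "sA _"] linear_expansion linear_intros generator_linear)
  finally show ?thesis
    by (simp only: lift_def sum_distrib_left)
qed

end

section \<open>Colour Lie algebras\<close>

lemma colour_lie_algebra_graded: "colour_lie_algebra s G \<epsilon> br \<Longrightarrow> graded_space s G"
  and colour_lie_algebra_vector_space: "colour_lie_algebra s G \<epsilon> br \<Longrightarrow> vector_space s"
  and colour_lie_algebra_bilinear: "colour_lie_algebra s G \<epsilon> br \<Longrightarrow> bilinear_map s s s br"
  and colour_lie_algebra_deg: "colour_lie_algebra s G \<epsilon> br \<Longrightarrow> x \<in> G a \<Longrightarrow> y \<in> G b \<Longrightarrow> br x y \<in> G (a + b)"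
  and colour_lie_algebra_antisym:
    "colour_lie_algebra s G \<epsilon> br \<Longrightarrow> x \<in> G a \<Longrightarrow> y \<in> G b \<Longrightarrow> br x y = - s (\<epsilon> a b) (br y x)"
  and colour_lie_algebra_jacobi:
    "colour_lie_algebra s G \<epsilon> br \<Longrightarrow> x \<in> G a \<Longrightarrow> y \<in> G b \<Longrightarrow> z \<in> G c \<Longrightarrow>
      s (\<epsilon> c a) (br x (br y z)) + s (\<epsilon> a b) (br y (br z x)) + s (\<epsilon> b c) (br z (br x y)) = 0"
  unfolding colour_lie_algebra_def graded_space_def by blast+

context commutation
begin

lemma colour_lie_algebra_leibniz:
  assumes lie: "colour_lie_algebra s G \<epsilon> br" and x: "x \<in> G a" and y: "y \<in> G b"
  shows "br x (br y z) = br (br x y) z + s (\<epsilon> a b) (br y (br x z))"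
proof -
  interpret vector_space s
    using lie by (rule colour_lie_algebra_vector_space)
  note br_linear = bilinear_map_linear(1)[OF colour_lie_algebra_bilinear[OF lie]]
  show ?thesis
  proof (rule linear_map_eqI_graded[OF colour_lie_algebra_graded[OF lie],
        of s "\<lambda>z. br x (br y z)" "\<lambda>z. br (br x y) z + s (\<epsilon> a b) (br y (br x z))"])
    show "linear_map s s (\<lambda>z. br x (br y z))"
      "linear_map s s (\<lambda>z. br (br x y) z + s (\<epsilon> a b) (br y (br x z)))"
      by (intro linear_intros linear_map_compose[OF br_linear] br_linear)+
  next
    fix c z assume z: "z \<in> G c"
    have zx: "br z x = - s (\<epsilon> c a) (br x z)"
      and zxy: "br z (br x y) = - s (\<epsilon> c (a + b)) (br (br x y) z)"
      by (rule colour_lie_algebra_antisym[OF lie z x]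
          colour_lie_algebra_antisym[OF lie z colour_lie_algebra_deg[OF lie x y]])+
    have eps: "\<epsilon> b c * \<epsilon> c (a + b) = \<epsilon> c a"
      using eps_swap[of b c] unfolding eps_simps by algebra
    have "s (\<epsilon> c a) (br x (br y z)) - s (\<epsilon> a b * \<epsilon> c a) (br y (br x z))
        - s (\<epsilon> b c * \<epsilon> c (a + b)) (br (br x y) z) = 0"
      using colour_lie_algebra_jacobi[OF lie x y z]
      by (simp add: zx zxy linear_map_simps[OF br_linear])
    then have "s (\<epsilon> c a) (br x (br y z) - (br (br x y) z + s (\<epsilon> a b) (br y (br x z)))) = 0"
      unfolding eps by (simp add: algebra_simps)
    then show "br x (br y z) = br (br x y) z + s (\<epsilon> a b) (br y (br x z))"
      using eps_nonzero[of c a] by simp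
  qed
qed

end

section \<open>Representations of colour Lie type\<close>

lemma ext_simps [simp]:
  "ext_scale sg sv k (x, v) = (sg k x, sv k v)"
  "(x, v) \<in> ext_part Gg Gv a \<longleftrightarrow> x \<in> Gg a \<and> v \<in> Gv a"
  "ext_form Bg Bv (x, v) (y, w) = Bg x y + Bv v w"
  by (simp_all add: ext_scale_def ext_part_def ext_form_def)

locale colour_lie_type_rep = commutation \<epsilon>
  for \<epsilon> :: "'a::ab_group_add \<Rightarrow> 'a \<Rightarrow> 'k::field" +
  fixes sg :: "'k \<Rightarrow> 'g::ab_group_add \<Rightarrow> 'g" and Gg :: "'a \<Rightarrow> 'g set"
    and brg :: "'g \<Rightarrow> 'g \<Rightarrow> 'g" and Bg :: "'g \<Rightarrow> 'g \<Rightarrow> 'k"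
    and sv :: "'k \<Rightarrow> 'v::ab_group_add \<Rightarrow> 'v" and Gv :: "'a \<Rightarrow> 'v set"
    and Bv :: "'v \<Rightarrow> 'v \<Rightarrow> 'k"
    and \<pi> :: "'g \<Rightarrow> 'v \<Rightarrow> 'v" and \<phi> :: "'v \<Rightarrow> 'v \<Rightarrow> 'v"
    and X :: "'g set" and E :: "'v set" and Y :: "('g \<times> 'v) set"
  assumes quadratic_g: "eps_quadratic sg Gg \<epsilon> brg Bg"
    and rep: "orthogonal_rep sg Gg \<epsilon> brg sv Gv Bv \<pi>"
    and lie_type: "colour_lie_type sg Gg \<epsilon> brg Bg sv Gv Bv \<pi> \<phi>"
    and basis_g: "homogeneous_basis sg Gg X" and basis_v: "homogeneous_basis sv Gv E"
    and basis_t: "homogeneous_basis (ext_scale sg sv) (ext_part Gg Gv) Y"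
begin

abbreviation st :: "'k \<Rightarrow> 'g \<times> 'v \<Rightarrow> 'g \<times> 'v" where
  "st \<equiv> ext_scale sg sv"

abbreviation Gt :: "'a \<Rightarrow> ('g \<times> 'v) set" where
  "Gt \<equiv> ext_part Gg Gv"

abbreviation Bt :: "'g \<times> 'v \<Rightarrow> 'g \<times> 'v \<Rightarrow> 'k" where
  "Bt \<equiv> ext_form Bg Bv"

abbreviation brt :: "'g \<times> 'v \<Rightarrow> 'g \<times> 'v \<Rightarrow> 'g \<times> 'v" where
  "brt \<equiv> ext_bracket Gg \<epsilon> brg Bg sv Gv Bv \<pi> \<phi>"

abbreviation \<mu> :: "'v \<Rightarrow> 'v \<Rightarrow> 'g" where
  "\<mu> \<equiv> moment_map Bg Bv \<pi>"

lemma lie_g: "colour_lie_algebra sg Gg \<epsilon> brg"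
  using quadratic_g by (simp add: eps_quadratic_def)

lemma quadratic_t: "eps_quadratic st Gt \<epsilon> brt Bt"
  using lie_type by (simp add: colour_lie_type_def)

lemma lie_t: "colour_lie_algebra st Gt \<epsilon> brt"
  using quadratic_t by (simp add: eps_quadratic_def)

sublocale colour_form \<epsilon> sv Gv Bv E
  using rep basis_v by unfold_locales (simp_all add: orthogonal_rep_def)

sublocale g: colour_form \<epsilon> sg Gg Bg X
  using quadratic_g basis_g colour_lie_algebra_graded[OF lie_g]
  by unfold_locales (simp_all add: eps_quadratic_def)

sublocale t: colour_form \<epsilon> st Gt Bt Y
  using quadratic_t basis_t colour_lie_algebra_graded[OF lie_t]
  by unfold_locales (simp_all add: eps_quadratic_def)

lemma embedding_linear [linear_intros]:
  "linear_map r sg f \<Longrightarrow> linear_map r st (\<lambda>u. (f u, 0))"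
  "linear_map r sv h \<Longrightarrow> linear_map r st (\<lambda>u. (0, h u))"
  by (simp_all add: Vector_Spaces.linear_iff t.vector_space)

lemma pi_linear_left: "linear_map sg sv (\<lambda>x. \<pi> x v)"
  and pi_so: "x \<in> Gg a \<Longrightarrow> \<pi> x \<in> so_eps sv Gv \<epsilon> Bv a"
  and pi_bracket:
    "x \<in> Gg a \<Longrightarrow> y \<in> Gg b \<Longrightarrow> \<pi> (brg x y) v = \<pi> x (\<pi> y v) - sv (\<epsilon> a b) (\<pi> y (\<pi> x v))"
  using rep unfolding orthogonal_rep_def by blast+

lemma pi_linear_right: "linear_map sv sv (\<pi> x)"
proof -
  have "\<pi> x = (\<lambda>v. \<Sum>y\<in>X. sv (Bg x (g.dual y)) (\<pi> y v))"
    using g.linear_expansion[OF pi_linear_left] by metis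
  moreover have "linear_map sv sv (\<lambda>v. \<Sum>y\<in>X. sv (Bg x (g.dual y)) (\<pi> y v))"
    by (intro linear_intros so_eps_linear[OF pi_so[OF g.basis_deg]])
  ultimately show ?thesis by simp
qed

lemmas pi_linear [linear_intros] = linear_map_compose[OF pi_linear_left]
    linear_map_compose[OF pi_linear_right]

lemma phi_bilinear: "bilinear_map sv sv sv \<phi>"
  and phi_deg: "u \<in> Gv a \<Longrightarrow> v \<in> Gv b \<Longrightarrow> \<phi> u v \<in> Gv (a + b)"
  and phi_invariant: "u \<in> Gv a \<Longrightarrow> v \<in> Gv b \<Longrightarrow> Bv (\<phi> u v) w = - \<epsilon> a b * Bv v (\<phi> u w)"
  and phi_antisym: "u \<in> Gv a \<Longrightarrow> v \<in> Gv b \<Longrightarrow> \<phi> u v = - sv (\<epsilon> a b) (\<phi> v u)"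
  using lie_type unfolding colour_lie_type_def by blast+

lemmas phi_linear [linear_intros] = linear_map_compose[OF bilinear_map_linear(1)[OF phi_bilinear]]
  linear_map_compose[OF bilinear_map_linear(2)[OF phi_bilinear]]

lemmas phi_simps = linear_map_simps[OF bilinear_map_linear(1)[OF phi_bilinear]]
  linear_map_simps[OF bilinear_map_linear(2)[OF phi_bilinear]]

lemma phi_so: "u \<in> Gv a \<Longrightarrow> \<phi> u \<in> so_eps sv Gv \<epsilon> Bv a"
  unfolding so_eps_def by (auto simp: bilinear_map_linear(1)[OF phi_bilinear] phi_deg phi_invariant)

lemma form_phi_cyclic:
  assumes u: "u \<in> Gv a" and v: "v \<in> Gv b"
  shows "Bv u (\<phi> v w) = Bv (\<phi> u v) w"
  using so_eps_skew[OF phi_so[OF v] u, of w] by (simp add: phi_antisym[OF u v] form_simps)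

lemma moment_form: "Bg x (\<mu> v w) = Bv (\<pi> x v) w"
proof -
  obtain m where basis_values: "\<forall>x\<in>X. Bg x m = Bv (\<pi> x v) w"
    using g.ex_form_values[of "\<lambda>x. Bv (\<pi> x v) w"] by (rule exE)
  have m: "Bg x m = Bv (\<pi> x v) w" for x
    by (rule g.linear_map_eqI[of "(*)" "\<lambda>x. Bg x m" "\<lambda>x. Bv (\<pi> x v) w"])
      (auto intro!: linear_intros simp: basis_values)
  then have "\<mu> v w = m"
    unfolding moment_map_def by (intro the_equality) (auto intro: g.form_eqI)
  with m show ?thesis by simp
qed

lemma moment_expansion: "\<mu> v w = (\<Sum>x\<in>X. sg (Bv (\<pi> x v) w) (g.dual x))"
  using g.dual_basis_expansion[of "\<mu> v w"] by (simp add: moment_form)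

lemma linear_moment_expansion:
  "linear_map sg t h \<Longrightarrow> h (\<mu> v w) = (\<Sum>x\<in>X. t (Bv (\<pi> x v) w) (h (g.dual x)))"
  by (simp add: moment_expansion linear_map_simps)

lemma moment_linear [linear_intros]:
  "linear_map t sv f \<Longrightarrow> linear_map t sg (\<lambda>u. \<mu> v (f u))"
  "linear_map t sv f \<Longrightarrow> linear_map t sg (\<lambda>u. \<mu> (f u) w)"
  unfolding moment_expansion by (intro linear_intros; (assumption | erule linear_map_vector_space))+

lemmas moment_simps = moment_linear[OF linear_map_ident[OF vector_space], THEN linear_map_neg]
  moment_linear[OF linear_map_ident[OF vector_space], THEN linear_map_scale]
  moment_linear[OF linear_map_ident[OF vector_space], THEN linear_map_zero]

lemma bracket_linear: "linear_map st st (brt p)" "linear_map st st (\<lambda>p. brt p q)"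
  by (rule bilinear_map_linear[OF colour_lie_algebra_bilinear[OF lie_t]])+

lemmas bracket_linear_compose [linear_intros] =
  linear_map_compose[OF bracket_linear(1)] linear_map_compose[OF bracket_linear(2)]

lemma hcomp_zero: "hcomp Gv 0 = (\<lambda>_. 0)" "hcomp Gg 0 = (\<lambda>_. 0)"
  by (intro hcomp_eqI[OF graded] hcomp_eqI[OF g.graded]; simp add: homogeneous_decomp_def)+

lemma bracket_gg: "brt (x, 0) (y, 0) = (brg x y, 0)"
  and bracket_gv: "brt (x, 0) (0, w) = (0, \<pi> x w)"
  and bracket_vv: "brt (0, u) (0, w) = (\<mu> u w, \<phi> u w)"
  using linear_map_zero[OF bilinear_map_linear(1)[OF colour_lie_algebra_bilinear[OF lie_g]]]
  by (simp_all add: ext_bracket_def hcomp_zero moment_simps phi_simps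
      linear_map_zero[OF pi_linear_left] linear_map_zero[OF pi_linear_right])

lemma bracket_vg:
  assumes "u \<in> Gv a" "x \<in> Gg b"
  shows "brt (0, u) (x, 0) = (0, - sv (\<epsilon> a b) (\<pi> x u))"
  using colour_lie_algebra_antisym[OF lie_t, of "(0, u)" a "(x, 0)" b] assms
  by (simp add: bracket_gv)

lemma moment_deg: "u \<in> Gv a \<Longrightarrow> w \<in> Gv b \<Longrightarrow> \<mu> u w \<in> Gg (a + b)"
  using colour_lie_algebra_deg[OF lie_t, of "(0, u)" a "(0, w)" b] by (simp add: bracket_vv)

lemma bracket_pair_right: "brt p (x, v) = brt p (x, 0) + brt p (0, v)"
  and bracket_pair_left: "brt (x, v) p = brt (x, 0) p + brt (0, v) p"
  by (simp_all flip: linear_map_add[OF bracket_linear(1)] linear_map_add[OF bracket_linear(2)])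

lemma phi_jacobi:
  assumes u: "u \<in> Gv a" and v: "v \<in> Gv b" and w: "w \<in> Gv c"
  shows "\<phi> u (\<phi> v w) - \<phi> (\<phi> u v) w - sv (\<epsilon> a b) (\<phi> v (\<phi> u w))
      = sv (\<epsilon> a (b + c)) (\<pi> (\<mu> v w) u) + \<pi> (\<mu> u v) w - sv (\<epsilon> b c) (\<pi> (\<mu> u w) v)"
proof -
  have eps: "\<epsilon> a b * \<epsilon> b (a + c) = \<epsilon> b c"
    using eps_swap[of a b] unfolding eps_simps by algebra
  have "brt (0, u) (\<mu> v w, \<phi> v w) = brt (\<mu> u v, \<phi> u v) (0, w)
      + st (\<epsilon> a b) (brt (0, v) (\<mu> u w, \<phi> u w))"
    using colour_lie_algebra_leibniz[OF lie_t, of "(0, u)" a "(0, v)" b "(0, w)"] u v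
    by (simp add: bracket_vv)
  then have "\<phi> u (\<phi> v w) - sv (\<epsilon> a (b + c)) (\<pi> (\<mu> v w) u)
      = \<pi> (\<mu> u v) w + \<phi> (\<phi> u v) w
        + (sv (\<epsilon> a b) (\<phi> v (\<phi> u w)) - sv (\<epsilon> a b * \<epsilon> b (a + c)) (\<pi> (\<mu> u w) v))"
    unfolding bracket_pair_right[of _ "\<mu> _ _" "\<phi> _ _"] bracket_pair_left[of "\<mu> _ _" "\<phi> _ _"]
    by (simp add: bracket_gv bracket_vv bracket_vg[OF u moment_deg[OF v w]]
        bracket_vg[OF v moment_deg[OF u w]] vs.scale_right_diff_distrib)
  then show ?thesis
    unfolding eps by (simp add: algebra_simps)
qed

subsection \<open>Traces of the Casimir operators\<close>

lemma sum_dual_pair: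
  assumes F: "bilinear_map st st r F"
  shows "(\<Sum>y\<in>Y. F (t.dual y) y) = (\<Sum>x\<in>X. F (g.dual x, 0) (x, 0)) + (\<Sum>e\<in>E. F (0, dual e) (0, e))"
proof -
  let ?b = "case_sum (\<lambda>x. (x, 0)) (\<lambda>e. (0, e))"
  let ?b' = "case_sum (\<lambda>x. (g.dual x, 0)) (\<lambda>e. (0, dual e))"
  note sum_Plus = sum.Plus[OF g.vs.finite_Basis vs.finite_Basis]
  have "(\<Sum>i\<in>X <+> E. st (Bt p (?b' i)) (?b i)) = p" for p
  proof (cases p)
    case (Pair x u)
    have "(\<Sum>i\<in>X <+> E. st (Bt p (?b' i)) (?b i))
        = (\<Sum>y\<in>X. st (Bg x (g.dual y)) (y, 0)) + (\<Sum>e\<in>E. st (Bv u (dual e)) (0, e))"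
      by (simp add: Pair sum_Plus form_simps g.form_simps)
    also have "\<dots> = (x, 0) + (0, u)"
      by (intro arg_cong2[of _ _ _ _ "(+)"] g.linear_expansion[of st "\<lambda>x. (x, 0)"]
          linear_expansion[of st "\<lambda>u. (0, u)"] linear_intros)
    finally show ?thesis
      by (simp add: Pair)
  qed
  then show ?thesis
    using t.sum_dual_basis_eq[OF F, where I = "X <+> E" and b' = ?b' and b = ?b]
    by (simp add: sum_Plus)
qed

lemma casimir_operator_pair:
  "casimir_operator Bt Y brt p
    = casimir_operator Bg X (\<lambda>x. brt (x, 0)) p + casimir_operator Bv E (\<lambda>v. brt (0, v)) p"
  unfolding casimir_operator_def
  by (rule sum_dual_pair[where r = st]) (intro bilinear_mapI linear_intros)

lemma eps_trace_pair:
  assumes f: "linear_map st st f"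
  shows "eps_trace st Gt \<epsilon> f
    = (\<Sum>x\<in>X. Bt (f (g.dual x, 0)) (x, 0)) + (\<Sum>e\<in>E. Bt (f (0, dual e)) (0, e))"
  unfolding t.eps_trace_eq_form[OF f]
  by (rule sum_dual_pair[where r = "(*)"])
    (intro bilinear_mapI linear_intros linear_map_compose[OF f])

abbreviation pi_casimir :: "'v \<Rightarrow> 'v" where
  "pi_casimir \<equiv> casimir_operator Bg X \<pi>"

abbreviation phi_casimir :: "'v \<Rightarrow> 'v" where
  "phi_casimir \<equiv> casimir_operator Bv E \<phi>"

abbreviation \<tau> :: 'k where
  "\<tau> \<equiv> eps_trace sv Gv \<epsilon> pi_casimir"

abbreviation \<kappa> :: 'k where
  "\<kappa> \<equiv> eps_trace sv Gv \<epsilon> phi_casimir"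

lemma tau_eq: "\<tau> = (\<Sum>e\<in>E. Bv (pi_casimir (dual e)) e)"
  and kappa_eq: "\<kappa> = (\<Sum>e\<in>E. Bv (phi_casimir (dual e)) e)"
  by (intro eps_trace_eq_form linear_intros pi_linear_right
      bilinear_map_linear(1)[OF phi_bilinear])+

lemma pi_casimir_deg: "v \<in> Gv a \<Longrightarrow> pi_casimir v \<in> Gv a"
  and phi_casimir_deg: "v \<in> Gv a \<Longrightarrow> phi_casimir v \<in> Gv a"
  by (rule casimir_operator_deg[OF g.colour_form_axioms pi_so]
      casimir_operator_deg[OF colour_form_axioms phi_so]; assumption)+

lemma pi_casimir_selfadjoint: "v \<in> Gv a \<Longrightarrow> Bv (pi_casimir v) w = Bv v (pi_casimir w)"
  and phi_casimir_selfadjoint: "v \<in> Gv a \<Longrightarrow> Bv (phi_casimir v) w = Bv v (phi_casimir w)"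
  by (rule casimir_operator_selfadjoint[OF g.colour_form_axioms
      pi_linear_left pi_linear_right pi_so]
      casimir_operator_selfadjoint[OF colour_form_axioms
      bilinear_map_linear(2,1)[OF phi_bilinear] phi_so];
      assumption)+

lemma eps_trace_casimir_g:
  "eps_trace st Gt \<epsilon> (casimir_operator Bg X (\<lambda>x. brt (x, 0)))
      = eps_trace sg Gg \<epsilon> (casimir_operator Bg X brg) + \<tau>"
proof -
  let ?K = "casimir_operator Bg X (\<lambda>x. brt (x, 0))"
  have K: "?K (y, 0) = (casimir_operator Bg X brg y, 0)" "?K (0, u) = (0, pi_casimir u)" for y u
    by (simp_all add: casimir_operator_def bracket_gg bracket_gv prod_eq_iff fst_sum snd_sum)
  have "linear_map st st ?K"
    by (intro linear_intros t.vector_space bracket_linear)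
  moreover have "linear_map sg sg (casimir_operator Bg X brg)"
    by (intro linear_intros g.vector_space
        bilinear_map_linear[OF colour_lie_algebra_bilinear[OF lie_g]])
  ultimately show ?thesis
    by (simp add: eps_trace_pair g.eps_trace_eq_form tau_eq K form_simps g.form_simps)
qed

lemma form_pi_casimir_dual:
  assumes e: "e \<in> E"
  shows "(\<Sum>x\<in>X. - \<epsilon> (deg e) (g.deg x) * Bv (\<pi> (g.dual x) (dual e)) (\<pi> x e))
      = Bv (pi_casimir (dual e)) e"
proof -
  have "- \<epsilon> (deg e) (g.deg x) * Bv (\<pi> (g.dual x) (dual e)) (\<pi> x e)
      = Bv (dual e) (\<pi> (g.dual x) (\<pi> x e))"
    if x: "x \<in> X" for x
    unfolding so_eps_skew[OF pi_so[OF g.dual_deg[OF x]] dual_deg[OF e]] by (simp add: eps_simps)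
  then have "(\<Sum>x\<in>X. - \<epsilon> (deg e) (g.deg x) * Bv (\<pi> (g.dual x) (dual e)) (\<pi> x e))
      = Bv (dual e) (pi_casimir e)"
    by (simp add: casimir_operator_def form_simps)
  then show ?thesis
    by (simp only: pi_casimir_selfadjoint[OF dual_deg[OF e]])
qed

lemma sum_form_bracket_g:
  assumes e: "e \<in> E"
  shows "(\<Sum>x\<in>X. Bt (brt (0, dual e) (brt (0, e) (g.dual x, 0))) (x, 0))
      = Bv (pi_casimir (dual e)) e"
proof -
  have "(\<Sum>x\<in>X. Bt (brt (0, dual e) (brt (0, e) (g.dual x, 0))) (x, 0))
      = (\<Sum>x\<in>X. \<epsilon> (g.deg x) (g.deg x) * Bt (brt (0, dual e) (brt (0, e) (x, 0))) (g.dual x, 0))"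
    by (rule g.sum_dual_flip[symmetric]) (intro bilinear_mapI linear_intros)
  also have "\<dots> = (\<Sum>x\<in>X. - \<epsilon> (deg e) (g.deg x) * Bv (\<pi> (g.dual x) (dual e)) (\<pi> x e))"
  proof (intro sum.cong refl)
    fix x assume x: "x \<in> X"
    have mem: "\<mu> (dual e) (\<pi> x e) \<in> Gg (- deg e + (g.deg x + deg e))"
      by (intro moment_deg dual_deg e so_eps_deg[OF pi_so[OF g.basis_deg[OF x]] basis_deg[OF e]])
    have "Bt (brt (0, dual e) (brt (0, e) (x, 0))) (g.dual x, 0)
        = - \<epsilon> (deg e) (g.deg x) * Bg (\<mu> (dual e) (\<pi> x e)) (g.dual x)"
      by (simp add: bracket_vg[OF basis_deg[OF e] g.basis_deg[OF x]] bracket_vv moment_simps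
          form_simps g.form_simps)
    also have "Bg (\<mu> (dual e) (\<pi> x e)) (g.dual x)
        = \<epsilon> (g.deg x) (g.deg x) * Bv (\<pi> (g.dual x) (dual e)) (\<pi> x e)"
      using g.form_swap_diagonal(1)[OF mem g.dual_deg[OF x]] by (simp add: moment_form)
    finally show "\<epsilon> (g.deg x) (g.deg x) * Bt (brt (0, dual e) (brt (0, e) (x, 0))) (g.dual x, 0)
        = - \<epsilon> (deg e) (g.deg x) * Bv (\<pi> (g.dual x) (dual e)) (\<pi> x e)"
      by (simp add: mult.left_commute)
  qed
  finally show ?thesis
    by (simp only: form_pi_casimir_dual[OF e])
qed

lemma sum_form_bracket_v:
  assumes e: "e \<in> E"
  shows "(\<Sum>f\<in>E. Bt (brt (0, dual e) (brt (0, e) (0, dual f))) (0, f))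
    = Bv (pi_casimir (dual e)) e + (\<Sum>f\<in>E. Bv (\<phi> (dual e) (\<phi> e (dual f))) f)"
proof -
  have "Bt (brt (0, dual e) (\<mu> e (dual f), 0)) (0, f)
      = (\<Sum>x\<in>X. Bv (\<pi> x e) (dual f) * (- \<epsilon> (deg e) (g.deg x) * Bv (\<pi> (g.dual x) (dual e)) f))" for f
  proof -
    have "Bt (brt (0, dual e) (\<mu> e (dual f), 0)) (0, f)
        = (\<Sum>x\<in>X. Bv (\<pi> x e) (dual f) * Bt (brt (0, dual e) (g.dual x, 0)) (0, f))"
      by (rule linear_moment_expansion) (intro linear_intros)
    then show ?thesis
      by (simp add: bracket_vg[OF dual_deg[OF e] g.dual_deg] eps_simps form_simps g.form_simps)
  qed
  then have "(\<Sum>f\<in>E. Bt (brt (0, dual e) (\<mu> e (dual f), 0)) (0, f))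
      = (\<Sum>f\<in>E. \<Sum>x\<in>X. Bv (\<pi> x e) (dual f) * (- \<epsilon> (deg e) (g.deg x) * Bv (\<pi> (g.dual x) (dual e)) f))"
    by simp
  also have "\<dots> = (\<Sum>x\<in>X. \<Sum>f\<in>E. Bv (\<pi> x e) (dual f)
      * (- \<epsilon> (deg e) (g.deg x) * Bv (\<pi> (g.dual x) (dual e)) f))"
    by (rule sum.swap)
  also have "\<dots> = (\<Sum>x\<in>X. - \<epsilon> (deg e) (g.deg x) * Bv (\<pi> (g.dual x) (dual e)) (\<pi> x e))"
    by (intro sum.cong refl linear_expansion linear_intros)
  also have "\<dots> = Bv (pi_casimir (dual e)) e"
    by (rule form_pi_casimir_dual[OF e])
  finally show ?thesis
    by (simp add: bracket_vv bracket_pair_right[of _ "\<mu> _ _" "\<phi> _ _"] t.form_simps sum.distrib)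
      (simp add: g.form_simps)
qed

lemma eps_trace_casimir_v:
  "eps_trace st Gt \<epsilon> (casimir_operator Bv E (\<lambda>v. brt (0, v))) = 2 * \<tau> + \<kappa>"
proof -
  have K: "Bt (casimir_operator Bv E (\<lambda>v. brt (0, v)) p) q
      = (\<Sum>e\<in>E. Bt (brt (0, dual e) (brt (0, e) p)) q)" for p q
    by (simp add: casimir_operator_def t.form_simps)
  have linear: "linear_map st st (casimir_operator Bv E (\<lambda>v. brt (0, v)))"
    by (intro linear_intros t.vector_space bracket_linear)
  have "eps_trace st Gt \<epsilon> (casimir_operator Bv E (\<lambda>v. brt (0, v)))
      = (\<Sum>e\<in>E. \<Sum>x\<in>X. Bt (brt (0, dual e) (brt (0, e) (g.dual x, 0))) (x, 0))
        + (\<Sum>e\<in>E. \<Sum>f\<in>E. Bt (brt (0, dual e) (brt (0, e) (0, dual f))) (0, f))"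
    unfolding eps_trace_pair[OF linear] K by (intro arg_cong2[of _ _ _ _ "(+)"] sum.swap)
  also have "\<dots> = \<tau> + (\<tau> + (\<Sum>e\<in>E. \<Sum>f\<in>E. Bv (\<phi> (dual e) (\<phi> e (dual f))) f))"
    by (simp add: sum_form_bracket_g sum_form_bracket_v tau_eq sum.distrib)
  also have "(\<Sum>e\<in>E. \<Sum>f\<in>E. Bv (\<phi> (dual e) (\<phi> e (dual f))) f) = \<kappa>"
    unfolding kappa_eq casimir_operator_def form_simps by (rule sum.swap)
  finally show ?thesis by simp
qed

theorem eps_trace_casimir_pair:
  "eps_trace st Gt \<epsilon> (casimir_operator Bt Y brt)
    = eps_trace sg Gg \<epsilon> (casimir_operator Bg X brg) + 3 * \<tau> + \<kappa>"
proof -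
  have "casimir_operator Bt Y brt = (\<lambda>p. casimir_operator Bg X (\<lambda>x. brt (x, 0)) p
      + casimir_operator Bv E (\<lambda>v. brt (0, v)) p)"
    by (rule ext) (rule casimir_operator_pair)
  then have "eps_trace st Gt \<epsilon> (casimir_operator Bt Y brt)
      = eps_trace st Gt \<epsilon> (casimir_operator Bg X (\<lambda>x. brt (x, 0)))
        + eps_trace st Gt \<epsilon> (casimir_operator Bv E (\<lambda>v. brt (0, v)))"
    by (simp add: t.eps_trace_add linear_intros t.vector_space bracket_linear)
  then show ?thesis
    by (simp add: eps_trace_casimir_g eps_trace_casimir_v)
qed

end

section \<open>The square of the cubic term\<close>

locale cubic_clifford =
  colour_lie_type_rep \<epsilon> sg Gg brg Bg sv Gv Bv \<pi> \<phi> X E Y + colour_clifford \<epsilon> sv Gv Bv E sA c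
  for \<epsilon> :: "'a::ab_group_add \<Rightarrow> 'a \<Rightarrow> 'k::field"
    and sg :: "'k \<Rightarrow> 'g::ab_group_add \<Rightarrow> 'g" and Gg brg Bg
    and sv :: "'k \<Rightarrow> 'v::ab_group_add \<Rightarrow> 'v" and Gv Bv \<pi> \<phi> X E Y
    and sA :: "'k \<Rightarrow> 'w::ring_1 \<Rightarrow> 'w" and c
begin

text \<open>\<open>12 \<psi>\<close>; as in \<open>lift\<close>, the denominator is cleared.\<close>

definition cubic :: 'w where
  "cubic = (\<Sum>e\<in>E. lift (\<phi> (dual e)) * c e)"

definition pi_contraction :: "'v \<Rightarrow> 'w" where
  "pi_contraction u = (\<Sum>x\<in>X. lift (\<pi> (g.dual x)) * c (\<pi> x u))"

definition cubic_commutator :: "'v \<Rightarrow> 'w" where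
  "cubic_commutator u = lift (\<phi> u) * cubic - cubic * lift (\<phi> u)"

lemma sum_moment:
  assumes "linear_map sg sA h"
  shows "(\<Sum>e\<in>E. \<Sum>f\<in>E. sA (k (- deg e - deg f)) (h (\<mu> (dual e) (dual f)) * (c f * c e)))
    = (\<Sum>x\<in>X. sA (k (- g.deg x)) (h (g.dual x) * lift (\<pi> x)))"
  using g.colour_form_axioms pi_so moment_form assms by (rule sum_moment_generators)

lemma sum_phi:
  assumes "linear_map sv sA h"
  shows "(\<Sum>e\<in>E. \<Sum>f\<in>E. h (\<phi> (dual e) (dual f)) * (c f * c e)) = (\<Sum>e\<in>E. h (dual e) * lift (\<phi> e))"
  using sum_moment_generators[OF colour_form_axioms phi_so form_phi_cyclic[OF basis_deg dual_deg]
      assms, where k = "\<lambda>_. 1"]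
  by simp

lemma cubic_anticommute_generator:
  assumes w: "w \<in> Gv b"
  shows "cubic * c w = - (c w * cubic) + sA 6 (lift (\<phi> w))"
proof -
  have summand: "lift (\<phi> (dual e)) * c e * c w = - (c w * (lift (\<phi> (dual e)) * c e))
      + (sA 4 (c (\<phi> w (dual e)) * c e) + sA 2 (sA (Bv e w) (lift (\<phi> (dual e)))))"
    if e: "e \<in> E" for e
  proof -
    have eps: "\<epsilon> (- deg e) b * - \<epsilon> (deg e) b = - 1"
      by (simp add: eps_simps)
    have phi: "sA (- \<epsilon> (deg e) b) (sA 4 (c (\<phi> (dual e) w)) * c e) = sA 4 (c (\<phi> w (dual e)) * c e)"
      by (simp add: phi_antisym[OF dual_deg[OF e] w] generator_simps scale_mult eps_simps
          mult.left_commute)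
    show ?thesis
      using twisted_commute_mult_right[OF algebra
          lift_commute_generator[OF phi_so[OF dual_deg[OF e]] w]
          generator_commute[OF basis_deg[OF e] w]]
      unfolding eps phi by (simp add: scale_mult)
  qed
  have "cubic * c w = - (c w * cubic)
      + (sA 4 (\<Sum>e\<in>E. c (\<phi> w (dual e)) * c e) + sA 2 (\<Sum>e\<in>E. sA (Bv e w) (lift (\<phi> (dual e)))))"
    by (simp only: cubic_def sum_distrib_left sum_distrib_right alg.scale_sum_right
        summand sum.distrib sum_negf cong: sum.cong)
  also have "(\<Sum>e\<in>E. sA (Bv e w) (lift (\<phi> (dual e)))) = lift (\<phi> w)"
    by (intro linear_dual_expansion[of sA "\<lambda>u. lift (\<phi> u)"] linear_intros)
  finally show ?thesis
    by (simp add: lift_def[of "\<phi> w", symmetric] flip: alg.scale_left_distrib)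
qed

lemma lift_commute_cubic:
  assumes f: "f \<in> so_eps sv Gv \<epsilon> Bv a"
  shows "lift f * cubic - cubic * lift f = sA 4 (\<Sum>e\<in>E. lift (\<lambda>v. f (\<phi> (dual e) v)
    - sv (\<epsilon> a (- deg e)) (\<phi> (dual e) (f v)) - \<phi> (f (dual e)) v) * c e)"
proof -
  let ?h = "\<lambda>e v. f (\<phi> (dual e) v) - sv (\<epsilon> a (- deg e)) (\<phi> (dual e) (f v))"
  have summand: "lift f * (lift (\<phi> (dual e)) * c e) = lift (\<phi> (dual e)) * c e * lift f
      + (sA 4 (lift (?h e) * c e) + sA 4 (sA (\<epsilon> a (- deg e)) (lift (\<phi> (dual e)) * c (f e))))"
    if e: "e \<in> E" for e
  proof -
    have eps: "\<epsilon> a (- deg e) * \<epsilon> a (deg e) = 1"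
      by (simp add: eps_simps)
    show ?thesis
      using twisted_commute_mult_left[OF algebra lift_commute_lift[OF f phi_so[OF dual_deg[OF e]]]
          lift_commute_generator[OF f basis_deg[OF e]]]
      unfolding eps by (simp add: scale_mult mult.commute)
  qed
  have "lift f * cubic = cubic * lift f + (sA 4 (\<Sum>e\<in>E. lift (?h e) * c e)
      + sA 4 (\<Sum>e\<in>E. sA (\<epsilon> a (- deg e)) (lift (\<phi> (dual e)) * c (f e))))"
    by (simp only: cubic_def sum_distrib_left sum_distrib_right alg.scale_sum_right
        summand sum.distrib cong: sum.cong)
  also have "(\<Sum>e\<in>E. sA (\<epsilon> a (- deg e)) (lift (\<phi> (dual e)) * c (f e)))
      = - (\<Sum>e\<in>E. lift (\<phi> (f (dual e))) * c e)"
    by (rule sum_dual_so_eps[OF _ f, of sA "\<lambda>p q. lift (\<phi> p) * c q"])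
      (intro bilinear_mapI linear_intros)
  finally show ?thesis
    by (simp add: lift_diff[of "?h _"] left_diff_distrib sum_subtractf alg.scale_right_diff_distrib)
qed

subsection \<open>Commutators with the cubic term: the Jacobi identity\<close>

lemma pi_contraction_reverse:
  assumes u: "u \<in> Gv a"
  shows "(\<Sum>x\<in>X. sA (\<epsilon> a (- g.deg x)) (c (\<pi> (g.dual x) u) * lift (\<pi> x)))
    = pi_contraction u - sA 4 (c (pi_casimir u))"
proof -
  have "lift (\<pi> (g.dual x)) * c (\<pi> x u)
      = sA (\<epsilon> a (g.deg x) * \<epsilon> (g.deg x) (g.deg x)) (c (\<pi> x u) * lift (\<pi> (g.dual x)))
        + sA 4 (c (\<pi> (g.dual x) (\<pi> x u)))" if x: "x \<in> X" for x
    using lift_commute_generator[OF pi_so[OF g.dual_deg[OF x]]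
        so_eps_deg[OF pi_so[OF g.basis_deg[OF x]] u]]
    by (simp add: eps_simps mult.commute)
  then have "pi_contraction u
      = (\<Sum>x\<in>X. sA (\<epsilon> a (g.deg x) * \<epsilon> (g.deg x) (g.deg x)) (c (\<pi> x u) * lift (\<pi> (g.dual x))))
        + sA 4 (c (pi_casimir u))"
    by (simp add: pi_contraction_def casimir_operator_def generator_simps sum.distrib
        alg.scale_sum_right)
  also have "(\<Sum>x\<in>X. sA (\<epsilon> a (g.deg x) * \<epsilon> (g.deg x) (g.deg x)) (c (\<pi> x u) * lift (\<pi> (g.dual x))))
      = (\<Sum>x\<in>X. sA (\<epsilon> a (- g.deg x)) (c (\<pi> (g.dual x) u) * lift (\<pi> x)))"
    by (rule g.sum_dual_flip_weighted) (intro bilinear_mapI linear_intros)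
  finally show ?thesis
    by simp
qed

lemma sum_lift_moment: "(\<Sum>e\<in>E. lift (\<pi> (\<mu> u (dual e))) * c e) = pi_contraction u"
proof -
  have "(\<Sum>e\<in>E. lift (\<pi> (\<mu> u (dual e))) * c e)
      = (\<Sum>e\<in>E. \<Sum>x\<in>X. sA (Bv (\<pi> x u) (dual e)) (lift (\<pi> (g.dual x)) * c e))"
    by (intro sum.cong refl linear_moment_expansion linear_intros)
  also have "\<dots> = (\<Sum>x\<in>X. \<Sum>e\<in>E. sA (Bv (\<pi> x u) (dual e)) (lift (\<pi> (g.dual x)) * c e))"
    by (rule sum.swap)
  also have "\<dots> = pi_contraction u"
    unfolding pi_contraction_def
    by (intro sum.cong refl linear_expansion linear_intros generator_linear)
  finally show ?thesis .
qed

lemma sum_pi_moment: "(\<Sum>e\<in>E. \<pi> (\<mu> u (dual e)) e) = pi_casimir u"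
proof -
  have "(\<Sum>e\<in>E. \<pi> (\<mu> u (dual e)) e) = (\<Sum>e\<in>E. \<Sum>x\<in>X. sv (Bv (\<pi> x u) (dual e)) (\<pi> (g.dual x) e))"
    by (intro sum.cong refl linear_moment_expansion pi_linear_left)
  also have "\<dots> = (\<Sum>x\<in>X. \<Sum>e\<in>E. sv (Bv (\<pi> x u) (dual e)) (\<pi> (g.dual x) e))"
    by (rule sum.swap)
  also have "\<dots> = pi_casimir u"
    unfolding casimir_operator_def by (intro sum.cong refl linear_expansion pi_linear_right)
  finally show ?thesis .
qed

lemma cubic_commutator_eq_pi_contraction:
  assumes u: "u \<in> Gv a"
  shows "cubic_commutator u = sA 12 (pi_contraction u) - sA 24 (c (pi_casimir u))"
proof -
  let ?outer = "\<Sum>e\<in>E. \<Sum>f\<in>E. sA (\<epsilon> a (- deg e - deg f)) (c (\<pi> (\<mu> (dual e) (dual f)) u)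
      * (c f * c e))"
  let ?inner = "\<Sum>e\<in>E. \<Sum>f\<in>E. c (\<pi> (\<mu> u (dual e)) (dual f)) * (c f * c e)"
  let ?swapped = "\<Sum>e\<in>E. \<Sum>f\<in>E. sA (\<epsilon> (- deg e) (- deg f)) (c (\<pi> (\<mu> u (dual f)) (dual e))
      * (c f * c e))"
  have "cubic_commutator u = sA 4 (\<Sum>e\<in>E. lift (\<lambda>v. \<phi> u (\<phi> (dual e) v)
      - sv (\<epsilon> a (- deg e)) (\<phi> (dual e) (\<phi> u v)) - \<phi> (\<phi> u (dual e)) v) * c e)"
    unfolding cubic_commutator_def by (rule lift_commute_cubic[OF phi_so[OF u]])
  also have "\<dots> = sA 4 (?outer + ?inner - ?swapped)"
  proof -
    have "\<phi> u (\<phi> (dual e) (dual f)) - sv (\<epsilon> a (- deg e)) (\<phi> (dual e) (\<phi> u (dual f)))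
        - \<phi> (\<phi> u (dual e)) (dual f)
        = sv (\<epsilon> a (- deg e - deg f)) (\<pi> (\<mu> (dual e) (dual f)) u) + \<pi> (\<mu> u (dual e)) (dual f)
          - sv (\<epsilon> (- deg e) (- deg f)) (\<pi> (\<mu> u (dual f)) (dual e))" if "e \<in> E" "f \<in> E" for e f
      using phi_jacobi[OF u dual_deg[OF that(1)] dual_deg[OF that(2)]]
      by (simp add: diff_right_commute)
    then show ?thesis
      by (simp add: lift_def sum_distrib_right generator_simps alg_simps sum.distrib sum_subtractf
          cong: sum.cong)
  qed
  also have "?outer = pi_contraction u - sA 4 (c (pi_casimir u))"
    unfolding pi_contraction_reverse[OF u, symmetric] by (rule sum_moment) (intro linear_intros)
  also have inner: "?inner = pi_contraction u"
    unfolding sum_lift_moment[symmetric] by (simp add: lift_def sum_distrib_right mult.assoc)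
  also have "?swapped = sA 2 (\<Sum>e\<in>E. c (\<pi> (\<mu> u (dual e)) e)) - ?inner"
    by (rule sum_swapped_generators) (intro bilinear_mapI linear_intros)
  also have "(\<Sum>e\<in>E. c (\<pi> (\<mu> u (dual e)) e)) = c (pi_casimir u)"
    by (simp flip: sum_pi_moment linear_map_sum[OF generator_linear])
  finally have "cubic_commutator u
      = sA 4 (pi_contraction u - sA 4 (c (pi_casimir u)) + pi_contraction u
      - (sA 2 (c (pi_casimir u)) - pi_contraction u))"
    by (simp only: inner)
  moreover have "sA 12 (pi_contraction u) = sA 4 (pi_contraction u) + sA 4 (pi_contraction u)
      + sA 4 (pi_contraction u)"
    "sA 24 (c (pi_casimir u)) = sA 16 (c (pi_casimir u)) + sA 8 (c (pi_casimir u))"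
    by (simp_all flip: alg.scale_left_distrib)
  ultimately show ?thesis
    by (simp add: alg.scale_right_distrib alg.scale_right_diff_distrib)
qed

lemma sum_cubic_commutator_pi:
  "(\<Sum>e\<in>E. cubic_commutator (dual e) * c e) = sA 12 (casimir (\<lambda>x. lift (\<pi> x)) Bg X) - sA (24 * \<tau>) 1"
proof -
  have "(\<Sum>e\<in>E. pi_contraction (dual e) * c e)
      = (\<Sum>x\<in>X. \<Sum>e\<in>E. lift (\<pi> (g.dual x)) * (c (\<pi> x (dual e)) * c e))"
    unfolding pi_contraction_def sum_distrib_right mult.assoc by (rule sum.swap)
  also have "\<dots> = casimir (\<lambda>x. lift (\<pi> x)) Bg X"
    by (simp add: casimir_def lift_def[of "\<pi> x" for x] sum_distrib_left)
  finally have "(\<Sum>e\<in>E. pi_contraction (dual e) * c e) = casimir (\<lambda>x. lift (\<pi> x)) Bg X" .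
  moreover have "(\<Sum>e\<in>E. c (pi_casimir (dual e)) * c e) = sA \<tau> 1"
    unfolding lift_def[symmetric]
    by (intro lift_selfadjoint linear_intros pi_linear_right pi_casimir_deg pi_casimir_selfadjoint)
  ultimately show ?thesis
    by (simp add: cubic_commutator_eq_pi_contraction[OF dual_deg] left_diff_distrib scale_mult
        sum_subtractf flip: alg.scale_sum_right)
qed

subsection \<open>Commutators with the cubic term: rotation of indices\<close>

lemma lift_phi_casimir: "lift phi_casimir = sA \<kappa> 1"
  by (intro lift_selfadjoint linear_intros bilinear_map_linear(1)[OF phi_bilinear] phi_casimir_deg
      phi_casimir_selfadjoint)

definition double_phi :: 'w where
  "double_phi = (\<Sum>e\<in>E. \<Sum>f\<in>E. lift (\<lambda>v. \<phi> (dual e) (\<phi> (dual f) v)) * (c f * c e))"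

lemma double_phi_contract:
  "(\<Sum>a\<in>E. \<Sum>b\<in>E. \<Sum>d\<in>E. sA (Bv b a) (c (\<phi> (dual a) (\<phi> (dual b) (dual d))) * c d)) = lift phi_casimir"
proof -
  have "(\<Sum>a\<in>E. \<Sum>b\<in>E. \<Sum>d\<in>E. sA (Bv b a) (c (\<phi> (dual a) (\<phi> (dual b) (dual d))) * c d))
      = (\<Sum>d\<in>E. \<Sum>a\<in>E. \<Sum>b\<in>E. sA (Bv b a) (c (\<phi> (dual a) (\<phi> (dual b) (dual d))) * c d))"
    by (rule sum_rotate)
  also have "\<dots> = (\<Sum>d\<in>E. \<Sum>a\<in>E. c (\<phi> (dual a) (\<phi> a (dual d))) * c d)"
    by (intro sum.cong refl linear_dual_expansion linear_intros)
  finally show ?thesis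
    by (simp add: lift_def casimir_operator_def generator_simps sum_distrib_right)
qed

lemma double_phi_reorder:
  assumes "a \<in> E" "b \<in> E" "d \<in> E"
  shows "c (\<phi> (dual a) (\<phi> (dual b) (dual d))) * c d * (c b * c a)
    = sA 2 (sA (Bv b a) (c (\<phi> (dual a) (\<phi> (dual b) (dual d))) * c d))
      + sA 2 (sA (Bv d a) (c (\<phi> (dual a) (\<phi> (dual d) (dual b))) * c b))
      - c (\<phi> (\<phi> (dual b) (dual d)) (dual a)) * c a * (c d * c b)"
proof -
  let ?y = "c (\<phi> (dual a) (\<phi> (dual b) (dual d)))"
  note a = basis_deg[OF assms(1)] and b = basis_deg[OF assms(2)] and d = basis_deg[OF assms(3)]
  note dual_a = dual_deg[OF assms(1)] and dual_b = dual_deg[OF assms(2)]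
    and dual_d = dual_deg[OF assms(3)]
  have "\<epsilon> (deg d) (deg a) * \<epsilon> (deg b) (deg a) * \<epsilon> (- deg a) (- deg b + - deg d) = 1"
    using eps_swap[of "deg a" "deg b"] eps_swap[of "deg a" "deg d"] unfolding eps_simps by algebra
  then have rotated: "sA (\<epsilon> (deg d) (deg a) * \<epsilon> (deg b) (deg a)) ?y
      = - c (\<phi> (\<phi> (dual b) (dual d)) (dual a))"
    by (simp add: phi_antisym[OF dual_a phi_deg[OF dual_b dual_d]] generator_simps)
  have "\<epsilon> (deg b) (deg a) * \<epsilon> (- deg b) (- deg d) * Bv d a = 1 * Bv d a"
    by (rule form_degree_cong[OF d a]) (simp add: eps_simps)
  then have swapped: "sA (\<epsilon> (deg b) (deg a) * Bv d a) ?y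
      = - sA (Bv d a) (c (\<phi> (dual a) (\<phi> (dual d) (dual b))))"
    by (simp add: phi_antisym[OF dual_b dual_d] phi_simps generator_simps mult_ac)
  have "?y * (c d * c b * c a) = sA (\<epsilon> (deg d) (deg a) * \<epsilon> (deg b) (deg a)) ?y * (c a * (c d * c b))
      + (sA 2 (sA (Bv b a) (?y * c d)) - sA 2 (sA (\<epsilon> (deg b) (deg a) * Bv d a) ?y * c b))"
    using twisted_commute_mult_right[OF algebra generator_commute[OF d a] generator_commute[OF b a]]
    by (simp add: alg_simps mult.left_commute)
  then show ?thesis
    unfolding rotated swapped by (simp add: scale_mult mult.assoc)
qed

lemma double_phi_eq: "double_phi = sA 4 (lift phi_casimir) - casimir (\<lambda>u. lift (\<phi> u)) Bv E"
proof -
  let ?contract = "\<lambda>a b d. sA (Bv b a) (c (\<phi> (dual a) (\<phi> (dual b) (dual d))) * c d)"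
  let ?rotate = "\<lambda>a b d. c (\<phi> (\<phi> (dual b) (dual d)) (dual a)) * c a * (c d * c b)"
  have "double_phi = (\<Sum>a\<in>E. \<Sum>b\<in>E. \<Sum>d\<in>E. sA 2 (?contract a b d) + sA 2 (?contract a d b)
      - ?rotate a b d)"
    by (simp only: double_phi_def lift_def sum_distrib_right double_phi_reorder cong: sum.cong)
  also have "\<dots> = sA 2 (\<Sum>a\<in>E. \<Sum>b\<in>E. \<Sum>d\<in>E. ?contract a b d) + sA 2 (\<Sum>a\<in>E. \<Sum>b\<in>E. \<Sum>d\<in>E. ?contract a d b)
      - (\<Sum>a\<in>E. \<Sum>b\<in>E. \<Sum>d\<in>E. ?rotate a b d)"
    by (simp only: sum.distrib sum_subtractf alg.scale_sum_right)
  also have "(\<Sum>a\<in>E. \<Sum>b\<in>E. \<Sum>d\<in>E. ?contract a d b) = (\<Sum>a\<in>E. \<Sum>b\<in>E. \<Sum>d\<in>E. ?contract a b d)"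
    by (intro sum.cong refl sum.swap)
  also have "(\<Sum>a\<in>E. \<Sum>b\<in>E. \<Sum>d\<in>E. ?contract a b d) = lift phi_casimir"
    by (rule double_phi_contract)
  also have "(\<Sum>a\<in>E. \<Sum>b\<in>E. \<Sum>d\<in>E. ?rotate a b d) = (\<Sum>b\<in>E. \<Sum>d\<in>E. \<Sum>a\<in>E. ?rotate a b d)"
    by (rule sum_rotate[symmetric])
  also have "\<dots> = (\<Sum>b\<in>E. \<Sum>d\<in>E. lift (\<phi> (\<phi> (dual b) (dual d))) * (c d * c b))"
    by (simp only: lift_def sum_distrib_right)
  also have "\<dots> = casimir (\<lambda>u. lift (\<phi> u)) Bv E"
    unfolding casimir_def by (rule sum_phi) (intro linear_intros)
  finally show ?thesis
    by (simp flip: alg.scale_left_distrib)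
qed

lemma sum_cubic_commutator_phi:
  "(\<Sum>e\<in>E. cubic_commutator (dual e) * c e) = sA (24 * \<kappa>) 1 - sA 12 (casimir (\<lambda>u. lift (\<phi> u)) Bv E)"
proof -
  let ?Q = "casimir (\<lambda>u. lift (\<phi> u)) Bv E"
  let ?swapped = "\<Sum>e\<in>E. \<Sum>f\<in>E. sA (\<epsilon> (- deg e) (- deg f))
      (lift (\<lambda>v. \<phi> (dual f) (\<phi> (dual e) v)) * (c f * c e))"
  have "(\<Sum>e\<in>E. cubic_commutator (dual e) * c e) = sA 4 (double_phi - ?swapped
      - (\<Sum>e\<in>E. \<Sum>f\<in>E. lift (\<phi> (\<phi> (dual e) (dual f))) * (c f * c e)))"
    by (simp add: cubic_commutator_def lift_commute_cubic[OF phi_so[OF dual_deg]] double_phi_def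
        lift_diff lift_scale scale_mult
        sum_distrib_right left_diff_distrib sum_subtractf mult.assoc flip: alg.scale_sum_right)
  also have "(\<Sum>e\<in>E. \<Sum>f\<in>E. lift (\<phi> (\<phi> (dual e) (dual f))) * (c f * c e)) = ?Q"
    unfolding casimir_def by (rule sum_phi) (intro linear_intros)
  also have "?swapped = sA 2 (\<Sum>e\<in>E. lift (\<lambda>v. \<phi> (dual e) (\<phi> e v))) - double_phi"
    unfolding double_phi_def by (rule sum_swapped_generators) (intro bilinear_mapI linear_intros)
  also have "(\<Sum>e\<in>E. lift (\<lambda>v. \<phi> (dual e) (\<phi> e v))) = lift phi_casimir"
    by (simp add: casimir_operator_def[abs_def] lift_sum)
  finally have "(\<Sum>e\<in>E. cubic_commutator (dual e) * c e)
      = sA 4 (sA 4 (sA \<kappa> 1) - ?Q - (sA 2 (sA \<kappa> 1) - (sA 4 (sA \<kappa> 1) - ?Q)) - ?Q)"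
    by (simp only: double_phi_eq lift_phi_casimir)
  moreover have "sA 12 ?Q = sA 4 ?Q + sA 4 ?Q + sA 4 ?Q"
    "sA (24 * \<kappa>) 1 = sA (16 * \<kappa>) 1 + sA (16 * \<kappa>) 1 - sA (8 * \<kappa>) 1"
    by (simp_all flip: alg.scale_left_distrib alg.scale_left_diff_distrib)
  ultimately show ?thesis
    by (simp add: alg.scale_right_diff_distrib)
qed

theorem cubic_square: "cubic * cubic = sA (18 * \<tau> + 6 * \<kappa>) 1 - sA 9 (casimir (\<lambda>x. lift (\<pi> x)) Bg X)"
proof -
  let ?R = "casimir (\<lambda>x. lift (\<pi> x)) Bg X" and ?Q = "casimir (\<lambda>u. lift (\<phi> u)) Bv E"
  let ?Z = "\<Sum>e\<in>E. cubic_commutator (dual e) * c e"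
  have summand: "cubic * (lift (\<phi> (dual e)) * c e) = sA 6 (lift (\<phi> (dual e)) * lift (\<phi> e))
      - lift (\<phi> (dual e)) * c e * cubic - cubic_commutator (dual e) * c e" if e: "e \<in> E" for e
  proof -
    have "cubic * (lift (\<phi> (dual e)) * c e) = lift (\<phi> (dual e)) * (cubic * c e)
        - cubic_commutator (dual e) * c e"
      by (simp add: cubic_commutator_def algebra_simps)
    then show ?thesis
      by (simp add: cubic_anticommute_generator[OF basis_deg[OF e]] alg_simps)
  qed
  have "cubic * cubic = (\<Sum>e\<in>E. cubic * (lift (\<phi> (dual e)) * c e))"
    by (subst (2) cubic_def) (rule sum_distrib_left)
  also have "\<dots> = sA 6 ?Q - (\<Sum>e\<in>E. lift (\<phi> (dual e)) * c e) * cubic - ?Z"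
    by (simp only: summand sum_subtractf casimir_def sum_distrib_right alg.scale_sum_right
        cong: sum.cong)
  finally have twice: "cubic * cubic = sA 6 ?Q - cubic * cubic - ?Z"
    by (simp only: cubic_def[symmetric])
  have "sA 4 (cubic * cubic) = sA 2 (cubic * cubic + cubic * cubic)"
    by (simp flip: alg.scale_left_distrib add: alg.scale_right_distrib)
  also have "\<dots> = sA 12 ?Q - sA 2 ?Z"
    by (subst (2) twice) (simp add: alg.scale_right_diff_distrib)
  also have "\<dots> = sA (24 * \<kappa>) 1 - sA 3 ?Z"
    using alg.scale_left_distrib[of 2 1 ?Z] by (simp add: sum_cubic_commutator_phi)
  also have "\<dots> = sA 4 (sA (18 * \<tau> + 6 * \<kappa>) 1 - sA 9 ?R)"
    by (simp add: sum_cubic_commutator_pi alg.scale_right_diff_distrib alg.scale_right_distrib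
        alg.scale_left_distrib)
  finally show ?thesis
    using four_nonzero alg.scale_left_imp_eq by blast
qed

end

section \<open>The square of the Dirac operator\<close>

text \<open>
  An algebra with the defining relations of \<open>U\<^sub>\<epsilon>(\<g> \<oplus> V) \<otimes> C\<^sub>\<epsilon>(V)\<close>; \<open>\<xi>\<close> and \<open>c\<close> stand for the two
  inclusions.
\<close>

locale cubic_dirac_algebra = cubic_clifford \<epsilon> sg Gg brg Bg sv Gv Bv \<pi> \<phi> X E Y sA c
  for \<epsilon> :: "'a::ab_group_add \<Rightarrow> 'a \<Rightarrow> 'k::field"
    and sg :: "'k \<Rightarrow> 'g::ab_group_add \<Rightarrow> 'g" and Gg brg Bg
    and sv :: "'k \<Rightarrow> 'v::ab_group_add \<Rightarrow> 'v" and Gv Bv \<pi> \<phi> X E Y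
    and sA :: "'k \<Rightarrow> 'w::ring_1 \<Rightarrow> 'w" and c +
  fixes \<xi> :: "'g \<times> 'v \<Rightarrow> 'w"
  assumes three_nonzero: "(3::'k) \<noteq> 0"
    and xi_linear: "linear_map st sA \<xi>"
    and xi_commute: "p \<in> Gt a \<Longrightarrow> q \<in> Gt b \<Longrightarrow> \<xi> p * \<xi> q = sA (\<epsilon> a b) (\<xi> q * \<xi> p) + \<xi> (brt p q)"
    and generator_commute_xi: "u \<in> Gv a \<Longrightarrow> p \<in> Gt b \<Longrightarrow> c u * \<xi> p = sA (\<epsilon> a b) (\<xi> p * c u)"
begin

declare linear_map_compose[OF xi_linear, linear_intros]

lemma mult_commute_xi:
  assumes "u * \<xi> p = sA k (\<xi> p * u)" and "v * \<xi> p = sA l (\<xi> p * v)"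
  shows "u * v * \<xi> p = sA (k * l) (\<xi> p * (u * v))"
  using twisted_commute_mult_right[OF algebra, of u "\<xi> p" k 0 v l 0] assms by simp

lemma lift_commute_xi:
  assumes f: "f \<in> so_eps sv Gv \<epsilon> Bv a" and p: "p \<in> Gt b"
  shows "lift f * \<xi> p = sA (\<epsilon> a b) (\<xi> p * lift f)"
proof -
  have "c (f (dual e)) * c e * \<xi> p = sA (\<epsilon> a b) (\<xi> p * (c (f (dual e)) * c e))" if e: "e \<in> E" for e
    using mult_commute_xi[OF generator_commute_xi[OF so_eps_deg[OF f dual_deg[OF e]] p]
        generator_commute_xi[OF basis_deg[OF e] p]]
    by (simp add: eps_simps mult.assoc)
  then show ?thesis
    by (simp add: lift_def sum_distrib_left sum_distrib_right alg.scale_sum_right)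
qed

lemma cubic_commute_xi:
  assumes p: "p \<in> Gt b"
  shows "cubic * \<xi> p = \<xi> p * cubic"
proof -
  have "lift (\<phi> (dual e)) * c e * \<xi> p = \<xi> p * (lift (\<phi> (dual e)) * c e)" if e: "e \<in> E" for e
    using mult_commute_xi[OF lift_commute_xi[OF phi_so[OF dual_deg[OF e]] p]
        generator_commute_xi[OF basis_deg[OF e] p]]
    by (simp add: eps_simps)
  then show ?thesis
    by (simp add: cubic_def sum_distrib_left sum_distrib_right)
qed

definition dirac :: 'w where
  "dirac = (\<Sum>e\<in>E. \<xi> (0, dual e) * c e)"

definition pi_coupling :: 'w where
  "pi_coupling = (\<Sum>x\<in>X. \<xi> (g.dual x, 0) * lift (\<pi> x))"

definition phi_coupling :: 'w where
  "phi_coupling = (\<Sum>e\<in>E. \<xi> (0, dual e) * lift (\<phi> e))"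

lemma sum_xi_bracket:
  "(\<Sum>e\<in>E. \<Sum>f\<in>E. \<xi> (brt (0, dual e) (0, dual f)) * (c f * c e)) = pi_coupling + phi_coupling"
proof -
  have "(\<Sum>e\<in>E. \<Sum>f\<in>E. \<xi> (\<mu> (dual e) (dual f), 0) * (c f * c e)) = pi_coupling"
    using sum_moment[of "\<lambda>x. \<xi> (x, 0)" "\<lambda>_. 1"]
    by (simp add: pi_coupling_def linear_intros g.vector_space)
  moreover have "(\<Sum>e\<in>E. \<Sum>f\<in>E. \<xi> (0, \<phi> (dual e) (dual f)) * (c f * c e)) = phi_coupling"
    unfolding phi_coupling_def by (rule sum_phi) (intro linear_intros)
  moreover have "\<xi> (brt (0, u) (0, v)) = \<xi> (\<mu> u v, 0) + \<xi> (0, \<phi> u v)" for u v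
    by (simp add: bracket_vv flip: linear_map_add[OF xi_linear])
  ultimately show ?thesis
    by (simp add: distrib_right sum.distrib)
qed

lemma dirac_square_eq_sum:
  "dirac * dirac
    = (\<Sum>e\<in>E. \<Sum>f\<in>E. sA (\<epsilon> (- deg e) (- deg f)) (\<xi> (0, dual f) * \<xi> (0, dual e) * (c f * c e)))"
proof -
  have summand: "\<xi> (0, dual f) * c f * (\<xi> (0, dual e) * c e)
      = sA (\<epsilon> (- deg e) (- deg f)) (\<xi> (0, dual f) * \<xi> (0, dual e) * (c f * c e))"
    if "e \<in> E" "f \<in> E" for e f
  proof -
    have "c f * \<xi> (0, dual e) = sA (\<epsilon> (- deg e) (- deg f)) (\<xi> (0, dual e) * c f)"
      using generator_commute_xi[OF basis_deg[OF that(2)], of "(0, dual e)" "- deg e"]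
          dual_deg[OF that(1)]
      by (simp add: eps_simps)
    then have "\<xi> (0, dual f) * (c f * \<xi> (0, dual e)) * c e
        = \<xi> (0, dual f) * sA (\<epsilon> (- deg e) (- deg f)) (\<xi> (0, dual e) * c f) * c e"
      by simp
    then show ?thesis
      by (simp add: scale_mult mult.assoc)
  qed
  have "dirac * dirac = (\<Sum>f\<in>E. \<Sum>e\<in>E. \<xi> (0, dual f) * c f * (\<xi> (0, dual e) * c e))"
    unfolding dirac_def by (rule sum_product)
  also have "\<dots> = (\<Sum>e\<in>E. \<Sum>f\<in>E. \<xi> (0, dual f) * c f * (\<xi> (0, dual e) * c e))"
    by (rule sum.swap)
  finally show ?thesis
    by (simp only: summand cong: sum.cong)
qed

lemma dirac_square:
  "sA 2 (dirac * dirac) = sA 2 (casimir (\<lambda>v. \<xi> (0, v)) Bv E) - pi_coupling - phi_coupling"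
proof -
  let ?ordered = "\<Sum>e\<in>E. \<Sum>f\<in>E. \<xi> (0, dual e) * \<xi> (0, dual f) * (c f * c e)"
  have "dirac * dirac = sA 2 (\<Sum>e\<in>E. \<xi> (0, dual e) * \<xi> (0, e)) - ?ordered"
    unfolding dirac_square_eq_sum
    by (rule sum_swapped_generators) (intro bilinear_mapI linear_intros)
  moreover have "?ordered = dirac * dirac + (pi_coupling + phi_coupling)"
  proof -
    have summand: "\<xi> (0, dual e) * \<xi> (0, dual f) * (c f * c e)
        = sA (\<epsilon> (- deg e) (- deg f)) (\<xi> (0, dual f) * \<xi> (0, dual e) * (c f * c e))
          + \<xi> (brt (0, dual e) (0, dual f)) * (c f * c e)" if "e \<in> E" "f \<in> E" for e f
    proof -
      have "\<xi> (0, dual e) * \<xi> (0, dual f)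
          = sA (\<epsilon> (- deg e) (- deg f)) (\<xi> (0, dual f) * \<xi> (0, dual e))
          + \<xi> (brt (0, dual e) (0, dual f))"
        using that by (intro xi_commute) (simp_all add: dual_deg)
      then show ?thesis
        by (simp only: distrib_right scale_mult)
    qed
    show ?thesis
      by (simp only: summand dirac_square_eq_sum sum_xi_bracket[symmetric] sum.distrib
          cong: sum.cong)
  qed
  ultimately have "dirac * dirac + dirac * dirac
      = sA 2 (casimir (\<lambda>v. \<xi> (0, v)) Bv E) - pi_coupling - phi_coupling"
    by (simp add: casimir_def algebra_simps)
  then show ?thesis
    by (simp only: alg.scale_left_distrib alg.scale_one flip: one_add_one)
qed

lemma dirac_cubic_anticommutator: "dirac * cubic + cubic * dirac = sA 6 phi_coupling"
proof -
  have "cubic * (\<xi> (0, dual e) * c e) = sA 6 (\<xi> (0, dual e) * lift (\<phi> e))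
      - \<xi> (0, dual e) * c e * cubic"
    if e: "e \<in> E" for e
  proof -
    have "cubic * (\<xi> (0, dual e) * c e) = \<xi> (0, dual e) * (cubic * c e)"
      using cubic_commute_xi[of "(0, dual e)" "- deg e"] dual_deg[OF e] by (simp flip: mult.assoc)
    then show ?thesis
      by (simp add: cubic_anticommute_generator[OF basis_deg[OF e]] alg_simps)
  qed
  then show ?thesis
    by (simp add: dirac_def phi_coupling_def sum_distrib_left sum_distrib_right alg.scale_sum_right
        sum_subtractf)
qed

definition diagonal :: "'g \<Rightarrow> 'w" where
  "diagonal x = \<xi> (x, 0) + sA (1 / 4) (lift (\<pi> x))"

lemma diagonal_linear: "linear_map sg sA diagonal"
  unfolding diagonal_def[abs_def] by (intro linear_intros)

lemma diagonal_commute: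
  assumes x: "x \<in> Gg a" and y: "y \<in> Gg b"
  shows "diagonal x * diagonal y = sA (\<epsilon> a b) (diagonal y * diagonal x) + diagonal (brg x y)"
proof -
  have xi: "\<xi> (x, 0) * \<xi> (y, 0) = sA (\<epsilon> a b) (\<xi> (y, 0) * \<xi> (x, 0)) + \<xi> (brg x y, 0)"
    using xi_commute[of "(x, 0)" a "(y, 0)" b] x y by (simp add: bracket_gg)
  have lift_xi: "lift (\<pi> x) * \<xi> (y, 0) = sA (\<epsilon> a b) (\<xi> (y, 0) * lift (\<pi> x))"
    by (rule lift_commute_xi[OF pi_so[OF x]]) (simp add: y)
  have "lift (\<pi> y) * \<xi> (x, 0) = sA (\<epsilon> b a) (\<xi> (x, 0) * lift (\<pi> y))"
    by (rule lift_commute_xi[OF pi_so[OF y]]) (simp add: x)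
  then have xi_lift: "\<xi> (x, 0) * lift (\<pi> y) = sA (\<epsilon> a b) (lift (\<pi> y) * \<xi> (x, 0))"
    by simp
  have "\<pi> (brg x y) = (\<lambda>v. \<pi> x (\<pi> y v) - sv (\<epsilon> a b) (\<pi> y (\<pi> x v)))"
    by (rule ext) (rule pi_bracket[OF x y])
  then have lift_lift: "lift (\<pi> x) * lift (\<pi> y) = sA (\<epsilon> a b) (lift (\<pi> y) * lift (\<pi> x))
      + sA 4 (lift (\<pi> (brg x y)))"
    using lift_commute_lift[OF pi_so[OF x] pi_so[OF y]] by simp
  show ?thesis
    using four_nonzero
    by (simp add: diagonal_def alg_simps xi lift_xi xi_lift lift_lift mult_ac add_ac)
qed

lemma casimir_diagonal:
  "casimir diagonal Bg X = casimir (\<lambda>x. \<xi> (x, 0)) Bg X + sA (1 / 2) pi_coupling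
    + sA (1 / 16) (casimir (\<lambda>x. lift (\<pi> x)) Bg X)"
proof -
  have half: "1 / 4 + 1 / 4 = (1 / 2 :: 'k)"
    using two_nonzero four_nonzero by (simp add: field_simps)
  have "lift (\<pi> (g.dual x)) * \<xi> (x, 0)
      = sA (\<epsilon> (g.deg x) (g.deg x)) (\<xi> (x, 0) * lift (\<pi> (g.dual x)))"
    if x: "x \<in> X" for x
    using lift_commute_xi[OF pi_so[OF g.dual_deg[OF x]], of "(x, 0)" "g.deg x"] g.basis_deg[OF x]
    by (simp add: eps_simps)
  then have "(\<Sum>x\<in>X. lift (\<pi> (g.dual x)) * \<xi> (x, 0)) = pi_coupling"
    unfolding pi_coupling_def using g.sum_dual_flip[of sA "\<lambda>p q. \<xi> (p, 0) * lift (\<pi> q)"]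
    by (simp add: bilinear_mapI linear_intros g.vector_space)
  moreover have "casimir diagonal Bg X = casimir (\<lambda>x. \<xi> (x, 0)) Bg X + sA (1 / 4) pi_coupling
      + sA (1 / 4) (\<Sum>x\<in>X. lift (\<pi> (g.dual x)) * \<xi> (x, 0))
        + sA (1 / 16) (casimir (\<lambda>x. lift (\<pi> x)) Bg X)"
    by (simp add: casimir_def diagonal_def pi_coupling_def alg_simps sum.distrib
        alg.scale_sum_right)
  moreover have "sA (1 / 2) pi_coupling = sA (1 / 4) pi_coupling + sA (1 / 4) pi_coupling"
    by (simp only: half[symmetric] alg.scale_left_distrib)
  ultimately show ?thesis
    by (simp add: add.assoc)
qed

lemma casimir_xi_pair: "casimir \<xi> Bt Y = casimir (\<lambda>x. \<xi> (x, 0)) Bg X + casimir (\<lambda>v. \<xi> (0, v)) Bv E"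
  unfolding casimir_def by (rule sum_dual_pair[where r = sA]) (intro bilinear_mapI linear_intros)

theorem cubic_dirac_square:
  "(dirac + sA (1 / 12) cubic)\<^sup>2
    = casimir \<xi> Bt Y - casimir diagonal Bg X + sA (1 / 24 * (3 * \<tau> + \<kappa>)) 1"
proof -
  let ?V = "casimir (\<lambda>v. \<xi> (0, v)) Bv E" and ?R = "casimir (\<lambda>x. lift (\<pi> x)) Bg X"
  have nonzero: "(12::'k) \<noteq> 0" "(24::'k) \<noteq> 0" "(144::'k) \<noteq> 0" "(16::'k) \<noteq> 0"
    using two_nonzero three_nonzero four_nonzero mult_eq_0_iff[of "4::'k" 3]
      mult_eq_0_iff[of "12::'k" 2] mult_eq_0_iff[of "12::'k" 12] mult_eq_0_iff[of "4::'k" 4]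
    by simp_all
  have "dirac * dirac = sA (1 / 2) (sA 2 (dirac * dirac))"
    using two_nonzero by simp
  also have "\<dots> = ?V - sA (1 / 2) pi_coupling - sA (1 / 2) phi_coupling"
    unfolding dirac_square using two_nonzero by (simp add: alg.scale_right_diff_distrib)
  finally have square: "dirac * dirac = ?V - sA (1 / 2) pi_coupling - sA (1 / 2) phi_coupling" .
  have scalars: "1 / 12 * 6 = (1 / 2 :: 'k)" "1 / 12 * (1 / 12) * 9 = (1 / 16 :: 'k)"
    "1 / 12 * (1 / 12) * (18 * \<tau> + 6 * \<kappa>) = 1 / 24 * (3 * \<tau> + \<kappa>)"
    using nonzero two_nonzero by (simp_all add: field_simps)
  have "(dirac + sA (1 / 12) cubic)\<^sup>2 = dirac * dirac + sA (1 / 12) (dirac * cubic + cubic * dirac)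
      + sA (1 / 12 * (1 / 12)) (cubic * cubic)"
    by (simp add: power2_eq_square alg_simps add_ac)
  also have "\<dots> = ?V - sA (1 / 2) pi_coupling - sA (1 / 2) phi_coupling
      + sA (1 / 12 * 6) phi_coupling
      + (sA (1 / 12 * (1 / 12) * (18 * \<tau> + 6 * \<kappa>)) 1 - sA (1 / 12 * (1 / 12) * 9) ?R)"
    by (simp only: square dirac_cubic_anticommutator cubic_square alg.scale_right_diff_distrib
        alg.scale_scale)
  finally show ?thesis
    unfolding scalars casimir_diagonal casimir_xi_pair by (simp add: algebra_simps)
qed

end

section \<open>Enveloping and Clifford algebras\<close>

lemma presented_algebra_rel: "presented_algebra s \<iota> R \<Longrightarrow> r \<in> R \<Longrightarrow> free_eval s \<iota> r = 0"
  using ideal_gen.base[of r R] unfolding presented_algebra_def by blast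

lemma presented_algebra_linear:
  assumes vs: "vector_space s" and pres: "presented_algebra sU \<iota> R" and R: "tensor_rels s \<subseteq> R"
  shows "linear_map s sU \<iota>"
proof -
  have alg: "algebra_over sU"
    using pres by (simp add: presented_algebra_def)
  have rel: "free_eval sU \<iota> r = 0" if "r \<in> tensor_rels s" for r
    using presented_algebra_rel[OF pres] R that by blast
  have "gen (x + y) - gen x - gen y \<in> tensor_rels s"
    "gen (s k x) - const k * gen x \<in> tensor_rels s" for x y k
    unfolding tensor_rels_def by blast+
  then have "\<iota> (x + y) = \<iota> x + \<iota> y" "\<iota> (s k x) = sU k (\<iota> x)" for x y k
    using rel[of "gen (x + y) - gen x - gen y"] rel[of "gen (s k x) - const k * gen x"]
    by (simp_all add: free_eval_simps[OF alg] scale_one_mult[OF alg] algebra_simps)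
  then show ?thesis
    by (simp add: Vector_Spaces.linear_iff vs algebra_over_vector_space[OF alg])
qed

definition enveloping_rels ::
  "('k::field \<Rightarrow> 'g::ab_group_add \<Rightarrow> 'g) \<Rightarrow> ('a \<Rightarrow> 'g set) \<Rightarrow> ('a \<Rightarrow> 'a \<Rightarrow> 'k) \<Rightarrow> ('g \<Rightarrow> 'g \<Rightarrow> 'g) \<Rightarrow>
   ('g, 'k) free_algebra set" where
  "enveloping_rels s G \<epsilon> br = tensor_rels s \<union>
     {gen x * gen y - const (\<epsilon> a b) * gen y * gen x - gen (br x y) |a b x y. x \<in> G a \<and> y \<in> G b}"

lemma enveloping_algebra_presented:
  "enveloping_algebra s G \<epsilon> br sU \<iota> \<Longrightarrow> presented_algebra sU \<iota> (enveloping_rels s G \<epsilon> br)"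
  by (simp add: enveloping_algebra_def enveloping_rels_def)

lemma enveloping_algebra_algebra: "enveloping_algebra s G \<epsilon> br sU \<iota> \<Longrightarrow> algebra_over sU"
  by (simp add: enveloping_algebra_def presented_algebra_def)

lemma enveloping_algebra_linear:
  "vector_space s \<Longrightarrow> enveloping_algebra s G \<epsilon> br sU \<iota> \<Longrightarrow> linear_map s sU \<iota>"
  by (rule presented_algebra_linear[OF _ enveloping_algebra_presented])
    (auto simp: enveloping_rels_def)

lemma enveloping_algebra_commute:
  assumes env: "enveloping_algebra s G \<epsilon> br sU \<iota>" and "x \<in> G a" "y \<in> G b"
  shows "\<iota> x * \<iota> y = sU (\<epsilon> a b) (\<iota> y * \<iota> x) + \<iota> (br x y)"
proof -
  note alg = enveloping_algebra_algebra[OF env]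
  have "gen x * gen y - const (\<epsilon> a b) * gen y * gen x - gen (br x y) \<in> enveloping_rels s G \<epsilon> br"
    using assms(2,3) unfolding enveloping_rels_def by blast
  from presented_algebra_rel[OF enveloping_algebra_presented[OF env] this] show ?thesis
    by (simp add: free_eval_simps[OF alg] scale_one_mult[OF alg] mult.assoc algebra_simps)
qed

lemma clifford_algebra_algebra: "clifford_algebra s G \<epsilon> B sC \<iota> \<Longrightarrow> algebra_over sC"
  by (simp add: clifford_algebra_def presented_algebra_def)

lemma clifford_algebra_linear:
  "vector_space s \<Longrightarrow> clifford_algebra s G \<epsilon> B sC \<iota> \<Longrightarrow> linear_map s sC \<iota>"
  unfolding clifford_algebra_def by (rule presented_algebra_linear[OF _ _ Un_upper1])

lemma clifford_algebra_commute:
  assumes cl: "clifford_algebra s G \<epsilon> B sC \<iota>" and "x \<in> G a" "y \<in> G b"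
  shows "\<iota> x * \<iota> y = sC (2 * B x y) 1 - sC (\<epsilon> a b) (\<iota> y * \<iota> x)"
proof -
  note alg = clifford_algebra_algebra[OF cl]
  have "free_eval sC \<iota> (gen x * gen y + const (\<epsilon> a b) * gen y * gen x - const (2 * B x y)) = 0"
    using assms(2,3) by (intro presented_algebra_rel[OF cl[unfolded clifford_algebra_def]]) blast
  then show ?thesis
    by (simp add: free_eval_simps[OF alg] scale_one_mult[OF alg] mult.assoc algebra_simps)
qed

lemma env_extension_casimir:
  assumes env: "enveloping_algebra s G \<epsilon> br sU \<iota>" and alg: "algebra_over sW"
    and f: "linear_map s sW f"
    and commute: "\<And>a b x y. x \<in> G a \<Longrightarrow> y \<in> G b \<Longrightarrow> f x * f y = sW (\<epsilon> a b) (f y * f x) + f (br x y)"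
  shows "env_extension sU \<iota> sW f (casimir \<iota> B X) = casimir f B X"
proof -
  have "f x * f y - sW (\<epsilon> a b) (f y * f x) - f (br x y) = 0" if "x \<in> G a" "y \<in> G b" for a b x y
    using commute[OF that] by simp
  then have "free_eval sW f r = 0" if "r \<in> enveloping_rels s G \<epsilon> br" for r
    using that by (auto simp: enveloping_rels_def tensor_rels_def free_eval_simps[OF alg]
        scale_one_mult[OF alg] linear_map_simps[OF f] mult.assoc simp del: right_minus_eq)
  note ext = env_extension_hom[OF enveloping_algebra_presented[OF env] alg this]
  show ?thesis
    by (simp add: casimir_def algebra_hom_simps[OF ext(1)] ext(2))
qed

lemma (in commutation) ad_extension_casimir:
  assumes lie: "colour_lie_algebra s G \<epsilon> br" and env: "enveloping_algebra s G \<epsilon> br sU \<iota>"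
  shows "ad_extension s br sU \<iota> (casimir \<iota> B X) = casimir_operator B X br"
proof -
  note vs = colour_lie_algebra_vector_space[OF lie]
  note br_linear = bilinear_map_linear[OF colour_lie_algebra_bilinear[OF lie]]
  note pres = enveloping_algebra_presented[OF env]
  have "br x (br y z) - s (\<epsilon> a b) (br y (br x z)) - br (br x y) z = 0" if "x \<in> G a" "y \<in> G b"
      for a b x y z
    using colour_lie_algebra_leibniz[OF lie that] by simp
  then have "word_action s br r z = 0" if "r \<in> enveloping_rels s G \<epsilon> br" for r z
    using that by (auto simp: enveloping_rels_def tensor_rels_def
        word_action_simps[OF vs br_linear(1)] word_action_mult[OF vs br_linear(1)]
        linear_map_simps[OF br_linear(2)] mult.assoc simp del: right_minus_eq)
  then have "\<exists>A. algebra_action sU s A \<and> (\<forall>x. A (\<iota> x) = br x)"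
    by (rule presented_algebra_ex_action[OF pres vs br_linear(1)])
  then obtain A where A: "algebra_action sU s A" "A (\<iota> x) = br x" for x
    by blast
  have "ad_extension s br sU \<iota> = A"
    unfolding ad_extension_def algebra_action_def[symmetric]
    by (intro the_equality presented_algebra_action_unique[OF pres _ A(1)]) (simp_all add: A)
  then show ?thesis
    by (simp add: fun_eq_iff casimir_def casimir_operator_def algebra_action_simps[OF A(1)] A(2))
qed

lemma prod_list_in_algebra_part:
  assumes "vector_space s" and "list_all2 (\<lambda>x j. x \<in> P j) xs is"
  shows "prod_list (map \<iota> xs) \<in> algebra_part s \<iota> P (sum_list is)"
proof -
  interpret vector_space s by fact
  show ?thesis
    unfolding algebra_part_def using assms(2) by (intro span_base) blast
qed

lemma generator_in_algebra_part:
  assumes "vector_space s" and "x \<in> P i"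
  shows "\<iota> x \<in> algebra_part s \<iota> P i"
  using prod_list_in_algebra_part[OF assms(1), of P "[x]" "[i]" \<iota>] assms(2) by simp

lemma one_in_algebra_part:
  assumes "vector_space s"
  shows "1 \<in> algebra_part s \<iota> P 0"
  using prod_list_in_algebra_part[OF assms, of P "[]" "[]" \<iota>] by simp

section \<open>The cubic Dirac operator\<close>

lemma numeral_nonzero:
  assumes "CHAR('k::field) \<noteq> 2" "CHAR('k) \<noteq> 3"
  shows "(2::'k) \<noteq> 0" and "(3::'k) \<noteq> 0"
proof -
  have "CHAR('k) \<noteq> 1"
    using of_nat_CHAR[where 'a = 'k] by auto
  moreover have "n = 1 \<or> n = 2 \<or> n = 3" if "n dvd 2 \<or> n dvd 3" for n :: nat
  proof -
    have "0 < n \<and> n \<le> 3"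
      using that by (auto dest: dvd_imp_le intro: Nat.gr0I)
    then show ?thesis by linarith
  qed
  ultimately have "\<not> CHAR('k) dvd 2" "\<not> CHAR('k) dvd 3"
    using assms by blast+
  then show "(2::'k) \<noteq> 0" "(3::'k) \<noteq> 0"
    using of_nat_eq_0_iff_char_dvd[of 2, where 'a = 'k]
        of_nat_eq_0_iff_char_dvd[of 3, where 'a = 'k] by simp_all
qed

locale cubic_dirac_tensor = colour_lie_type_rep \<epsilon> sg Gg brg Bg sv Gv Bv \<pi> \<phi> X E Y
  for \<epsilon> :: "'a::ab_group_add \<Rightarrow> 'a \<Rightarrow> 'k::field"
    and sg :: "'k \<Rightarrow> 'g::ab_group_add \<Rightarrow> 'g" and Gg brg Bg
    and sv :: "'k \<Rightarrow> 'v::ab_group_add \<Rightarrow> 'v" and Gv Bv \<pi> \<phi> X E Y +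
  fixes sUt :: "'k \<Rightarrow> 'ut::ring_1 \<Rightarrow> 'ut" and \<iota>Ut :: "'g \<times> 'v \<Rightarrow> 'ut"
    and sC :: "'k \<Rightarrow> 'c::ring_1 \<Rightarrow> 'c" and \<iota>C :: "'v \<Rightarrow> 'c"
    and sW :: "'k \<Rightarrow> 'w::ring_1 \<Rightarrow> 'w" and tens :: "'ut \<Rightarrow> 'c \<Rightarrow> 'w"
  assumes two_nonzero: "(2::'k) \<noteq> 0" and three_nonzero: "(3::'k) \<noteq> 0"
    and enveloping_Ut: "enveloping_algebra st Gt \<epsilon> brt sUt \<iota>Ut"
    and clifford_C: "clifford_algebra sv Gv \<epsilon> Bv sC \<iota>C"
    and twisted: "twisted_tensor_algebra sUt (algebra_part sUt \<iota>Ut (z2_part 0 Gt))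
           sC (algebra_part sC \<iota>C (z2_part 1 Gv)) (eps_tilde \<epsilon>) sW tens"
begin

lemmas algebra_Ut = enveloping_algebra_algebra[OF enveloping_Ut]
lemmas algebra_C = clifford_algebra_algebra[OF clifford_C]

lemma algebra_W: "algebra_over sW" and tens_one: "tens 1 1 = 1"
  using twisted by (simp_all add: twisted_tensor_algebra_def)

lemma tens_bilinear: "bilinear_map sUt sC sW tens"
  using twisted unfolding twisted_tensor_algebra_def
  by (intro tensor_product_bilinear algebra_over_vector_space[OF algebra_Ut]
      algebra_over_vector_space[OF algebra_C]) blast

lemmas tens_linear = bilinear_map_linear[OF tens_bilinear]

lemmas tens_simps = linear_map_simps[OF tens_linear(1)] linear_map_simps[OF tens_linear(2)]

lemma tens_mult:
  assumes "b \<in> algebra_part sC \<iota>C (z2_part 1 Gv) (y, i)"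
      "q \<in> algebra_part sUt \<iota>Ut (z2_part 0 Gt) (0, j)"
  shows "tens p b * tens q d = sW (\<epsilon> i j) (tens (p * q) (b * d))"
  using twisted assms unfolding twisted_tensor_algebra_def by (fastforce simp: eps_tilde_def)

lemma scale_W_one [simp]: "sW 1 w = w"
  using algebra_over_vector_space[OF algebra_W] by (simp add: vector_space_def)

lemma one_part:
  "1 \<in> algebra_part sC \<iota>C (z2_part 1 Gv) (0, 0)" "1 \<in> algebra_part sUt \<iota>Ut (z2_part 0 Gt) (0, 0)"
  using one_in_algebra_part[OF algebra_over_vector_space[OF algebra_C], of \<iota>C "z2_part 1 Gv"]
    one_in_algebra_part[OF algebra_over_vector_space[OF algebra_Ut], of \<iota>Ut "z2_part 0 Gt"]
  by (simp_all add: zero_prod_def)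

lemma generator_part_C: "u \<in> Gv a \<Longrightarrow> \<iota>C u \<in> algebra_part sC \<iota>C (z2_part 1 Gv) (1, a)"
  by (rule generator_in_algebra_part[OF algebra_over_vector_space[OF algebra_C]])
    (simp add: z2_part_def)

lemma generator_part_Ut: "p \<in> Gt a \<Longrightarrow> \<iota>Ut p \<in> algebra_part sUt \<iota>Ut (z2_part 0 Gt) (0, a)"
  by (rule generator_in_algebra_part[OF algebra_over_vector_space[OF algebra_Ut]])
    (simp add: z2_part_def)

abbreviation \<xi> :: "'g \<times> 'v \<Rightarrow> 'w" where
  "\<xi> p \<equiv> tens (\<iota>Ut p) 1"

abbreviation c :: "'v \<Rightarrow> 'w" where
  "c v \<equiv> tens 1 (\<iota>C v)"

lemma tens_one_mult: "tens p b = tens p 1 * tens 1 b"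
  using tens_mult[OF one_part, of p b] by simp

lemma tens_xi_mult: "q \<in> Gt b \<Longrightarrow> tens p 1 * \<xi> q = tens (p * \<iota>Ut q) 1"
  using tens_mult[OF one_part(1) generator_part_Ut] by simp

lemma tens_generator_mult: "tens 1 (\<iota>C u * b) = c u * tens 1 b"
proof (rule linear_map_eqI_graded[OF graded, of sW "\<lambda>u. tens 1 (\<iota>C u * b)" "\<lambda>u. c u * tens 1 b"])
  note linear = clifford_algebra_linear[OF vector_space clifford_C]
  show "linear_map sv sW (\<lambda>u. tens 1 (\<iota>C u * b))" "linear_map sv sW (\<lambda>u. c u * tens 1 b)"
    by (intro linear_map_compose[OF tens_linear(1)] linear_intros algebra_C algebra_W linear)+
next
  show "tens 1 (\<iota>C v * b) = c v * tens 1 b" if "v \<in> Gv a" for a v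
    using tens_mult[OF generator_part_C[OF that] one_part(2), of 1 b] by simp
qed

sublocale cubic_dirac_algebra \<epsilon> sg Gg brg Bg sv Gv Bv \<pi> \<phi> X E Y sW c \<xi>
proof (intro cubic_dirac_algebra.intro cubic_clifford.intro colour_clifford.intro
    colour_clifford_axioms.intro cubic_dirac_algebra_axioms.intro)
  fix u v a b assume uv: "u \<in> Gv a" "v \<in> Gv b"
  show "c u * c v = sW (2 * Bv u v) 1 - sW (\<epsilon> a b) (c v * c u)"
    by (simp add: clifford_algebra_commute[OF clifford_C uv] tens_simps tens_one
        flip: tens_generator_mult)
next
  fix p q a b assume pq: "p \<in> Gt a" "q \<in> Gt b"
  show "\<xi> p * \<xi> q = sW (\<epsilon> a b) (\<xi> q * \<xi> p) + \<xi> (brt p q)"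
    unfolding tens_xi_mult[OF pq(1)] tens_xi_mult[OF pq(2)]
    by (simp add: enveloping_algebra_commute[OF enveloping_Ut pq] tens_simps)
next
  fix u p a b assume "u \<in> Gv a" "p \<in> Gt b"
  from tens_mult[OF generator_part_C[OF this(1)] generator_part_Ut[OF this(2)], of 1 1]
  show "c u * \<xi> p = sW (\<epsilon> a b) (\<xi> p * c u)"
    by (simp flip: tens_one_mult)
qed (intro colour_lie_type_rep_axioms colour_form_axioms algebra_W two_nonzero three_nonzero
    linear_map_compose[OF tens_linear(1)] linear_map_compose[OF tens_linear(2)]
    clifford_algebra_linear[OF vector_space clifford_C]
    enveloping_algebra_linear[OF t.vector_space enveloping_Ut])+

lemma tens_cubic_term: "tens 1 (cubic_term sC \<iota>C Bv \<phi> E) = sW (1 / 12) cubic"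
proof -
  have "(\<Sum>d\<in>E. sW (Bv (dual a) (\<phi> (dual b) (dual d))) (c d * (c b * c a)))
      = c (\<phi> (dual a) (dual b)) * (c b * c a)" if "a \<in> E" "b \<in> E" for a b
    unfolding form_phi_cyclic[OF dual_deg[OF that(1)] dual_deg[OF that(2)]]
    by (rule linear_expansion) (intro linear_intros generator_linear)
  then show ?thesis
    by (simp add: cubic_term_def cubic_def lift_def tens_simps tens_generator_mult sum_distrib_right
        mult.assoc)
qed

lemma cubic_dirac_eq: "cubic_dirac tens \<iota>Ut sC \<iota>C Bv \<phi> E = dirac + sW (1 / 12) cubic"
  by (simp add: cubic_dirac_def dirac_def tens_cubic_term flip: tens_one_mult)

lemma delta_map_eq: "delta_map tens \<iota>Ut sC \<iota>C Bv \<pi> E = diagonal"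
  by (rule ext)
    (simp add: delta_map_def diagonal_def pi_star_def lift_def tens_simps tens_generator_mult)

lemma tens_casimir: "tens (casimir \<iota>Ut Bt Y) 1 = casimir \<xi> Bt Y"
  using tens_xi_mult[OF t.basis_deg] by (simp add: casimir_def tens_simps)

theorem cubic_dirac_square_casimir:
  assumes env: "enveloping_algebra sg Gg \<epsilon> brg sU \<iota>U"
  shows "(cubic_dirac tens \<iota>Ut sC \<iota>C Bv \<phi> E)\<^sup>2 =
    tens (casimir \<iota>Ut Bt Y) 1
    - env_extension sU \<iota>U sW (delta_map tens \<iota>Ut sC \<iota>C Bv \<pi> E) (casimir \<iota>U Bg X)
    + sW (1 / 24 * (eps_trace st Gt \<epsilon> (ad_extension st brt sUt \<iota>Ut (casimir \<iota>Ut Bt Y))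
                    - eps_trace sg Gg \<epsilon> (ad_extension sg brg sU \<iota>U (casimir \<iota>U Bg X))))
        (tens 1 1)"
proof -
  have "env_extension sU \<iota>U sW diagonal (casimir \<iota>U Bg X) = casimir diagonal Bg X"
    using env algebra_W diagonal_linear diagonal_commute by (rule env_extension_casimir)
  moreover have "eps_trace st Gt \<epsilon> (ad_extension st brt sUt \<iota>Ut (casimir \<iota>Ut Bt Y))
      - eps_trace sg Gg \<epsilon> (ad_extension sg brg sU \<iota>U (casimir \<iota>U Bg X)) = 3 * \<tau> + \<kappa>"
    by (simp add: ad_extension_casimir[OF lie_t enveloping_Ut] ad_extension_casimir[OF lie_g env]
        eps_trace_casimir_pair)
  ultimately show ?thesis
    by (simp add: cubic_dirac_eq delta_map_eq tens_casimir tens_one cubic_dirac_square)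
qed

end

theorem theorem2:
  fixes \<epsilon> :: "'a::ab_group_add \<Rightarrow> 'a \<Rightarrow> 'k::field"
    and sg :: "'k \<Rightarrow> 'g::ab_group_add \<Rightarrow> 'g" and Gg :: "'a \<Rightarrow> 'g set"
    and brg :: "'g \<Rightarrow> 'g \<Rightarrow> 'g" and Bg :: "'g \<Rightarrow> 'g \<Rightarrow> 'k"
    and sv :: "'k \<Rightarrow> 'v::ab_group_add \<Rightarrow> 'v" and Gv :: "'a \<Rightarrow> 'v set"
    and Bv :: "'v \<Rightarrow> 'v \<Rightarrow> 'k"
    and \<pi> :: "'g \<Rightarrow> 'v \<Rightarrow> 'v" and \<phi> :: "'v \<Rightarrow> 'v \<Rightarrow> 'v"
    and st :: "'k \<Rightarrow> 'g \<times> 'v \<Rightarrow> 'g \<times> 'v" and Gt :: "'a \<Rightarrow> ('g \<times> 'v) set"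
    and brt :: "'g \<times> 'v \<Rightarrow> 'g \<times> 'v \<Rightarrow> 'g \<times> 'v" and Bt :: "'g \<times> 'v \<Rightarrow> 'g \<times> 'v \<Rightarrow> 'k"
    and X :: "'g set" and E :: "'v set" and Y :: "('g \<times> 'v) set"
    and sU :: "'k \<Rightarrow> 'u::ring_1 \<Rightarrow> 'u" and \<iota>U :: "'g \<Rightarrow> 'u"
    and sUt :: "'k \<Rightarrow> 'ut::ring_1 \<Rightarrow> 'ut" and \<iota>Ut :: "'g \<times> 'v \<Rightarrow> 'ut"
    and sC :: "'k \<Rightarrow> 'c::ring_1 \<Rightarrow> 'c" and \<iota>C :: "'v \<Rightarrow> 'c"
    and sW :: "'k \<Rightarrow> 'w::ring_1 \<Rightarrow> 'w" and tens :: "'ut \<Rightarrow> 'c \<Rightarrow> 'w"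
  assumes "CHAR('k) \<noteq> 2" and "CHAR('k) \<noteq> 3"
    and "commutation_factor \<epsilon>"
    and "eps_quadratic sg Gg \<epsilon> brg Bg"
    and "orthogonal_rep sg Gg \<epsilon> brg sv Gv Bv \<pi>"
    and "colour_lie_type sg Gg \<epsilon> brg Bg sv Gv Bv \<pi> \<phi>"
    and "st = ext_scale sg sv" and "Gt = ext_part Gg Gv"
    and "brt = ext_bracket Gg \<epsilon> brg Bg sv Gv Bv \<pi> \<phi>" and "Bt = ext_form Bg Bv"
    and "homogeneous_basis sg Gg X" and "homogeneous_basis sv Gv E" and "homogeneous_basis st Gt Y"
    and "vector_space.dim sv UNIV \<ge> 2"
    and "enveloping_algebra sg Gg \<epsilon> brg sU \<iota>U"
    and "enveloping_algebra st Gt \<epsilon> brt sUt \<iota>Ut"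
    and "clifford_algebra sv Gv \<epsilon> Bv sC \<iota>C"
    and "twisted_tensor_algebra sUt (algebra_part sUt \<iota>Ut (z2_part 0 Gt))
           sC (algebra_part sC \<iota>C (z2_part 1 Gv)) (eps_tilde \<epsilon>) sW tens"
  shows "(cubic_dirac tens \<iota>Ut sC \<iota>C Bv \<phi> E)\<^sup>2 =
    tens (casimir \<iota>Ut Bt Y) 1
    - env_extension sU \<iota>U sW (delta_map tens \<iota>Ut sC \<iota>C Bv \<pi> E) (casimir \<iota>U Bg X)
    + sW (1 / 24 * (eps_trace st Gt \<epsilon> (ad_extension st brt sUt \<iota>Ut (casimir \<iota>Ut Bt Y))
                    - eps_trace sg Gg \<epsilon> (ad_extension sg brg sU \<iota>U (casimir \<iota>U Bg X))))
        (tens 1 1)"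
proof -
  interpret cubic_dirac_tensor \<epsilon> sg Gg brg Bg sv Gv Bv \<pi> \<phi> X E Y sUt \<iota>Ut sC \<iota>C sW tens
    using assms numeral_nonzero[OF assms(1,2)] by unfold_locales simp_all
  show ?thesis
    unfolding assms(7-10) by (rule cubic_dirac_square_casimir[OF assms(15)])
qed

end
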